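(* Let $m\ge1$, $I\subset\{0,\dots,m\}$ nonempty, and $\mu\in X_*$ any cocharacter of $GSp_{2m}$. Then $\mathrm{Adm}_{GSp_{2m},I}(\mu)=\mathrm{Perm}_{GL_{2m},\pm I}(\mu)\cap\widetilde W/W_I$, where $\widetilde W/W_I$ is regarded as a subset of $\widetilde W_{GL_{2m}}/W_{GL_{2m},\pm I}$.
   Context: Notation: $(x^{(p)},y^{(q)})$ is $x$ repeated $p$ times then $y$ repeated $q$ times; $\mathbf b=(b,\dots,b)$. GL side: $\widetilde W_{GL_{2m}}=\mathbb Z^{2m}\rtimes S_{2m}$ acting on $\mathbb R^{2m}$ by affine transformations ($t_\lambda\sigma:x\mapsto\lambda+\sigma x$, $S_{2m}$ permuting coordinates). For $i=2mb+c$, $0\le c<2m$, $\omega_i=((-1)^{(c)},0^{(2m-c)})-\mathbf b$. $W_{GL_{2m},\pm I}$ is the stabilizer in $\widetilde W_{GL_{2m}}$ of all $\omega_i$ with $i\in2m\mathbb Z\pm I$ (integers congruent mod $2m$ to an element of $I\cup(-I)$). $\mathrm{Perm}_{GL_{2m},\pm I}(\mu)$ is the set of $\tilde w\in\widetilde W_{GL_{2m}}/W_{GL_{2m},\pm I}$ such that $\tilde w\cdot\omega_i-\omega_i\in\mathrm{Conv}(S_{2m}\mu)$ for all $i\in2m\mathbb Z\pm I$, where $\mathrm{Conv}(S_{2m}\mu)$ is the convex hull in $\mathbb R^{2m}$ of the $S_{2m}$-orbit of $\mu$. GSp side: $X_*=\{x\in\mathbb Z^{2m}:x_1+x_{2m}=\dots=x_m+x_{m+1}\}$,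 $V=X_*\otimes\mathbb R$, $S_{2m}^*=\{\sigma\in S_{2m}:\sigma(2m+1-j)=2m+1-\sigma(j)\ \forall j\}$, $\widetilde W=X_*\rtimes S_{2m}^*\subset\widetilde W_{GL_{2m}}$; affine Weyl group $W_a$ generated by the affine reflections of $V$ in $\widetilde W$ across the zero loci in $V$ of $x_i-x_j-k$ ($i<j$, $k\in\mathbb Z$); base alcove $A=\{x\in V:x_{2m}-1<x_1<\dots<x_m<x_{m+1}\}$ with stabilizer $\Omega$, $\widetilde W=W_a\rtimes\Omega$; Bruhat order: Coxeter Bruhat order on $W_a$ (simple reflections = reflections across walls of $A$), extended by $x\omega\le x'\omega'$ iff $\omega=\omega'$ and $x\le x'$. $W_I$ is the stabilizer in $\widetilde W$ of all $\omega_i$, $i\in2m\mathbb Z\pm I$; $W_I=\widetilde W\cap W_{GL_{2m},\pm I}$, so $\widetilde W/W_I$ injects into $\widetilde W_{GL_{2m}}/W_{GL_{2m},\pm I}$. Bruhat order on $\widetilde W/W_I$ via minimal-length representatives. $\mathrm{Adm}_{GSp_{2m},I}(\mu)$ is the set of $w\in\widetilde W/W_I$ with $w\le t_{\sigma\mu}W_I$ for some $\sigma\in S_{2m}^*$. *)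

theory Defs
  imports "HOL-Analysis.Analysis" "HOL-Combinatorics.Permutations"
begin

text \<open>Coordinates are indexed by 1..n (n = 2m).  Integer vectors are nat => int,
real vectors nat => real, both vanishing outside 1..n.  An element t_lam sigma of
the extended affine Weyl group is the pair (lam, sigma), acting by
x |-> lam + sigma x with (sigma x)_i = x_(sigma^-1 i).\<close>

type_synonym aw = "(nat \<Rightarrow> int) \<times> (nat \<Rightarrow> nat)"

definition aw_mult :: "aw \<Rightarrow> aw \<Rightarrow> aw" where
  "aw_mult w w' = ((\<lambda>i. fst w i + fst w' (inv (snd w) i)), snd w \<circ> snd w')"

definition aw_one :: aw where "aw_one = ((\<lambda>i. 0), id)"

definition aw_inv :: "aw \<Rightarrow> aw" where
  "aw_inv w = ((\<lambda>i. - fst w (snd w i)), inv (snd w))"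

definition aw_act :: "aw \<Rightarrow> (nat \<Rightarrow> real) \<Rightarrow> (nat \<Rightarrow> real)" where
  "aw_act w x = (\<lambda>i. real_of_int (fst w i) + x (inv (snd w) i))"

definition transl :: "(nat \<Rightarrow> int) \<Rightarrow> aw" where
  "transl lam = (lam, id)"

definition perm_vec :: "(nat \<Rightarrow> nat) \<Rightarrow> (nat \<Rightarrow> int) \<Rightarrow> (nat \<Rightarrow> int)" where
  "perm_vec \<sigma> lam = (\<lambda>i. lam (inv \<sigma> i))"

definition WGL :: "nat \<Rightarrow> aw set" where
  "WGL n = {w. snd w permutes {1..n} \<and> (\<forall>i. i \<notin> {1..n} \<longrightarrow> fst w i = 0)}"

definition omega :: "nat \<Rightarrow> int \<Rightarrow> (nat \<Rightarrow> real)" where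
  "omega n i = (\<lambda>j. if j \<in> {1..n}
       then (if int j \<le> i mod int n then -1 else 0) - real_of_int (i div int n)
       else 0)"

definition idx :: "nat \<Rightarrow> nat set \<Rightarrow> int set" where
  "idx n I = {i. \<exists>a\<in>I. i mod int n = int a mod int n \<or> i mod int n = (- int a) mod int n}"

definition stab_in :: "aw set \<Rightarrow> nat \<Rightarrow> nat set \<Rightarrow> aw set" where
  "stab_in G n I = {w \<in> G. \<forall>i\<in>idx n I. aw_act w (omega n i) = omega n i}"

definition WGL_pmI :: "nat \<Rightarrow> nat set \<Rightarrow> aw set" where
  "WGL_pmI n I = stab_in (WGL n) n I"

definition lcoset :: "aw \<Rightarrow> aw set \<Rightarrow> aw set" where
  "lcoset w H = {aw_mult w h | h. h \<in> H}"

definition quot :: "aw set \<Rightarrow> aw set \<Rightarrow> aw set set" where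
  "quot G H = {lcoset w H | w. w \<in> G}"

definition conv :: "(nat \<Rightarrow> real) set \<Rightarrow> (nat \<Rightarrow> real) set" where
  "conv S = {y. \<exists>F c. finite F \<and> F \<subseteq> S \<and> F \<noteq> {} \<and> (\<forall>v\<in>F. 0 \<le> c v) \<and> sum c F = 1
                 \<and> y = (\<lambda>j. \<Sum>v\<in>F. c v * v j)}"

definition of_int_vec :: "(nat \<Rightarrow> int) \<Rightarrow> (nat \<Rightarrow> real)" where
  "of_int_vec lam = (\<lambda>i. real_of_int (lam i))"

definition Perm_GL :: "nat \<Rightarrow> nat set \<Rightarrow> (nat \<Rightarrow> int) \<Rightarrow> aw set set" where
  "Perm_GL n I \<mu> = {C \<in> quot (WGL n) (WGL_pmI n I). \<exists>w\<in>C. \<forall>i\<in>idx n I.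
      (\<lambda>j. aw_act w (omega n i) j - omega n i j)
        \<in> conv {of_int_vec (perm_vec \<sigma> \<mu>) | \<sigma>. \<sigma> permutes {1..n}}}"

definition Xstar :: "nat \<Rightarrow> (nat \<Rightarrow> int) set" where
  "Xstar m = {x. (\<forall>i. i \<notin> {1..2*m} \<longrightarrow> x i = 0) \<and>
                 (\<forall>j\<in>{1..m}. x j + x (2*m+1-j) = x 1 + x (2*m))}"

text \<open>V = X_* tensor R, the real solution space of the same equations\<close>
definition Vsp :: "nat \<Rightarrow> (nat \<Rightarrow> real) set" where
  "Vsp m = {x. (\<forall>i. i \<notin> {1..2*m} \<longrightarrow> x i = 0) \<and>
                 (\<forall>j\<in>{1..m}. x j + x (2*m+1-j) = x 1 + x (2*m))}"

definition Sstar :: "nat \<Rightarrow> (nat \<Rightarrow> nat) set" where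
  "Sstar m = {\<sigma>. \<sigma> permutes {1..2*m} \<and> (\<forall>j\<in>{1..2*m}. \<sigma> (2*m+1-j) = 2*m+1 - \<sigma> j)}"

definition Wt :: "nat \<Rightarrow> aw set" where
  "Wt m = {w. fst w \<in> Xstar m \<and> snd w \<in> Sstar m}"

definition hyp :: "nat \<Rightarrow> nat \<Rightarrow> nat \<Rightarrow> int \<Rightarrow> (nat \<Rightarrow> real) set" where
  "hyp m i j k = {x \<in> Vsp m. x i - x j = real_of_int k}"

definition Hyps :: "nat \<Rightarrow> (nat \<Rightarrow> real) set set" where
  "Hyps m = {hyp m i j k | i j k. 1 \<le> i \<and> i < j \<and> j \<le> 2*m}"

text \<open>affine reflections of V lying in W~ : nontrivial on V, fixing pointwise one of the
hyperplanes (elements of W~ act on V by isometries, so these are exactly the reflections)\<close>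
definition Refl :: "nat \<Rightarrow> aw set" where
  "Refl m = {s \<in> Wt m. \<exists>H\<in>Hyps m. (\<forall>x\<in>H. aw_act s x = x) \<and> (\<exists>x\<in>Vsp m. aw_act s x \<noteq> x)}"

inductive_set Wa :: "nat \<Rightarrow> aw set" for m where
  Wa_one: "aw_one \<in> Wa m"
| Wa_step: "s \<in> Refl m \<Longrightarrow> w \<in> Wa m \<Longrightarrow> aw_mult s w \<in> Wa m"

definition alcove :: "nat \<Rightarrow> (nat \<Rightarrow> real) set" where
  "alcove m = {x \<in> Vsp m. x (2*m) - 1 < x 1 \<and> (\<forall>i\<in>{1..m}. x i < x (i+1))}"

definition Omega :: "nat \<Rightarrow> aw set" where
  "Omega m = {w \<in> Wt m. aw_act w ` alcove m = alcove m}"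

definition is_wall :: "nat \<Rightarrow> (nat \<Rightarrow> real) set \<Rightarrow> bool" where
  "is_wall m H \<longleftrightarrow> H \<in> Hyps m \<and>
     (\<exists>p\<in>H \<inter> closure (alcove m). \<forall>H'\<in>Hyps m. p \<in> H' \<longrightarrow> H' = H)"

definition Simple :: "nat \<Rightarrow> aw set" where
  "Simple m = {s \<in> Refl m. \<exists>H. is_wall m H \<and> (\<forall>x\<in>H. aw_act s x = x)}"

definition len :: "nat \<Rightarrow> aw \<Rightarrow> nat" where
  "len m w = (LEAST k. \<exists>ss. set ss \<subseteq> Simple m \<and> length ss = k \<and> foldr aw_mult ss aw_one = w)"

definition CoxRefl :: "nat \<Rightarrow> aw set" where
  "CoxRefl m = {aw_mult (aw_mult w s) (aw_inv w) | w s. w \<in> Wa m \<and> s \<in> Simple m}"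

definition bruhat_le :: "nat \<Rightarrow> aw \<Rightarrow> aw \<Rightarrow> bool" where
  "bruhat_le m x y \<longleftrightarrow> x \<in> Wa m \<and> y \<in> Wa m \<and>
     (x, y) \<in> {(u, aw_mult u t) | u t. u \<in> Wa m \<and> t \<in> CoxRefl m \<and> len m u < len m (aw_mult u t)}\<^sup>*"

text \<open>extension to W~ = W_a \<rtimes> Omega\<close>
definition ext_le :: "nat \<Rightarrow> aw \<Rightarrow> aw \<Rightarrow> bool" where
  "ext_le m w w' \<longleftrightarrow> (\<exists>x x' \<omega>. x \<in> Wa m \<and> x' \<in> Wa m \<and> \<omega> \<in> Omega m \<and>
       w = aw_mult x \<omega> \<and> w' = aw_mult x' \<omega> \<and> bruhat_le m x x')"

definition ext_len :: "nat \<Rightarrow> aw \<Rightarrow> nat" where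
  "ext_len m w = (LEAST k. \<exists>x \<omega>. x \<in> Wa m \<and> \<omega> \<in> Omega m \<and> w = aw_mult x \<omega> \<and> len m x = k)"

definition W_I :: "nat \<Rightarrow> nat set \<Rightarrow> aw set" where
  "W_I m I = stab_in (Wt m) (2*m) I"

definition minrep :: "nat \<Rightarrow> aw set \<Rightarrow> aw \<Rightarrow> bool" where
  "minrep m C w \<longleftrightarrow> w \<in> C \<and> (\<forall>w'\<in>C. ext_len m w \<le> ext_len m w')"

definition quot_le :: "nat \<Rightarrow> aw set \<Rightarrow> aw set \<Rightarrow> bool" where
  "quot_le m C C' \<longleftrightarrow> (\<exists>w w'. minrep m C w \<and> minrep m C' w' \<and> ext_le m w w')"

definition Adm :: "nat \<Rightarrow> nat set \<Rightarrow> (nat \<Rightarrow> int) \<Rightarrow> aw set set" where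
  "Adm m I \<mu> = {C \<in> quot (Wt m) (W_I m I). \<exists>\<sigma>\<in>Sstar m.
       quot_le m C (lcoset (transl (perm_vec \<sigma> \<mu>)) (W_I m I))}"

definition emb :: "nat \<Rightarrow> nat set \<Rightarrow> aw set \<Rightarrow> aw set" where
  "emb m I C = {aw_mult c h | c h. c \<in> C \<and> h \<in> WGL_pmI (2*m) I}"

end

theory Submission
  imports Defs "HOL-Algebra.Group"
begin

text \<open>
  Record an element \<open>w\<close> by the set of reflections whose hyperplanes separate the base alcove \<open>A\<close> from
  \<open>wA\<close>. This set is a cocycle, so its size is the length, and a reflection \<open>t\<close> increases \<open>x\<close> in the
  Bruhat order iff \<open>A\<close> and \<open>xA\<close> lie on the same side of the hyperplane of \<open>t\<close>. In that case \<open>x \<omega>\<^sub>i - \<omega>\<^sub>i\<close>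
  arises from \<open>tx \<omega>\<^sub>i - \<omega>\<^sub>i\<close> by at most two transfers between coordinates, so permissibility passes
  down, and admissible cosets are permissible.

  Conversely let \<open>x\<close> be permissible. Order the coordinates by decreasing displacement of the barycentre of
  \<open>A\<close> under \<open>x\<close> (that is, \<open>xA\<close> lies in the acute cone of this ordering), and let \<open>y\<close> be translation by
  the conjugate of \<open>\<mu>\<close> that is dominant for it. At each vertex \<open>i \<in> I\<close>, permissibility says that \<open>x \<omega>\<^sub>i\<close> is
  below \<open>y \<omega>\<^sub>i\<close> in the dominance order, and a combinatorial argument on partial sums connects the two by
  reflections in the positive direction. After a large dominant translation these reflections become
  increasing in the Bruhat order; since lengths add up in the acute cone the translation can be cancelled,
  and \<open>x \<le> y\<close> modulo the stabilizer of the vertex. Deodhar's lemma combines the vertices.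
\<close>

section \<open>Reflection cocycles and the Bruhat order\<close>

text \<open>The obstacle is that the vertices \<open>omega (2*m) i\<close> of the GL alcove need not
  lie in \<open>Vsp m\<close>: the sums of opposite coordinates of their images can take two
  consecutive values. A reflection of \<open>Wt m\<close> then moves the two halves of such a vector
  by different amounts, so dominance for GL does not simply restrict, and a reflection must be found
  that keeps all partial sums in range in both halves at once. It points upward in the cone of the
  chosen ordering, but seen from \<open>A\<close> it may decrease the length; this is what the large
  translation repairs. One key \<kappa> both sorts the coordinates and gives the direction of the
  translation: it is the displacement with a tie-break that makes it injective and keeps
  \<open>\<kappa> j + \<kappa> (opp m j)\<close> constant, so that the sorting permutation lies in
  \<open>Sstar m\<close>. In the same way the sorted rearrangement of \<mu>, taken over all
  permutations, is reached within \<open>Sstar m\<close>; hence the translation that dominates the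
  GL hull is one of those in \<open>Adm\<close>. The Bruhat theory uses only the cocycle, so it
  covers the length-zero elements of \<open>Omega m\<close> from the start.\<close>

locale reflection_cocycle = group G for G (structure) +
  fixes T S :: "'a set" and N :: "'a \<Rightarrow> 'a set"
  assumes T_carrier: "t \<in> T \<Longrightarrow> t \<in> carrier G"
    and S_T: "s \<in> S \<Longrightarrow> s \<in> T"
    and T_invol: "t \<in> T \<Longrightarrow> t \<otimes> t = \<one>"
    and T_conj: "\<lbrakk>g \<in> carrier G; t \<in> T\<rbrakk> \<Longrightarrow> inv g \<otimes> t \<otimes> g \<in> T"
    and N_T: "\<lbrakk>g \<in> carrier G; t \<in> N g\<rbrakk> \<Longrightarrow> t \<in> T"
    and N_finite: "g \<in> carrier G \<Longrightarrow> finite (N g)"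
    \<comment> \<open>A path from \<open>A\<close> to \<open>uwA\<close> may pass through
      \<open>uA\<close>; its second half is the \<open>u\<close>-image of a path from
      \<open>A\<close> to \<open>wA\<close>.\<close>
    and N_mult: "\<lbrakk>u \<in> carrier G; w \<in> carrier G; t \<in> T\<rbrakk>
      \<Longrightarrow> t \<in> N (u \<otimes> w) \<longleftrightarrow> (t \<in> N u) \<noteq> (inv u \<otimes> t \<otimes> u \<in> N w)"
    and N_simple: "s \<in> S \<Longrightarrow> N s = {s}"
    and N_self: "t \<in> T \<Longrightarrow> t \<in> N t"
    and descent: "\<lbrakk>w \<in> carrier G; N w \<inter> S = {}\<rbrakk> \<Longrightarrow> N w = {}"
begin

lemma inv_T: "t \<in> T \<Longrightarrow> inv t = t"
  using T_invol T_carrier inv_equality by blast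

lemma T_cancel [simp]: "\<lbrakk>t \<in> T; w \<in> carrier G\<rbrakk> \<Longrightarrow> t \<otimes> (t \<otimes> w) = w"
  using T_invol T_carrier by (simp add: m_assoc[symmetric])

lemma inv_mult_cancel [simp]: "\<lbrakk>u \<in> carrier G; w \<in> carrier G\<rbrakk> \<Longrightarrow> inv u \<otimes> (u \<otimes> w) = w"
  by (simp add: m_assoc[symmetric])

lemma mult_inv_cancel [simp]: "\<lbrakk>u \<in> carrier G; w \<in> carrier G\<rbrakk> \<Longrightarrow> u \<otimes> (inv u \<otimes> w) = w"
  by (simp add: m_assoc[symmetric])

lemma conj_T: "\<lbrakk>g \<in> carrier G; t \<in> T\<rbrakk> \<Longrightarrow> g \<otimes> t \<otimes> inv g \<in> T"
  using T_conj[of "inv g" t] by simp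

lemma N_one: "N \<one> = {}"
proof -
  have "t \<notin> N \<one>" for t
  proof
    assume t: "t \<in> N \<one>"
    have tT: "t \<in> T" using t N_T by blast
    \<comment> \<open>At \<open>u = w = \<one>\<close> the cocycle rule says that a proposition
      holds iff it differs from itself.\<close>
    show False using N_mult[of \<one> \<one> t] tT T_carrier[OF tT] t by simp
  qed
  thus ?thesis by blast
qed

lemma N_inv: "\<lbrakk>u \<in> carrier G; t \<in> T\<rbrakk> \<Longrightarrow> inv u \<otimes> t \<otimes> u \<in> N (inv u) \<longleftrightarrow> t \<in> N u"
  using N_mult[of u "inv u" t] N_one by simp

lemma N_smult: "\<lbrakk>s \<in> S; w \<in> carrier G; t \<in> T\<rbrakk> \<Longrightarrow> t \<in> N (s \<otimes> w) \<longleftrightarrow> (t = s) \<noteq> (s \<otimes> t \<otimes> s \<in> N w)"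
  using N_mult[of s w t] N_simple[of s] S_T[of s] T_carrier[of s] inv_T[of s] by simp

lemma s_in_smult: "\<lbrakk>s \<in> S; w \<in> carrier G\<rbrakk> \<Longrightarrow> s \<in> N (s \<otimes> w) \<longleftrightarrow> s \<notin> N w"
  using N_smult[of s w s] S_T T_invol T_carrier by simp

lemma t_in_tmult: "\<lbrakk>t \<in> T; w \<in> carrier G\<rbrakk> \<Longrightarrow> t \<in> N (t \<otimes> w) \<longleftrightarrow> t \<notin> N w"
  using N_mult[of t w t] T_invol T_carrier inv_T N_self by simp

definition ell :: "'a \<Rightarrow> nat" where "ell w = card (N w)"

lemma conj_invol: "\<lbrakk>s \<in> T; t \<in> T\<rbrakk> \<Longrightarrow> s \<otimes> (s \<otimes> t \<otimes> s) \<otimes> s = t"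
  using T_invol T_carrier by (simp add: m_assoc)

lemma sconj_T: "\<lbrakk>s \<in> T; t \<in> T\<rbrakk> \<Longrightarrow> s \<otimes> t \<otimes> s \<in> T"
  using T_conj[of s t] T_carrier inv_T by simp

text \<open>Conjugation by \<open>s\<close> carries \<open>N w\<close> injectively into
  \<open>N (s \<otimes> w)\<close> and misses only \<open>s\<close>.\<close>

lemma ell_up:
  assumes s: "s \<in> S" and w: "w \<in> carrier G" and n: "s \<notin> N w"
  shows "ell (s \<otimes> w) = Suc (ell w)"
proof -
  have sT: "s \<in> T" using s S_T by blast
  have sss: "s \<otimes> s \<otimes> s = s" using sT T_invol T_carrier by simp
  have eq: "N (s \<otimes> w) = insert s ((\<lambda>t. s \<otimes> t \<otimes> s) ` N w)" (is "_ = ?R")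
  proof (rule Set.set_eqI)
    fix t
    show "t \<in> N (s \<otimes> w) \<longleftrightarrow> t \<in> insert s ((\<lambda>t. s \<otimes> t \<otimes> s) ` N w)"
    proof (cases "t \<in> T")
      case True
      have "t \<in> (\<lambda>t. s \<otimes> t \<otimes> s) ` N w \<longleftrightarrow> s \<otimes> t \<otimes> s \<in> N w"
        using conj_invol[OF sT] N_T[OF w] True by (metis (no_types, lifting) image_iff)
      then show ?thesis using N_smult[OF s w True] sss n by auto
    next
      case False
      then show ?thesis using N_T[OF w] N_T[of "s \<otimes> w"] sT sconj_T T_carrier w by auto
    qed
  qed
  have inj: "inj_on (\<lambda>t. s \<otimes> t \<otimes> s) (N w)"
    using conj_invol[OF sT] N_T[OF w] by (metis (no_types, lifting) inj_onI)
  have "s \<notin> (\<lambda>t. s \<otimes> t \<otimes> s) ` N w"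
    using conj_invol[OF sT] N_T[OF w] n sss by (metis (no_types, lifting) imageE)
  then show ?thesis
    unfolding ell_def eq using N_finite[OF w] inj by (simp add: card_image)
qed

lemma ell_down: "\<lbrakk>s \<in> S; w \<in> carrier G; s \<in> N w\<rbrakk> \<Longrightarrow> ell w = Suc (ell (s \<otimes> w))"
  using ell_up[of s "s \<otimes> w"] s_in_smult[of s w] S_T T_carrier by simp

lemma ell_0: "w \<in> carrier G \<Longrightarrow> ell w = 0 \<longleftrightarrow> N w = {}"
  using N_finite by (simp add: ell_def)

lemma ell_inv:
  assumes w: "w \<in> carrier G"
  shows "ell (inv w) = ell w"
proof -
  have c: "t \<in> carrier G" if "u \<in> carrier G" "t \<in> N u" for t u
    using that N_T T_carrier by blast
  have "bij_betw (\<lambda>t. inv w \<otimes> t \<otimes> w) (N w) (N (inv w))"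
  proof (rule bij_betwI[where g="\<lambda>t. w \<otimes> t \<otimes> inv w"])
    show "(\<lambda>t. inv w \<otimes> t \<otimes> w) \<in> N w \<rightarrow> N (inv w)" using N_inv N_T w by blast
    show "(\<lambda>t. w \<otimes> t \<otimes> inv w) \<in> N (inv w) \<rightarrow> N w"
    proof
      fix t assume "t \<in> N (inv w)"
      then show "w \<otimes> t \<otimes> inv w \<in> N w" using N_inv[of "inv w" t] N_T[of "inv w" t] w by simp
    qed
    show "w \<otimes> (inv w \<otimes> t \<otimes> w) \<otimes> inv w = t" if "t \<in> N w" for t
      using c[OF w that] w by (simp add: m_assoc)
    show "inv w \<otimes> (w \<otimes> t \<otimes> inv w) \<otimes> w = t" if "t \<in> N (inv w)" for t
      using c[OF _ that] w by (simp add: m_assoc)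
  qed
  then show ?thesis by (simp add: ell_def bij_betw_same_card)
qed

lemma exists_descent: "\<lbrakk>w \<in> carrier G; N w \<noteq> {}\<rbrakk> \<Longrightarrow> \<exists>s\<in>S. s \<in> N w"
  using descent by blast

text \<open>Strip a left descent \<open>s\<close> of \<open>w\<close>. For
  \<open>t \<noteq> s\<close> the conjugate \<open>s \<otimes> t \<otimes> s\<close> lies in
  \<open>N (s \<otimes> w)\<close> and sends \<open>s \<otimes> w\<close> to
  \<open>s \<otimes> (t \<otimes> w)\<close>; putting \<open>s\<close> back costs at most
  one.\<close>

lemma ell_reflect_less: "\<lbrakk>w \<in> carrier G; t \<in> N w\<rbrakk> \<Longrightarrow> ell (t \<otimes> w) < ell w"
proof (induction "ell w" arbitrary: w t rule: less_induct)
  case less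
  have tT: "t \<in> T" using less N_T by blast
  obtain s where s: "s \<in> S" "s \<in> N w" using exists_descent less by blast
  have sT: "s \<in> T" using s S_T by blast
  have c: "s \<in> carrier G" "t \<in> carrier G" using sT tT T_carrier by auto
  note d = ell_down[OF s(1) less(2) s(2)]
  show ?case
  proof (cases "t = s")
    case True
    then show ?thesis using d by simp
  next
    case False
    have "s \<otimes> t \<otimes> s \<in> N (s \<otimes> w)"
      using N_smult[OF s(1) _ sconj_T[OF sT tT], of w] False less(2,3) conj_invol[OF sT tT]
        T_invol[OF sT] c by (metis T_cancel m_assoc m_closed r_one sT)
    then have "ell ((s \<otimes> t \<otimes> s) \<otimes> (s \<otimes> w)) < ell (s \<otimes> w)"
      using less(1)[of "s \<otimes> w"] d c less(2) by simp
    moreover have "(s \<otimes> t \<otimes> s) \<otimes> (s \<otimes> w) = s \<otimes> (t \<otimes> w)"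
      using c less(2) sT by (simp add: m_assoc)
    ultimately have 1: "ell (s \<otimes> (t \<otimes> w)) < ell (s \<otimes> w)" by simp
    have "ell (t \<otimes> w) \<le> Suc (ell (s \<otimes> (t \<otimes> w)))"
      using ell_up[OF s(1), of "t \<otimes> w"] ell_down[OF s(1), of "t \<otimes> w"] c less(2)
      by (cases "s \<in> N (t \<otimes> w)") auto
    then show ?thesis using 1 d by simp
  qed
qed

lemma ell_reflect_iff: "\<lbrakk>w \<in> carrier G; t \<in> T\<rbrakk> \<Longrightarrow> ell w < ell (t \<otimes> w) \<longleftrightarrow> t \<notin> N w"
  using ell_reflect_less[of w t] ell_reflect_less[of "t \<otimes> w" t] t_in_tmult[of t w] T_carrier by fastforce

text \<open>The condition \<open>t \<notin> N x\<close> replaces an increase in length; the two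
  agree by \<open>ell_reflect_iff\<close>. Reflections act on the left, so a length-zero factor on
  the right survives every step and the relation makes sense on the whole extended group.\<close>

inductive le :: "'a \<Rightarrow> 'a \<Rightarrow> bool" where
  le_refl: "x \<in> carrier G \<Longrightarrow> le x x"
| le_step: "\<lbrakk>x \<in> carrier G; t \<in> T; t \<notin> N x; le (t \<otimes> x) y\<rbrakk> \<Longrightarrow> le x y"

lemma le_carrier: "le x y \<Longrightarrow> x \<in> carrier G \<and> y \<in> carrier G"
  by (induction rule: le.induct) auto

lemma le_trans: "\<lbrakk>le x y; le y z\<rbrakk> \<Longrightarrow> le x z"
  by (induction rule: le.induct) (auto intro: le_step)

lemma le_up: "\<lbrakk>x \<in> carrier G; t \<in> T; t \<notin> N x\<rbrakk> \<Longrightarrow> le x (t \<otimes> x)"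
  using T_carrier by (auto intro!: le_step[of x t] le_refl)

lemma le_down: "\<lbrakk>x \<in> carrier G; t \<in> N x\<rbrakk> \<Longrightarrow> le (t \<otimes> x) x"
  using le_up[of "t \<otimes> x" t] t_in_tmult[of t x] T_carrier N_T by auto

lemma le_smult_step:
  assumes "x \<in> carrier G" "s \<in> S" "t \<in> T" "t \<noteq> s"
    and "s \<otimes> t \<otimes> s \<notin> N (s \<otimes> x)"
  shows "le (s \<otimes> x) (s \<otimes> (t \<otimes> x))"
proof -
  have sT: "s \<in> T" using assms S_T by blast
  have c: "s \<in> carrier G" "t \<in> carrier G" using sT assms T_carrier by auto
  have "le (s \<otimes> x) ((s \<otimes> t \<otimes> s) \<otimes> (s \<otimes> x))"
    using le_up[of "s \<otimes> x" "s \<otimes> t \<otimes> s"] sconj_T[OF sT assms(3)] assms c by simp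
  then show ?thesis using c assms sT by (simp add: m_assoc)
qed

text \<open>The cocycle rule for \<open>s \<otimes> x\<close>, evaluated at
  \<open>s \<otimes> t \<otimes> s\<close>, reduces to \<open>t \<in> N x\<close> as long as
  \<open>s \<otimes> t \<otimes> s \<noteq> s\<close>, that is, \<open>t \<noteq> s\<close>.\<close>

lemma lift_step:
  assumes "x \<in> carrier G" "s \<in> S" "t \<in> T" "t \<noteq> s" "t \<notin> N x"
  shows "le (s \<otimes> x) (s \<otimes> (t \<otimes> x))"
proof -
  have sT: "s \<in> T" using assms S_T by blast
  have c: "s \<in> carrier G" "t \<in> carrier G" using sT assms T_carrier by auto
  have "s \<otimes> t \<otimes> s \<noteq> s"
    using assms(4) c sT by (metis T_cancel T_invol m_assoc m_closed r_one)
  then have "s \<otimes> t \<otimes> s \<notin> N (s \<otimes> x)"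
    using N_smult[OF assms(2,1) sconj_T[OF sT assms(3)]] conj_invol[OF sT assms(3)] assms(5) by simp
  then show ?thesis using le_smult_step assms by blast
qed

text \<open>This and \<open>lift_right\<close> are the lifting property without any assumption on
  descents. A step by \<open>t = s\<close> is absorbed into the alternative; every other step is
  transported by \<open>lift_step\<close>.\<close>

lemma lift_left:
  assumes "le x y" "s \<in> S"
  shows "le (s \<otimes> x) y \<or> le (s \<otimes> x) (s \<otimes> y)"
  using assms
proof (induction rule: le.induct)
  case (le_refl x)
  then show ?case using S_T T_carrier le.le_refl by auto
next
  case (le_step x t y)
  show ?case
  proof (cases "t = s")
    case True
    then show ?thesis using le_step by blast
  next
    case False
    then show ?thesis using lift_step[of x s t] le_step le_trans by blast
  qed
qed

lemma lift_right:
  assumes "le x y" "s \<in> S"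
  shows "le (s \<otimes> x) (s \<otimes> y) \<or> le x (s \<otimes> y)"
  using assms
proof (induction rule: le.induct)
  case (le_refl x)
  then show ?case using S_T T_carrier le.le_refl by auto
next
  case (le_step x t y)
  then have sT: "s \<in> T" "s \<in> carrier G" using S_T T_carrier by auto
  show ?case
  proof (cases "t = s")
    case True
    have "le (s \<otimes> (t \<otimes> x)) (s \<otimes> y) \<or> le (t \<otimes> x) (s \<otimes> y)" using le_step by blast
    moreover have "le x (t \<otimes> x)" using le_up le_step by blast
    ultimately show ?thesis using True le_step(1) le_trans sT by auto
  next
    case False
    have "le x (t \<otimes> x)" using le_up le_step by blast
    then show ?thesis using False lift_step[of x s t] le_step le_trans by blast
  qed
qed

lemma le_length0_mult:
  assumes "le x y" "u \<in> carrier G" "N u = {}"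
  shows "le (u \<otimes> x) (u \<otimes> y)"
  using assms
proof (induction rule: le.induct)
  case (le_refl x)
  then show ?case by (simp add: le.le_refl)
next
  case (le_step x t y)
  have c: "t \<in> carrier G" using le_step T_carrier by blast
  let ?t = "u \<otimes> t \<otimes> inv u"
  have T: "?t \<in> T" using conj_T le_step by blast
  have e1: "inv u \<otimes> ?t \<otimes> u = t" using c le_step by (simp add: m_assoc)
  have e2: "?t \<otimes> (u \<otimes> x) = u \<otimes> (t \<otimes> x)" using c le_step by (simp add: m_assoc)
  have "?t \<notin> N (u \<otimes> x)" using N_mult[of u x ?t] T e1 le_step by simp
  then show ?case using le.le_step[of "u \<otimes> x" ?t] T e2 le_step by simp
qed

text \<open>The last hypothesis says that the lengths of \<open>u\<close> and \<open>x\<close> add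
  up. Hence a left descent \<open>s\<close> of \<open>u\<close> is one of
  \<open>u \<otimes> x\<close> too, both alternatives of \<open>lift_right\<close> give
  \<open>s \<otimes> (u \<otimes> x)\<close> below \<open>s \<otimes> (u \<otimes> y)\<close>, and
  \<open>u\<close> can be stripped letter by letter.\<close>

lemma le_left_cancel:
  assumes "u \<in> carrier G" "x \<in> carrier G" "y \<in> carrier G" "le (u \<otimes> x) (u \<otimes> y)"
    and "\<And>t. t \<in> N u \<Longrightarrow> inv u \<otimes> t \<otimes> u \<notin> N x"
  shows "le x y"
  using assms
proof (induction "ell u" arbitrary: u)
  case 0
  then have "N u = {}" using ell_0 by simp
  then have "N (inv u) = {}"
    using N_inv[of "inv u"] N_T[of "inv u"] 0 by (metis all_not_in_conv empty_iff inv_closed inv_inv)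
  then show ?case using le_length0_mult[OF 0(5), of "inv u"] 0 by (simp add: m_assoc[symmetric])
next
  case (Suc n)
  then obtain s where s: "s \<in> S" "s \<in> N u"
    using exists_descent[of u] ell_0[of u] by auto
  have sT: "s \<in> T" and c: "s \<in> carrier G" using s S_T T_carrier by auto
  have sux: "s \<in> N (u \<otimes> x)" using N_mult[of u x s] Suc s sT by simp
  have 1: "le (s \<otimes> (u \<otimes> x)) (s \<otimes> (u \<otimes> y))"
    using lift_right[OF Suc(6) s(1)] le_down[OF _ sux] Suc(3,4) le_trans by blast
  have 2: "n = ell (s \<otimes> u)" using ell_down[OF s(1) _ s(2)] Suc by simp
  show ?case
  proof (rule Suc(1)[of "s \<otimes> u"])
    show "n = ell (s \<otimes> u)" by fact
    show "le (s \<otimes> u \<otimes> x) (s \<otimes> u \<otimes> y)" using 1 c Suc by (simp add: m_assoc)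
    fix t assume t: "t \<in> N (s \<otimes> u)"
    then have tT: "t \<in> T" using N_T[of "s \<otimes> u" t] Suc c by simp
    have tc: "t \<in> carrier G" using tT T_carrier by simp
    have "t \<noteq> s" using t s s_in_smult Suc by blast
    then have "s \<otimes> t \<otimes> s \<in> N u" using t N_smult[of s u t] s tT Suc by blast
    from Suc(7)[OF this] show "inv (s \<otimes> u) \<otimes> t \<otimes> (s \<otimes> u) \<notin> N x"
      using c tc Suc inv_T[OF sT] by (simp add: inv_mult_group m_assoc)
  qed (use Suc c in auto)
qed

end

text \<open>Models the stabilizer \<open>P\<close> of a face of the base alcove. \<open>N_P\<close>:
  a hyperplane between \<open>A\<close> and \<open>hA\<close> contains the face.
  \<open>local_descent\<close>: the walls of \<open>A\<close> through the face already bound its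
  chamber for all hyperplanes through the face. \<open>length0_P\<close>: no nontrivial symmetry of
  \<open>A\<close> fixes the face. Stated this way, the axioms can be checked for a stabilizer
  without generators.\<close>

locale reflection_parabolic = reflection_cocycle G T S N + subgroup P G for G (structure) and T S N P +
  assumes N_P: "h \<in> P \<Longrightarrow> N h \<subseteq> P"
    and local_descent: "\<lbrakk>w \<in> carrier G; N w \<inter> S \<inter> P = {}\<rbrakk> \<Longrightarrow> N w \<inter> P = {}"
    and length0_P: "\<lbrakk>h \<in> P; N h = {}\<rbrakk> \<Longrightarrow> h = \<one>"
begin

text \<open>The minimal-length elements of the cosets \<open>xP\<close>.\<close>
definition reduced :: "'a \<Rightarrow> bool" where
  "reduced x \<longleftrightarrow> x \<in> carrier G \<and> N (inv x) \<inter> P = {}"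

lemma N_inv_P: "\<lbrakk>h \<in> P; t \<in> N (inv h)\<rbrakk> \<Longrightarrow> t \<in> P"
  using N_P[of "inv h"] by auto

text \<open>\<open>N (inv (u \<otimes> h))\<close> is the union of \<open>N (inv h)\<close>, which
  lies in \<open>P\<close>, and of the conjugate of \<open>N (inv u)\<close> by \<open>h\<close>,
  which avoids \<open>P\<close> because \<open>u\<close> is reduced; so no cancellation
  occurs.\<close>

lemma reduced_mult_ell:
  assumes "reduced u" "h \<in> P"
  shows "ell (u \<otimes> h) = ell u + ell h"
proof -
  have c: "u \<in> carrier G" "h \<in> carrier G" using assms by (auto simp: reduced_def)
  let ?f = "\<lambda>t. inv h \<otimes> t \<otimes> h"
  have inj: "inj_on ?f (N (inv u))"
  proof (rule inj_onI)
    fix r t assume "r \<in> N (inv u)" "t \<in> N (inv u)" and eq: "?f r = ?f t"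
    then have "r \<in> carrier G" "t \<in> carrier G" using N_T T_carrier c by blast+
    then show "r = t" using eq c by simp
  qed
  have disj: "N (inv h) \<inter> ?f ` N (inv u) = {}"
  proof -
    have False if "t \<in> N (inv u)" "?f t \<in> N (inv h)" for t
    proof -
      have "t \<in> carrier G" using that N_T T_carrier c by blast
      then have "t = h \<otimes> ?f t \<otimes> inv h" using c by (simp add: m_assoc)
      also have "\<dots> \<in> P" using that N_inv_P assms by simp
      finally show False using that assms by (auto simp: reduced_def)
    qed
    then show ?thesis by blast
  qed
  have "N (inv (u \<otimes> h)) = N (inv h) \<union> ?f ` N (inv u)"
  proof (rule Set.set_eqI)
    fix t
    show "t \<in> N (inv (u \<otimes> h)) \<longleftrightarrow> t \<in> N (inv h) \<union> ?f ` N (inv u)"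
    proof (cases "t \<in> T")
      case True
      have "t \<in> ?f ` N (inv u) \<longleftrightarrow> h \<otimes> t \<otimes> inv h \<in> N (inv u)"
      proof
        assume "t \<in> ?f ` N (inv u)"
        then obtain r where r: "r \<in> N (inv u)" "t = ?f r" by blast
        then have "r \<in> carrier G" using N_T T_carrier c by blast
        then show "h \<otimes> t \<otimes> inv h \<in> N (inv u)" using r c by (simp add: m_assoc)
      next
        assume "h \<otimes> t \<otimes> inv h \<in> N (inv u)"
        moreover have "t = ?f (h \<otimes> t \<otimes> inv h)" using True T_carrier c by (simp add: m_assoc)
        ultimately show "t \<in> ?f ` N (inv u)" by blast
      qed
      then show ?thesis
        using N_mult[of "inv h" "inv u" t] True c disj by (auto simp: inv_mult_group)
    next
      case False
      then show ?thesis using N_T[of "inv (u \<otimes> h)"] N_T[of "inv h"] N_T[of "inv u"] T_conj c by auto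
    qed
  qed
  then have "ell (inv (u \<otimes> h)) = ell (inv h) + ell (inv u)"
    using disj inj N_finite c by (simp add: ell_def card_Un_disjoint card_image)
  then show ?thesis using ell_inv c by simp
qed

text \<open>Right multiplication by a simple \<open>s\<close> in \<open>P\<close> that shortens
  \<open>x\<close> is left multiplication by the reflection
  \<open>x \<otimes> s \<otimes> inv x\<close>, hence a downward Bruhat step inside the
  coset.\<close>

lemma exists_reduced:
  assumes "x \<in> carrier G"
  shows "\<exists>u h. reduced u \<and> h \<in> P \<and> x = u \<otimes> h \<and> le u x"
  using assms
proof (induction "ell x" arbitrary: x rule: less_induct)
  case less
  show ?case
  proof (cases "reduced x")
    case True
    then show ?thesis using less le_refl by (intro exI[of _ x] exI[of _ \<one>]) auto
  next
    case False
    then obtain s where s: "s \<in> S" "s \<in> P" "s \<in> N (inv x)"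
      using local_descent[of "inv x"] less(2) by (auto simp: reduced_def)
    have sT: "s \<in> T" and c: "s \<in> carrier G" using s S_T T_carrier by auto
    have i: "inv (s \<otimes> inv x) = x \<otimes> s" using c less inv_T[OF sT] by (simp add: inv_mult_group)
    have l: "ell (x \<otimes> s) < ell x"
      using ell_down[OF s(1) _ s(3)] ell_inv[of "s \<otimes> inv x"] ell_inv[of x] c less i by simp
    have "x \<otimes> s \<otimes> inv x \<in> N x"
      using N_inv[of "inv x" s] s sT less by simp
    then have "le (x \<otimes> s \<otimes> inv x \<otimes> x) x" using le_down[of x] less by blast
    then have le: "le (x \<otimes> s) x" using c less by (simp add: m_assoc)
    from less(1)[OF l] obtain u h where u: "reduced u" "h \<in> P" "x \<otimes> s = u \<otimes> h" "le u (x \<otimes> s)"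
      using c less by auto
    have "x = x \<otimes> s \<otimes> s" using c less T_invol[OF sT] by (simp add: m_assoc)
    also have "\<dots> = u \<otimes> (h \<otimes> s)" using u c by (simp add: m_assoc reduced_def)
    finally show ?thesis using u le_trans[OF u(4) le] s
      by (intro exI[of _ u] exI[of _ "h \<otimes> s"]) auto
  qed
qed

lemma reduced_smult:
  assumes "reduced x" "s \<in> S" "s \<in> N x"
  shows "reduced (s \<otimes> x)"
proof -
  have sT: "s \<in> T" and c: "s \<in> carrier G" "x \<in> carrier G"
    using assms S_T T_carrier by (auto simp: reduced_def)
  have "t \<notin> N (inv (s \<otimes> x))" if "t \<in> P" for t
  proof
    assume t: "t \<in> N (inv (s \<otimes> x))"
    then have tT: "t \<in> T" using N_T c by blast
    have tc: "t \<in> carrier G" using tT T_carrier by blast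
    have "inv (s \<otimes> x) = inv x \<otimes> s" using c inv_T[OF sT] by (simp add: inv_mult_group)
    moreover have "t \<notin> N (inv x)" using assms that by (auto simp: reduced_def)
    ultimately have "x \<otimes> t \<otimes> inv x \<in> N s" using N_mult[of "inv x" s t] tT t c by simp
    then have "s = x \<otimes> t \<otimes> inv x" using N_simple assms by simp
    then have "inv x \<otimes> s \<otimes> x = t" using c tc by (simp add: m_assoc)
    then show False using N_inv[of x s] assms sT c \<open>t \<notin> N (inv x)\<close> by simp
  qed
  then show ?thesis using c by (auto simp: reduced_def)
qed

text \<open>Lifting for cosets, in a form where the branch is decided by \<open>N x\<close> alone
  and not by the subgroup \<open>P\<close>; this lets \<open>deodhar\<close> treat several subgroups
  with the same \<open>s\<close>.\<close>

lemma coset_lift: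
  assumes x: "x \<in> carrier G" and a: "a \<in> P" and le: "le (x \<otimes> a) v" and s: "s \<in> S"
  shows "\<exists>b\<in>P. if s \<in> N x then le (s \<otimes> x \<otimes> b) (s \<otimes> v) else le (x \<otimes> b) (s \<otimes> v)"
proof -
  have sT: "s \<in> T" and sc: "s \<in> carrier G" using s S_T T_carrier by auto
  have ac: "a \<in> carrier G" using a by auto
  obtain u h where u: "reduced u" "h \<in> P" "x \<otimes> a = u \<otimes> h" "le u (x \<otimes> a)"
    using exists_reduced[of "x \<otimes> a"] x ac by auto
  have uc: "u \<in> carrier G" "h \<in> carrier G" using u by (auto simp: reduced_def)
  define b where "b = a \<otimes> inv h"
  have bP: "b \<in> P" and bc: "b \<in> carrier G" using a u by (auto simp: b_def)
  have ux: "u = x \<otimes> b"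
  proof -
    have "x \<otimes> b = (x \<otimes> a) \<otimes> inv h" using x ac uc by (simp add: b_def m_assoc)
    then show ?thesis using u(3) uc by (simp add: m_assoc)
  qed
  have xu: "x = u \<otimes> inv b" using ux x bc by (simp add: m_assoc)
  have sN: "s \<in> N x \<longleftrightarrow> (s \<in> N u) \<noteq> (inv u \<otimes> s \<otimes> u \<in> N (inv b))"
    using N_mult[of u "inv b" s] uc bc sT xu by simp
  have L: "le (s \<otimes> u) (s \<otimes> v) \<or> le u (s \<otimes> v)" using lift_right[OF le_trans[OF u(4) le] s] .
  show ?thesis
  proof (cases "s \<in> N x")
    case True
    consider (1) "le (s \<otimes> u) (s \<otimes> v)" | (2) "le u (s \<otimes> v)" "s \<notin> N u" | (3) "le u (s \<otimes> v)" "s \<in> N u"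
      using L by argo
    then show ?thesis
    proof cases
      case 1
      then show ?thesis using True ux bP x bc sc by (intro bexI[of _ b]) (auto simp: m_assoc)
    next
      case 2
      \<comment> \<open>Here \<open>s\<close> separates for \<open>x\<close> but not for the reduced
        \<open>u\<close>, which forces \<open>?r\<close> into \<open>P\<close>: multiplication by
        \<open>s\<close> preserves the coset, and
        \<open>s \<otimes> x \<otimes> (b \<otimes> ?r)\<close> is \<open>u\<close> itself.\<close>
      let ?r = "inv u \<otimes> s \<otimes> u"
      have rP: "?r \<in> P" using 2 True sN N_inv_P[OF bP] by simp
      have rc: "?r \<in> carrier G" using uc sc by simp
      have "s \<otimes> x \<otimes> (b \<otimes> ?r) = s \<otimes> (x \<otimes> b \<otimes> ?r)" using x bc sc rc by (simp add: m_assoc del: inv_mult_cancel)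
      also have "\<dots> = s \<otimes> (u \<otimes> ?r)" using ux by simp
      also have "\<dots> = u" using uc sc sT by (simp add: m_assoc)
      finally show ?thesis using True 2 rP bP by (intro bexI[of _ "b \<otimes> ?r"]) auto
    next
      case 3
      have "le (s \<otimes> u) (s \<otimes> v)" using le_trans[OF le_down[OF uc(1) 3(2)] 3(1)] .
      then show ?thesis using True ux bP x bc sc by (intro bexI[of _ b]) (auto simp: m_assoc)
    qed
  next
    case False
    have "s \<notin> N u"
    proof
      assume su: "s \<in> N u"
      then have "inv u \<otimes> s \<otimes> u \<in> P" using False sN N_inv_P[OF bP] by simp
      then show False using su N_inv[of u s] uc sT u by (auto simp: reduced_def)
    qed
    then have "le u (s \<otimes> v)" using L le_up[of u s] uc sT le_trans by blast
    then show ?thesis using ux False bP by auto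
  qed
qed

lemma le_P: "le x y \<Longrightarrow> y \<in> P \<Longrightarrow> x \<in> P"
proof (induction rule: le.induct)
  case (le_step x t y)
  then have P: "t \<otimes> x \<in> P" by blast
  have "t \<in> N (t \<otimes> x)" using t_in_tmult le_step by blast
  then have "t \<in> P" using N_P[OF P] by blast
  then have "t \<otimes> (t \<otimes> x) \<in> P" using P by blast
  then show ?case using le_step by simp
qed

end

section \<open>Deodhar's lemma\<close>

context reflection_cocycle
begin

text \<open>Induction along left descents \<open>s\<close> of \<open>y\<close>: both
  \<open>s \<otimes> y\<close> and, if \<open>s \<in> N x\<close>, \<open>s \<otimes> x\<close> stay
  reduced for \<open>P\<close>, and \<open>coset_lift\<close> carries the comparison over for every
  \<open>i\<close> simultaneously. If \<open>y\<close> has length zero, \<open>le_P\<close> puts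
  \<open>inv x \<otimes> y\<close> into every \<open>Q i\<close>, hence into \<open>P\<close>, and
  additivity of lengths leaves only \<open>x = y\<close>.\<close>

lemma deodhar:
  assumes par: "\<And>i. i \<in> I \<Longrightarrow> reflection_parabolic G T S N (Q i)"
    and P: "reflection_parabolic G T S N P" and PQ: "P = (\<Inter>i\<in>I. Q i)" and "I \<noteq> {}"
    and "reflection_parabolic.reduced G N P x" "reflection_parabolic.reduced G N P y"
    and "\<And>i. i \<in> I \<Longrightarrow> \<exists>a\<in>Q i. \<exists>b\<in>Q i. le (x \<otimes> a) (y \<otimes> b)"
  shows "le x y"
  using assms(5-7)
proof (induction "ell y" arbitrary: x y)
  interpret P: reflection_parabolic G T S N P by fact
  case 0
  have c: "x \<in> carrier G" "y \<in> carrier G" using 0 by (auto simp: P.reduced_def)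
  have Ny: "N y = {}" using 0 c ell_0 by simp
  then have Niy: "N (inv y) = {}" using ell_0 ell_inv c by (metis inv_closed)
  have "inv x \<otimes> y \<in> Q i" if i: "i \<in> I" for i
  proof -
    interpret Qi: reflection_parabolic G T S N "Q i" using par i by blast
    obtain a b where ab: "a \<in> Q i" "b \<in> Q i" "le (x \<otimes> a) (y \<otimes> b)" using 0 i by blast
    have abc: "a \<in> carrier G" "b \<in> carrier G" using ab by auto
    obtain u h where u: "Qi.reduced u" "h \<in> Q i" "x \<otimes> a = u \<otimes> h" "le u (x \<otimes> a)"
      using Qi.exists_reduced[of "x \<otimes> a"] c abc by auto
    have "le u (y \<otimes> b)" using u ab le_trans by blast
    then have "le (inv y \<otimes> u) (inv y \<otimes> (y \<otimes> b))" using le_length0_mult Niy c by simp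
    then have "le (inv y \<otimes> u) b" using c abc by (simp add: m_assoc[symmetric])
    then have "inv y \<otimes> u \<in> Q i" using Qi.le_P ab by blast
    moreover have uc: "u \<in> carrier G" "h \<in> carrier G" using u by (auto simp: Qi.reduced_def)
    moreover have "inv y \<otimes> x = (inv y \<otimes> u) \<otimes> (h \<otimes> inv a)"
    proof -
      have "(inv y \<otimes> u) \<otimes> (h \<otimes> inv a) = inv y \<otimes> ((u \<otimes> h) \<otimes> inv a)" using c abc uc by (simp add: m_assoc)
      also have "\<dots> = inv y \<otimes> x" unfolding u(3)[symmetric] using c abc by (simp add: m_assoc)
      finally show ?thesis ..
    qed
    ultimately have "inv y \<otimes> x \<in> Q i" using u ab by simp
    then have "inv (inv y \<otimes> x) \<in> Q i" by blast
    then show ?thesis using c by (simp add: inv_mult_group)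
  qed
  then have "inv x \<otimes> y \<in> P" using PQ by blast
  moreover have "y = x \<otimes> (inv x \<otimes> y)" using c by (simp add: m_assoc[symmetric])
  ultimately have "ell y = ell x + ell (inv x \<otimes> y)" using P.reduced_mult_ell 0 by metis
  then have "inv x \<otimes> y = \<one>" using P.length0_P \<open>inv x \<otimes> y \<in> P\<close> 0 c ell_0 by simp
  then have "x = y" using c by (metis inv_equality inv_inv inv_closed)
  then show ?case using c le_refl by simp
next
  interpret P: reflection_parabolic G T S N P by fact
  case (Suc n)
  have c: "x \<in> carrier G" "y \<in> carrier G" using Suc by (auto simp: P.reduced_def)
  then obtain s where s: "s \<in> S" "s \<in> N y"
    using exists_descent[of y] ell_0[of y] Suc(2) by auto
  have sT: "s \<in> T" and sc: "s \<in> carrier G" using s S_T T_carrier by auto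
  have n: "n = ell (s \<otimes> y)" using ell_down[OF s(1) _ s(2)] Suc c by simp
  have ry: "P.reduced (s \<otimes> y)" using P.reduced_smult Suc s by blast
  have sy: "le (s \<otimes> y) y" using le_down c s by blast
  show ?case
  proof (cases "s \<in> N x")
    case True
    have rx: "P.reduced (s \<otimes> x)" using P.reduced_smult Suc s True by blast
    have "\<exists>a\<in>Q i. \<exists>b\<in>Q i. le (s \<otimes> x \<otimes> a) (s \<otimes> y \<otimes> b)" if i: "i \<in> I" for i
    proof -
      interpret Qi: reflection_parabolic G T S N "Q i" using par i by blast
      obtain a b where ab: "a \<in> Q i" "b \<in> Q i" "le (x \<otimes> a) (y \<otimes> b)" using Suc i by blast
      then show ?thesis using Qi.coset_lift[OF c(1) ab(1,3) s(1)] True c sc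
        by (auto simp: m_assoc)
    qed
    then have "le (s \<otimes> x) (s \<otimes> y)" using Suc(1)[OF n rx ry] by blast
    then have "le (s \<otimes> (s \<otimes> x)) (s \<otimes> y) \<or> le (s \<otimes> (s \<otimes> x)) (s \<otimes> (s \<otimes> y))"
      using lift_left s by blast
    then show ?thesis using sy le_trans sT c by auto
  next
    case False
    have "\<exists>a\<in>Q i. \<exists>b\<in>Q i. le (x \<otimes> a) (s \<otimes> y \<otimes> b)" if i: "i \<in> I" for i
    proof -
      interpret Qi: reflection_parabolic G T S N "Q i" using par i by blast
      obtain a b where ab: "a \<in> Q i" "b \<in> Q i" "le (x \<otimes> a) (y \<otimes> b)" using Suc i by blast
      then show ?thesis using Qi.coset_lift[OF c(1) ab(1,3) s(1)] False c sc
        by (auto simp: m_assoc)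
    qed
    then have "le x (s \<otimes> y)" using Suc(1)[OF n Suc(3) ry] by blast
    then show ?thesis using sy le_trans by blast
  qed
qed

end

section \<open>The affine group in coordinates\<close>

unbundle no m_inv_syntax

declare One_nat_def [simp del]

definition opp :: "nat \<Rightarrow> nat \<Rightarrow> nat" where "opp m j = 2*m+1-j"

text \<open>Denominator of the base point \<open>(1, \<dots>, 2m)/(2m+1)\<close>. With this choice
  the point is symmetric under \<open>opp\<close>, and \<open>1, \<dots>, 2m\<close> are distinct
  modulo \<open>per m\<close>.\<close>

definition per :: "nat \<Rightarrow> int" where "per m = 2 * int m + 1"

lemma opp_range [simp]: "j \<in> {1..2*m} \<Longrightarrow> opp m j \<in> {1..2*m}"
  by (auto simp: opp_def)

lemma opp_opp [simp]: "j \<in> {1..2*m} \<Longrightarrow> opp m (opp m j) = j"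
  by (auto simp: opp_def)

lemma opp_neq [simp]: "opp m j \<noteq> j" "j \<noteq> opp m j"
  by (auto simp: opp_def) presburger+

lemma opp_inj: "\<lbrakk>i \<in> {1..2*m}; j \<in> {1..2*m}\<rbrakk> \<Longrightarrow> opp m i = opp m j \<longleftrightarrow> i = j"
  by (auto simp: opp_def)

lemma opp_flip: "\<lbrakk>i \<in> {1..2*m}; j \<in> {1..2*m}\<rbrakk> \<Longrightarrow> opp m i = j \<longleftrightarrow> i = opp m j"
  by (auto simp: opp_def)

lemma int_opp: "j \<in> {1..2*m} \<Longrightarrow> int (opp m j) = per m - int j"
  by (auto simp: opp_def per_def)

lemma per_pos: "per m > 0" by (simp add: per_def)

lemma per_small:
  assumes "per m * x = d" "\<bar>d\<bar> < per m"
  shows "x = 0 \<and> d = 0"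
proof -
  have "x = 0"
  proof (rule ccontr)
    assume "x \<noteq> 0"
    then have "per m * 1 \<le> per m * \<bar>x\<bar>" using per_pos[of m] by (intro mult_left_mono) auto
    then show False using assms per_pos[of m] by (metis abs_mult abs_of_pos mult.right_neutral not_less)
  qed
  then show ?thesis using assms by simp
qed

lemma Sstar_permutes: "\<sigma> \<in> Sstar m \<Longrightarrow> \<sigma> permutes {1..2*m}"
  by (simp add: Sstar_def)

lemma Sstar_opp: "\<lbrakk>\<sigma> \<in> Sstar m; j \<in> {1..2*m}\<rbrakk> \<Longrightarrow> \<sigma> (opp m j) = opp m (\<sigma> j)"
  by (simp add: Sstar_def opp_def)

lemma Sstar_range: "\<lbrakk>\<sigma> \<in> Sstar m; j \<in> {1..2*m}\<rbrakk> \<Longrightarrow> \<sigma> j \<in> {1..2*m}"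
  using permutes_in_image[OF Sstar_permutes] by blast

lemma SstarI:
  assumes "\<sigma> permutes {1..2*m}" "\<And>j. j \<in> {1..2*m} \<Longrightarrow> \<sigma> (opp m j) = opp m (\<sigma> j)"
  shows "\<sigma> \<in> Sstar m"
  using assms by (simp add: Sstar_def opp_def)

lemma Sstar_id: "id \<in> Sstar m"
  by (auto intro!: SstarI permutes_id)

lemma Sstar_comp: "\<lbrakk>\<sigma> \<in> Sstar m; \<tau> \<in> Sstar m\<rbrakk> \<Longrightarrow> \<sigma> \<circ> \<tau> \<in> Sstar m"
  using permutes_compose[OF Sstar_permutes Sstar_permutes, of \<tau> m \<sigma>] Sstar_opp Sstar_range
  by (intro SstarI) (simp_all del: atLeastAtMost_iff)

lemma Sstar_inv: "\<sigma> \<in> Sstar m \<Longrightarrow> inv \<sigma> \<in> Sstar m"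
proof -
  assume s: "\<sigma> \<in> Sstar m"
  note p = Sstar_permutes[OF s]
  show ?thesis
  proof (rule SstarI[OF permutes_inv[OF p]])
    fix j assume j: "j \<in> {1..2*m}"
    then have r: "inv \<sigma> j \<in> {1..2*m}" using p by (metis permutes_in_image permutes_inv)
    have "\<sigma> (opp m (inv \<sigma> j)) = opp m j"
      using Sstar_opp[OF s r] permutes_inverses[OF p] by simp
    then show "inv \<sigma> (opp m j) = opp m (inv \<sigma> j)"
      using permutes_inverses[OF p] by metis
  qed
qed

lemma Xstar_zero: "\<lbrakk>l \<in> Xstar m; j \<notin> {1..2*m}\<rbrakk> \<Longrightarrow> l j = 0"
  by (simp add: Xstar_def)

lemma Xstar_pair:
  assumes "l \<in> Xstar m" "j \<in> {1..2*m}"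
  shows "l j + l (opp m j) = l 1 + l (2*m)"
proof (cases "j \<le> m")
  case True
  then show ?thesis using assms by (auto simp: Xstar_def opp_def)
next
  case False
  then have "opp m j \<in> {1..m}" using assms by (auto simp: opp_def)
  then have "l (opp m j) + l (2*m+1 - opp m j) = l 1 + l (2*m)" using assms by (auto simp: Xstar_def)
  moreover have "2*m+1 - opp m j = j" using opp_opp[OF assms(2)] by (simp add: opp_def)
  ultimately show ?thesis by simp
qed

lemma XstarI:
  assumes "\<And>j. j \<notin> {1..2*m} \<Longrightarrow> l j = 0"
    and "\<And>j. j \<in> {1..2*m} \<Longrightarrow> l j + l (opp m j) = c"
  shows "l \<in> Xstar m"
proof (cases "m = 0")
  case True
  then show ?thesis using assms by (auto simp: Xstar_def)
next
  case False
  then have "l 1 + l (2*m) = c" using assms(2)[of 1] by (simp add: opp_def)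
  then show ?thesis using assms by (auto simp: Xstar_def opp_def)
qed

text \<open>The similitude character. For \<open>m \<ge> 1\<close> it is a homomorphism on
  \<open>Wt m\<close>, and its kernel turns out to be \<open>Wa m\<close>.\<close>

definition cen :: "nat \<Rightarrow> aw \<Rightarrow> int" where "cen m w = fst w 1 + fst w (2*m)"

lemma Wt_fst: "w \<in> Wt m \<Longrightarrow> fst w \<in> Xstar m" by (simp add: Wt_def)
lemma Wt_snd: "w \<in> Wt m \<Longrightarrow> snd w \<in> Sstar m" by (simp add: Wt_def)
lemma Wt_permutes: "w \<in> Wt m \<Longrightarrow> snd w permutes {1..2*m}" by (simp add: Wt_def Sstar_def)

lemma Wt_cen: "\<lbrakk>w \<in> Wt m; j \<in> {1..2*m}\<rbrakk> \<Longrightarrow> fst w j + fst w (opp m j) = cen m w"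
  using Xstar_pair[OF Wt_fst] by (simp add: cen_def)

lemma Wt_inv_range: "\<lbrakk>w \<in> Wt m; j \<in> {1..2*m}\<rbrakk> \<Longrightarrow> inv (snd w) j \<in> {1..2*m}"
  using Sstar_range[OF Sstar_inv[OF Wt_snd]] by blast

lemma Wt_inv_opp: "\<lbrakk>w \<in> Wt m; j \<in> {1..2*m}\<rbrakk> \<Longrightarrow> inv (snd w) (opp m j) = opp m (inv (snd w) j)"
  using Sstar_opp[OF Sstar_inv[OF Wt_snd]] by blast

lemma Wt_inv_eq: "w \<in> Wt m \<Longrightarrow> inv (snd w) i = inv (snd w) j \<longleftrightarrow> i = j"
  using permutes_inv[OF Wt_permutes] permutes_inj by (metis injD)

lemma fst_mult: "fst (aw_mult u w) j = fst u j + fst w (inv (snd u) j)"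
  by (simp add: aw_mult_def)

lemma snd_mult: "snd (aw_mult u w) = snd u \<circ> snd w"
  by (simp add: aw_mult_def)

lemma inv_snd_mult: "\<lbrakk>bij (snd u); bij (snd w)\<rbrakk> \<Longrightarrow> inv (snd (aw_mult u w)) = inv (snd w) \<circ> inv (snd u)"
  by (simp add: snd_mult o_inv_distrib)

lemma aw_mult_assoc:
  assumes "bij (snd u)" "bij (snd v)"
  shows "aw_mult (aw_mult u v) w = aw_mult u (aw_mult v w)"
  using inv_snd_mult[OF assms] by (intro prod_eqI ext) (auto simp: aw_mult_def)

lemma aw_one_mult [simp]: "aw_mult aw_one w = w"
  by (intro prod_eqI ext) (auto simp: aw_mult_def aw_one_def)

lemma aw_mult_one [simp]: "aw_mult w aw_one = w"
  by (intro prod_eqI ext) (auto simp: aw_mult_def aw_one_def)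

lemma aw_inv_left: "bij (snd w) \<Longrightarrow> aw_mult (aw_inv w) w = aw_one"
  by (intro prod_eqI ext) (auto simp: aw_mult_def aw_one_def aw_inv_def inv_inv_eq bij_is_inj)

lemma aw_inv_right: "bij (snd w) \<Longrightarrow> aw_mult w (aw_inv w) = aw_one"
  by (intro prod_eqI ext) (auto simp: aw_mult_def aw_one_def aw_inv_def bij_is_surj surj_f_inv_f)

lemma aw_act_mult:
  assumes "bij (snd u)" "bij (snd w)"
  shows "aw_act (aw_mult u w) x = aw_act u (aw_act w x)"
  using inv_snd_mult[OF assms] by (auto simp: aw_act_def fst_mult)

lemma Wt_bij: "w \<in> Wt m \<Longrightarrow> bij (snd w)"
  using Wt_permutes permutes_bij by blast

lemma WtI: "\<lbrakk>fst w \<in> Xstar m; snd w \<in> Sstar m\<rbrakk> \<Longrightarrow> w \<in> Wt m"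
  by (simp add: Wt_def)

lemma Wt_one: "aw_one \<in> Wt m"
  by (auto intro!: WtI XstarI simp: aw_one_def Sstar_id)

lemma Wt_mult:
  assumes "u \<in> Wt m" "w \<in> Wt m"
  shows "aw_mult u w \<in> Wt m"
proof (rule WtI)
  show "snd (aw_mult u w) \<in> Sstar m" using assms Sstar_comp by (simp add: snd_mult Wt_snd)
  show "fst (aw_mult u w) \<in> Xstar m"
  proof (rule XstarI[where c="cen m u + cen m w"])
    fix j assume "j \<notin> {1..2*m}"
    moreover from this have "inv (snd u) j \<notin> {1..2*m}"
      using Wt_permutes[OF assms(1)] by (metis permutes_in_image permutes_inv)
    ultimately show "fst (aw_mult u w) j = 0"
      using Xstar_zero[OF Wt_fst[OF assms(1)]] Xstar_zero[OF Wt_fst[OF assms(2)]] by (simp add: fst_mult)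
  next
    fix j assume "j \<in> {1..2*m}"
    then show "fst (aw_mult u w) j + fst (aw_mult u w) (opp m j) = cen m u + cen m w"
      using Wt_cen[OF assms(1), of j] Wt_cen[OF assms(2), of "inv (snd u) j"] Wt_inv_range[OF assms(1)]
      by (simp add: fst_mult Wt_inv_opp[OF assms(1)] del: atLeastAtMost_iff)
  qed
qed

lemma cen_mult:
  assumes "m \<ge> 1" "u \<in> Wt m" "w \<in> Wt m"
  shows "cen m (aw_mult u w) = cen m u + cen m w"
proof -
  have r: "1 \<in> {1..2*m}" "opp m 1 = 2*m" using assms by (auto simp: opp_def)
  show ?thesis
    using Wt_cen[OF assms(2) r(1)] Wt_cen[OF assms(3), of "inv (snd u) 1"] Wt_inv_range[OF assms(2) r(1)]
      Wt_cen[OF Wt_mult[OF assms(2,3)] r(1)]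
      Wt_inv_opp[OF assms(2) r(1)]
    by (simp add: fst_mult r)
qed

lemma Wt_inv:
  assumes "w \<in> Wt m"
  shows "aw_inv w \<in> Wt m"
proof (rule WtI)
  show "snd (aw_inv w) \<in> Sstar m" using assms Sstar_inv by (simp add: aw_inv_def Wt_snd)
  show "fst (aw_inv w) \<in> Xstar m"
  proof (rule XstarI[where c="- cen m w"])
    fix j assume "j \<notin> {1..2*m}"
    moreover from this have "snd w j \<notin> {1..2*m}"
      using Wt_permutes[OF assms(1)] by (metis permutes_in_image)
    ultimately show "fst (aw_inv w) j = 0"
      using Xstar_zero[OF Wt_fst[OF assms]] by (simp add: aw_inv_def)
  next
    fix j assume j: "j \<in> {1..2*m}"
    then show "fst (aw_inv w) j + fst (aw_inv w) (opp m j) = - cen m w"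
      using Wt_cen[OF assms(1), of "snd w j"] Sstar_range[OF Wt_snd[OF assms] j]
        Sstar_opp[OF Wt_snd[OF assms] j]
      by (simp add: aw_inv_def)
  qed
qed

definition affW :: "nat \<Rightarrow> aw monoid" where
  "affW m = \<lparr>carrier = Wt m, mult = aw_mult, one = aw_one\<rparr>"

lemma affW_simps [simp]: "carrier (affW m) = Wt m" "mult (affW m) = aw_mult" "one (affW m) = aw_one"
  by (simp_all add: affW_def)

lemma group_affW: "group (affW m)"
proof (rule groupI)
  fix x y z assume "x \<in> carrier (affW m)" "y \<in> carrier (affW m)" "z \<in> carrier (affW m)"
  then show "x \<otimes>\<^bsub>affW m\<^esub> y \<otimes>\<^bsub>affW m\<^esub> z = x \<otimes>\<^bsub>affW m\<^esub> (y \<otimes>\<^bsub>affW m\<^esub> z)"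
    by (simp add: aw_mult_assoc Wt_bij)
next
  fix x assume "x \<in> carrier (affW m)"
  then show "\<exists>y\<in>carrier (affW m). y \<otimes>\<^bsub>affW m\<^esub> x = \<one>\<^bsub>affW m\<^esub>"
    using Wt_inv by (intro bexI[of _ "aw_inv x"]) (simp_all add: aw_inv_left[OF Wt_bij])
qed (auto simp: Wt_mult Wt_one)

lemma inv_affW [simp]: "w \<in> Wt m \<Longrightarrow> m_inv (affW m) w = aw_inv w"
  by (intro group.inv_equality[OF group_affW]) (simp_all add: aw_inv_left Wt_inv Wt_bij)

text \<open>The vector \<open>w (1, \<dots>, 2m) / (2m+1)\<close>, up to the factor \<open>2m+1\<close>: the image under \<open>w\<close> of an
  interior point of the base alcove.\<close>
definition pos :: "nat \<Rightarrow> aw \<Rightarrow> nat \<Rightarrow> int" where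
  "pos m w j = per m * fst w j + int (inv (snd w) j)"

lemma pos_one [simp]: "pos m aw_one j = int j"
  by (simp add: pos_def aw_one_def)

lemma pos_mult:
  assumes "u \<in> Wt m" "w \<in> Wt m"
  shows "pos m (aw_mult u w) j = per m * fst u j + pos m w (inv (snd u) j)"
  using inv_snd_mult[OF Wt_bij[OF assms(1)] Wt_bij[OF assms(2)]]
  by (simp add: pos_def fst_mult algebra_simps)

lemma pos_opp:
  assumes "w \<in> Wt m" "j \<in> {1..2*m}"
  shows "pos m w (opp m j) = per m * (cen m w + 1) - pos m w j"
  using Wt_cen[OF assms] Wt_inv_opp[OF assms] int_opp[OF Wt_inv_range[OF assms]]
  by (simp add: pos_def algebra_simps flip: Wt_cen[OF assms])

text \<open>The base point and its images are regular: the residues of \<open>pos m w\<close> modulo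
  \<open>per m\<close> are a permutation of \<open>1, \<dots>, 2m\<close>. So every comparison with
  a hyperplane is strict.\<close>

lemma pos_neq:
  assumes "w \<in> Wt m" "a \<in> {1..2*m}" "b \<in> {1..2*m}" "a \<noteq> b"
  shows "pos m w a - pos m w b \<noteq> per m * k"
proof
  assume e: "pos m w a - pos m w b = per m * k"
  let ?A = "inv (snd w) a" and ?B = "inv (snd w) b"
  have r: "?A \<in> {1..2*m}" "?B \<in> {1..2*m}" using assms Wt_inv_range by blast+
  have "per m * (k - fst w a + fst w b) = int ?A - int ?B"
    using e by (simp add: pos_def algebra_simps)
  moreover have "\<bar>int ?A - int ?B\<bar> < per m" using r by (auto simp: per_def)
  ultimately have "?A = ?B" using per_small by fastforce
  then show False using assms Wt_inv_eq by blast
qed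

text \<open>Quotient and residue modulo \<open>per m\<close> recover translation and permutation.
  Identities in \<open>Wt m\<close> can thus be verified on integer vectors.\<close>

lemma pos_inject:
  assumes "u \<in> Wt m" "w \<in> Wt m" and eq: "\<And>j. j \<in> {1..2*m} \<Longrightarrow> pos m u j = pos m w j"
  shows "u = w"
proof -
  have 1: "fst u j = fst w j \<and> inv (snd u) j = inv (snd w) j" for j
  proof (cases "j \<in> {1..2*m}")
    case True
    let ?A = "inv (snd u) j" and ?B = "inv (snd w) j"
    have r: "?A \<in> {1..2*m}" "?B \<in> {1..2*m}" using assms True Wt_inv_range by blast+
    have "per m * (fst w j - fst u j) = int ?A - int ?B"
      using eq[OF True] by (simp add: pos_def algebra_simps)
    moreover have "\<bar>int ?A - int ?B\<bar> < per m" using r by (auto simp: per_def)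
    ultimately show ?thesis using per_small by fastforce
  next
    case False
    then show ?thesis
      using Xstar_zero[OF Wt_fst] permutes_not_in[OF permutes_inv[OF Wt_permutes]] assms by simp
  qed
  then have "inv (snd u) = inv (snd w)" by blast
  then have "snd u = snd w" by (metis assms(1,2) Wt_bij inv_inv_eq)
  then show ?thesis using 1 by (intro prod_eqI ext) auto
qed

text \<open>The reflection in the hyperplane \<open>x\<^sub>a - x\<^sub>b = k\<close> of \<open>V\<close>.\<close>
definition rfl :: "nat \<Rightarrow> nat \<Rightarrow> nat \<Rightarrow> int \<Rightarrow> aw" where
  "rfl m a b k = ((\<lambda>j. if j = a \<or> j = opp m b then k else if j = b \<or> j = opp m a then -k else 0),
     (\<lambda>j. if j = a then b else if j = b then a else if j = opp m a then opp m b
        else if j = opp m b then opp m a else j))"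

lemma snd_rfl_invol:
  assumes "a \<in> {1..2*m}" "b \<in> {1..2*m}" "a \<noteq> b"
  shows "snd (rfl m a b k) (snd (rfl m a b k) j) = j"
  using assms opp_inj[of a m b] opp_flip[of a m b] opp_flip[of b m a] by (auto simp: rfl_def)

lemma inv_snd_rfl:
  assumes "a \<in> {1..2*m}" "b \<in> {1..2*m}" "a \<noteq> b"
  shows "inv (snd (rfl m a b k)) = snd (rfl m a b k)"
  using snd_rfl_invol[OF assms] by (intro inv_unique_comp ext) auto

lemma rfl_Wt:
  assumes "a \<in> {1..2*m}" "b \<in> {1..2*m}" "a \<noteq> b"
  shows "rfl m a b k \<in> Wt m"
proof (rule WtI)
  note r = opp_range[OF assms(1)] opp_range[OF assms(2)]
  note f = opp_inj[OF assms(1,2)] opp_flip[OF assms(1,2)] opp_flip[OF assms(2,1)]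
  show "snd (rfl m a b k) \<in> Sstar m"
  proof (rule SstarI)
    have "bij_betw (snd (rfl m a b k)) {1..2*m} {1..2*m}"
      using snd_rfl_invol[OF assms] r assms
      by (intro bij_betwI[where g="snd (rfl m a b k)"]) (auto simp: rfl_def)
    then show "snd (rfl m a b k) permutes {1..2*m}"
      using assms r by (intro bij_imp_permutes) (auto simp: rfl_def simp del: One_nat_def)
    fix j assume j: "j \<in> {1..2*m}"
    then have "opp m j = a \<longleftrightarrow> j = opp m a" "opp m j = b \<longleftrightarrow> j = opp m b"
      "opp m j = opp m a \<longleftrightarrow> j = a" "opp m j = opp m b \<longleftrightarrow> j = b"
      using opp_inj opp_flip assms by blast+
    then show "snd (rfl m a b k) (opp m j) = opp m (snd (rfl m a b k) j)"
      using f assms by (auto simp: rfl_def simp del: atLeastAtMost_iff)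
  qed
  show "fst (rfl m a b k) \<in> Xstar m"
  proof (rule XstarI[where c=0])
    fix j assume "j \<notin> {1..2*m}"
    then show "fst (rfl m a b k) j = 0" using r assms by (auto simp: rfl_def)
  next
    fix j assume j: "j \<in> {1..2*m}"
    then have "opp m j = a \<longleftrightarrow> j = opp m a" "opp m j = b \<longleftrightarrow> j = opp m b"
      "opp m j = opp m a \<longleftrightarrow> j = a" "opp m j = opp m b \<longleftrightarrow> j = b"
      using opp_inj opp_flip assms by blast+
    then show "fst (rfl m a b k) j + fst (rfl m a b k) (opp m j) = 0"
      using f assms by (auto simp: rfl_def simp del: atLeastAtMost_iff)
  qed
qed

lemma pos_rfl_mult:
  assumes "a \<in> {1..2*m}" "b \<in> {1..2*m}" "a \<noteq> b" "w \<in> Wt m"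
  shows "pos m (aw_mult (rfl m a b k) w) j =
    (if j = a then pos m w b + per m * k else if j = b then pos m w a - per m * k
     else if j = opp m a then pos m w (opp m b) - per m * k
     else if j = opp m b then pos m w (opp m a) + per m * k else pos m w j)"
  unfolding pos_mult[OF rfl_Wt[OF assms(1-3)] assms(4)] inv_snd_rfl[OF assms(1-3)]
  using opp_inj[of a m b] opp_flip[of a m b] opp_flip[of b m a] assms by (auto simp: rfl_def)

lemma pos_rfl:
  assumes "a \<in> {1..2*m}" "b \<in> {1..2*m}" "a \<noteq> b"
  shows "pos m (rfl m a b k) j =
    (if j = a then int b + per m * k else if j = b then int a - per m * k
     else if j = opp m a then int (opp m b) - per m * k
     else if j = opp m b then int (opp m a) + per m * k else int j)"
  using pos_rfl_mult[OF assms Wt_one, of k j] by simp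

lemma rfl_invol:
  assumes "a \<in> {1..2*m}" "b \<in> {1..2*m}" "a \<noteq> b"
  shows "aw_mult (rfl m a b k) (rfl m a b k) = aw_one"
proof (rule pos_inject[OF Wt_mult Wt_one])
  fix j
  show "pos m (aw_mult (rfl m a b k) (rfl m a b k)) j = pos m aw_one j"
    unfolding pos_rfl_mult[OF assms rfl_Wt[OF assms]] pos_rfl[OF assms]
    using assms opp_inj[of a m b] opp_flip[of a m b] opp_flip[of b m a] by auto
qed (use assms rfl_Wt in auto)

lemma rfl_swap: "\<lbrakk>a \<in> {1..2*m}; b \<in> {1..2*m}; a \<noteq> b\<rbrakk> \<Longrightarrow> rfl m b a (-k) = rfl m a b k"
  using opp_inj[of a m b] opp_flip[of a m b] opp_flip[of b m a]
  by (intro prod_eqI ext) (auto simp: rfl_def)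

lemma rfl_opp: "\<lbrakk>a \<in> {1..2*m}; b \<in> {1..2*m}; a \<noteq> b\<rbrakk> \<Longrightarrow> rfl m (opp m b) (opp m a) k = rfl m a b k"
  using opp_inj[of a m b] opp_flip[of a m b] opp_flip[of b m a]
  by (intro prod_eqI ext) (auto simp: rfl_def simp del: atLeastAtMost_iff)

text \<open>On \<open>Vsp m\<close> the form \<open>x a - x b\<close> equals
  \<open>x (opp m b) - x (opp m a)\<close>, and both may change sign together with \<open>k\<close>.
  These are all the descriptions of one reflection, so membership in \<open>seps\<close> can be
  tested on any of them.\<close>

lemma rfl_eq_cases:
  assumes "a \<in> {1..2*m}" "b \<in> {1..2*m}" "a \<noteq> b" and eq: "rfl m a b k = rfl m c d l" and "c \<noteq> d"
  shows "(c = a \<and> d = b \<and> l = k) \<or> (c = b \<and> d = a \<and> l = -k) \<or>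
    (c = opp m b \<and> d = opp m a \<and> l = k) \<or> (c = opp m a \<and> d = opp m b \<and> l = -k)"
proof -
  have l: "l = fst (rfl m a b k) c" and d: "d = snd (rfl m a b k) c" unfolding eq by (auto simp: rfl_def)
  have ne: "opp m a \<noteq> opp m b" using assms opp_inj by blast
  have "c \<in> {a, b, opp m a, opp m b}" using \<open>c \<noteq> d\<close> d by (auto simp: rfl_def split: if_splits)
  then consider "c = a" | "c = b" | "c = opp m a" | "c = opp m b" by blast
  then show ?thesis
  proof cases
    case 1
    then have "l = k" "d = b" unfolding l d by (simp_all add: rfl_def)
    then show ?thesis using 1 by blast
  next
    case 2
    then have "l = -k" "d = a" unfolding l d using assms(3) by (simp_all add: rfl_def)
    then show ?thesis using 2 by blast
  next
    case 3
    have "l = -k" unfolding l 3 using ne by (simp add: rfl_def)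
    moreover have "d = opp m b" unfolding d 3 using opp_opp[OF assms(1)] opp_opp[OF assms(2)] by (auto simp: rfl_def)
    ultimately show ?thesis using 3 by blast
  next
    case 4
    have "l = k" unfolding l 4 by (simp add: rfl_def)
    moreover have "d = opp m a"
    proof (cases "opp m b = a")
      case True
      then have "d = b" unfolding d 4 by (simp add: rfl_def)
      then show ?thesis using True opp_opp[OF assms(2)] by simp
    next
      case False
      then show ?thesis unfolding d 4 using ne by (simp add: rfl_def)
    qed
    ultimately show ?thesis using 4 by blast
  qed
qed

text \<open>Compares the base point and its \<open>w\<close>-image with the hyperplane
  \<open>x\<^sub>a - x\<^sub>b = k\<close>, after multiplication by \<open>per m\<close>.\<close>

definition separates :: "nat \<Rightarrow> aw \<Rightarrow> nat \<Rightarrow> nat \<Rightarrow> int \<Rightarrow> bool" where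
  "separates m w a b k \<longleftrightarrow> (int a - int b < per m * k) \<noteq> (pos m w a - pos m w b < per m * k)"

definition rfls :: "nat \<Rightarrow> aw set" where
  "rfls m = {rfl m a b k | a b k. a \<in> {1..2*m} \<and> b \<in> {1..2*m} \<and> a \<noteq> b}"

definition seps :: "nat \<Rightarrow> aw \<Rightarrow> aw set" where
  "seps m w = {rfl m a b k | a b k. a \<in> {1..2*m} \<and> b \<in> {1..2*m} \<and> a \<noteq> b \<and> separates m w a b k}"

lemma separates_swap:
  assumes "w \<in> Wt m" "a \<in> {1..2*m}" "b \<in> {1..2*m}" "a \<noteq> b"
  shows "separates m w b a (-k) \<longleftrightarrow> separates m w a b k"
  using pos_neq[OF assms, of k] pos_neq[OF Wt_one assms(2-4), of k]
  by (auto simp: separates_def)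

lemma separates_opp:
  assumes "w \<in> Wt m" "a \<in> {1..2*m}" "b \<in> {1..2*m}"
  shows "separates m w (opp m b) (opp m a) k \<longleftrightarrow> separates m w a b k"
  unfolding separates_def pos_opp[OF assms(1,2)] pos_opp[OF assms(1,3)] int_opp[OF assms(2)] int_opp[OF assms(3)]
  by auto

lemma rfl_in_seps:
  assumes "w \<in> Wt m" "a \<in> {1..2*m}" "b \<in> {1..2*m}" "a \<noteq> b"
  shows "rfl m a b k \<in> seps m w \<longleftrightarrow> separates m w a b k"
proof
  assume "rfl m a b k \<in> seps m w"
  then obtain c d l where cd: "c \<noteq> d" "rfl m a b k = rfl m c d l" "separates m w c d l"
    by (auto simp: seps_def)
  have "separates m w (opp m a) (opp m b) (-k) \<longleftrightarrow> separates m w a b k"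
    using separates_opp[OF assms(1,3,2)] separates_swap[OF assms] by simp
  then show "separates m w a b k"
    using rfl_eq_cases[OF assms(2-4) cd(2,1)] cd(3) separates_opp[OF assms(1,2,3)] separates_swap[OF assms]
    by auto
qed (use assms in \<open>auto simp: seps_def\<close>)

lemma rfl_conj:
  assumes "u \<in> Wt m" "a \<in> {1..2*m}" "b \<in> {1..2*m}" "a \<noteq> b"
  shows "aw_mult (aw_mult (aw_inv u) (rfl m a b k)) u
    = rfl m (inv (snd u) a) (inv (snd u) b) (k - fst u a + fst u b)" (is "_ = ?r")
proof -
  let ?A = "inv (snd u) a" and ?B = "inv (snd u) b"
  have r: "?A \<in> {1..2*m}" "?B \<in> {1..2*m}" "?A \<noteq> ?B" using assms Wt_inv_range Wt_inv_eq by blast+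
  note w = rfl_Wt[OF assms(2-4)] rfl_Wt[OF r]
  have "aw_mult (rfl m a b k) u = aw_mult u ?r"
  proof (rule pos_inject[OF Wt_mult Wt_mult])
    fix j assume j: "j \<in> {1..2*m}"
    have o: "inv (snd u) j = opp m ?A \<longleftrightarrow> j = opp m a" "inv (snd u) j = opp m ?B \<longleftrightarrow> j = opp m b"
      using Wt_inv_eq[OF assms(1)] Wt_inv_opp[OF assms(1)] assms(2,3) by metis+
    have "fst u (opp m a) = cen m u - fst u a" "fst u (opp m b) = cen m u - fst u b"
      using Wt_cen[OF assms(1,2)] Wt_cen[OF assms(1,3)] by simp_all
    then have c: "per m * fst u (opp m a) = per m * cen m u - per m * fst u a"
      "per m * fst u (opp m b) = per m * cen m u - per m * fst u b" by (simp_all add: right_diff_distrib)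
    have ne: "opp m a \<noteq> opp m b" using assms opp_inj by blast
    show "pos m (aw_mult (rfl m a b k) u) j = pos m (aw_mult u ?r) j"
      unfolding pos_rfl_mult[OF assms(2-4,1)] pos_mult[OF assms(1) w(2)] pos_rfl[OF r]
        o Wt_inv_eq[OF assms(1)]
      unfolding pos_def Wt_inv_opp[OF assms(1,2)] Wt_inv_opp[OF assms(1,3)]
      using c ne by (auto simp: algebra_simps)
  qed (use assms w in auto)
  then have "aw_mult (aw_inv u) (aw_mult (rfl m a b k) u) = aw_mult (aw_mult (aw_inv u) u) ?r"
    using assms w Wt_bij Wt_inv by (metis aw_mult_assoc)
  then show ?thesis using assms w Wt_bij Wt_inv aw_inv_left by (metis aw_mult_assoc aw_one_mult)
qed

lemma separates_mult:
  assumes "u \<in> Wt m" "w \<in> Wt m"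
  shows "separates m (aw_mult u w) a b k \<longleftrightarrow>
    separates m u a b k \<noteq> separates m w (inv (snd u) a) (inv (snd u) b) (k - fst u a + fst u b)"
  unfolding separates_def pos_mult[OF assms] by (auto simp: pos_def algebra_simps)

lemma separates_self:
  assumes "a \<in> {1..2*m}" "b \<in> {1..2*m}" "a \<noteq> b"
  shows "separates m (rfl m a b k) a b k"
proof -
  define K where "K = per m * k"
  have "pos m (rfl m a b k) a - pos m (rfl m a b k) b = int b - int a + 2 * K"
    using assms(3) by (simp add: pos_rfl[OF assms] K_def)
  moreover have "int a - int b \<noteq> K" using pos_neq[OF Wt_one assms, of k] by (simp add: K_def)
  ultimately show ?thesis unfolding separates_def K_def[symmetric] by auto
qed

lemma finite_seps:
  assumes "w \<in> Wt m"
  shows "finite (seps m w)"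
proof -
  define B where "B = Max ((\<lambda>j. \<bar>pos m w j\<bar>) ` {1..2*m})"
  have B: "\<bar>pos m w j\<bar> \<le> B" if "j \<in> {1..2*m}" for j
    unfolding B_def using that by (intro Max_ge) auto
  \<comment> \<open>For a separating hyperplane \<open>per m * k\<close> lies between two
    differences whose absolute values are bounded by \<open>per m\<close> and
    \<open>2 * B\<close>.\<close>
  define K where "K = 2 * B + per m"
  have "\<bar>k\<bar> \<le> K" if "a \<in> {1..2*m}" "b \<in> {1..2*m}" "separates m w a b k" for a b k
  proof -
    have 1: "\<bar>int a - int b\<bar> < per m" using that by (auto simp: per_def)
    have 2: "\<bar>pos m w a - pos m w b\<bar> \<le> 2 * B" using B[OF that(1)] B[OF that(2)] by linarith
    have "\<bar>per m * k\<bar> \<le> K" using that(3) 1 2 by (auto simp: separates_def K_def)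
    moreover have "1 * \<bar>k\<bar> \<le> per m * \<bar>k\<bar>" using per_pos[of m] by (intro mult_right_mono) auto
    ultimately show ?thesis using per_pos[of m] by (simp add: abs_mult)
  qed
  then have "seps m w \<subseteq> (\<lambda>(a,b,k). rfl m a b k) ` ({1..2*m} \<times> {1..2*m} \<times> {-K..K})"
    unfolding seps_def by (force simp: abs_le_iff)
  then show ?thesis by (rule finite_subset) auto
qed

section \<open>The base alcove and its walls\<close>

lemma per_less_iff: "per m * k < per m * l \<longleftrightarrow> k < l"
  using per_pos[of m] by simp

text \<open>Exchanging \<open>a\<close> and \<open>b\<close> and negating \<open>k\<close> orients
  the hyperplane so that the base alcove lies on its negative side.\<close>

lemma seps_obtain:
  assumes "w \<in> Wt m" "t \<in> seps m w"
  obtains a b k where "a \<in> {1..2*m}" "b \<in> {1..2*m}" "a \<noteq> b" "t = rfl m a b k"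
    "int a - int b < per m * k" "pos m w a - pos m w b > per m * k"
proof -
  obtain a b k where t: "a \<in> {1..2*m}" "b \<in> {1..2*m}" "a \<noteq> b" "t = rfl m a b k" "separates m w a b k"
    using assms(2) by (auto simp: seps_def)
  show ?thesis
  proof (cases "int a - int b < per m * k")
    case True
    then show ?thesis using that[OF t(1-4)] t(5) pos_neq[OF assms(1) t(1-3), of k]
      by (auto simp: separates_def)
  next
    case False
    then have "int b - int a < per m * (-k)" using pos_neq[OF Wt_one t(1-3), of k] by simp
    moreover have "pos m w b - pos m w a > per m * (-k)" using t(5) False by (simp add: separates_def)
    ultimately show ?thesis using that[of b a "-k"] t(1-4) rfl_swap[OF t(1-3), of k] by simp
  qed
qed

text \<open>The nodes of the affine diagram of type C. The two ends \<open>i = 0\<close> and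
  \<open>i = m\<close> are the reflections that exchange a coordinate with its opposite.\<close>

definition srefl :: "nat \<Rightarrow> nat \<Rightarrow> aw" where
  "srefl m i = (if i = 0 then rfl m (2*m) 1 1 else rfl m i (i+1) 0)"

lemma range_diff: "\<lbrakk>a \<in> {1..2*m}; b \<in> {1..2*m}\<rbrakk> \<Longrightarrow> - per m < int a - int b \<and> int a - int b < per m"
  by (auto simp: per_def)

lemma srefl_Wt: "\<lbrakk>m \<ge> 1; i \<le> m\<rbrakk> \<Longrightarrow> srefl m i \<in> Wt m"
  by (auto simp: srefl_def intro!: rfl_Wt)

lemma srefl_rfls: "\<lbrakk>m \<ge> 1; i \<le> m\<rbrakk> \<Longrightarrow> srefl m i \<in> rfls m"
  unfolding srefl_def rfls_def by force

lemma seps_srefl: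
  assumes "m \<ge> 1" "i \<le> m"
  shows "seps m (srefl m i) = {srefl m i}"
proof (cases "i = 0")
  case False
  then have r: "i \<in> {1..2*m}" "i+1 \<in> {1..2*m}" "i \<noteq> i+1" using assms by auto
  have s: "srefl m i = rfl m i (i+1) 0" using False by (simp add: srefl_def)
  note w = rfl_Wt[OF r]
  have "t = srefl m i" if t: "t \<in> seps m (srefl m i)" for t
  proof -
    obtain a b k where ab: "a \<in> {1..2*m}" "b \<in> {1..2*m}" "a \<noteq> b" "t = rfl m a b k"
      "int a - int b < per m * k" "pos m (srefl m i) a - pos m (srefl m i) b > per m * k"
      using seps_obtain[OF srefl_Wt[OF assms] t] by metis
    define \<sigma> where "\<sigma> j = (if j = i then i+1 else if j = i+1 then i
      else if j = opp m i then opp m (i+1) else if j = opp m (i+1) then opp m i else j)" for j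
    have p: "pos m (srefl m i) j = int (\<sigma> j)" for j
      unfolding s pos_rfl[OF r] \<sigma>_def by simp
    have \<sigma>r: "\<sigma> a \<in> {1..2*m}" "\<sigma> b \<in> {1..2*m}"
      using ab(1,2) r opp_range[of i m] opp_range[of "i+1" m] unfolding \<sigma>_def by presburger+
    have "per m * k < per m * 1" using ab(6) range_diff[OF \<sigma>r] unfolding p by linarith
    moreover have "per m * (-1) < per m * k" using ab(5) range_diff[OF ab(1,2)] by linarith
    ultimately have k: "k = 0" unfolding per_less_iff by simp
    then have l: "a < b" "\<sigma> a > \<sigma> b" using ab p by auto
    \<comment> \<open>\<open>\<sigma>\<close> moves every index by at most one, so it can only
      invert neighbours that it exchanges.\<close>
    have "(a = i \<and> b = i+1) \<or> (a = opp m (i+1) \<and> b = opp m i)"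
    proof -
      have o: "opp m i = opp m (i+1) + 1" using r by (auto simp: opp_def)
      have d: "\<sigma> j = j \<or> (j \<in> {i, opp m (i+1)} \<and> \<sigma> j = j+1) \<or> (j \<in> {i+1, opp m i} \<and> \<sigma> j + 1 = j)" for j
        unfolding \<sigma>_def o by auto
      have "b = a+1 \<and> \<sigma> a = a+1 \<and> \<sigma> b + 1 = b" using d[of a] d[of b] l by linarith
      then have "a \<in> {i, opp m (i+1)}" "b = a+1" using d[of a] by auto
      then show ?thesis using o by auto
    qed
    then show ?thesis using ab(4) k s rfl_opp[OF r, of 0] by auto
  qed
  moreover have "srefl m i \<in> seps m (srefl m i)"
    unfolding s using rfl_in_seps[OF w r] separates_self[OF r] by blast
  ultimately show ?thesis by blast
next
  case True
  then have r: "2*m \<in> {1..2*m}" "1 \<in> {1..2*m}" "2*m \<noteq> 1" using assms by auto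
  have s: "srefl m i = rfl m (2*m) 1 1" using True by (simp add: srefl_def)
  note w = rfl_Wt[OF r]
  have "t = srefl m i" if t: "t \<in> seps m (srefl m i)" for t
  proof -
    obtain a b k where ab: "a \<in> {1..2*m}" "b \<in> {1..2*m}" "a \<noteq> b" "t = rfl m a b k"
      "int a - int b < per m * k" "pos m (srefl m i) a - pos m (srefl m i) b > per m * k"
      using seps_obtain[OF srefl_Wt[OF assms] t] by metis
    have o: "opp m 1 = 2*m" "opp m (2*m) = 1" by (auto simp: opp_def)
    have p: "pos m (srefl m i) j = (if j = 2*m then per m + 1 else if j = 1 then -1 else int j)" for j
      unfolding s pos_rfl[OF r] o by (auto simp: per_def)
    have d: "pos m (srefl m i) a - pos m (srefl m i) b < per m * 2"
      using ab(1,2) assms unfolding p by (auto simp: per_def)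
    then have "per m * k < per m * 2" using ab(6) by linarith
    moreover have "per m * (-1) < per m * k" using ab(5) range_diff[OF ab(1,2)] by linarith
    ultimately have "k = 0 \<or> k = 1" unfolding per_less_iff by auto
    then show ?thesis
    proof
      assume "k = 0"
      then have "a < b" "pos m (srefl m i) a > pos m (srefl m i) b" using ab by auto
      then show ?thesis using ab(1,2) unfolding p by (auto simp: per_def split: if_splits)
    next
      assume k: "k = 1"
      then have "pos m (srefl m i) a - pos m (srefl m i) b > per m" using ab by auto
      then have "a = 2*m \<and> b = 1" using ab(1,2) unfolding p by (auto simp: per_def split: if_splits)
      then show ?thesis using ab(4) k s by simp
    qed
  qed
  moreover have "srefl m i \<in> seps m (srefl m i)"
    unfolding s using rfl_in_seps[OF w r] separates_self[OF r] by blast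
  ultimately show ?thesis by blast
qed

lemma step_less:
  assumes "w \<in> Wt m" "1 \<le> j" "j < 2*m" "rfl m j (j+1) 0 \<notin> seps m w"
  shows "pos m w j < pos m w (j+1)"
proof -
  have r: "j \<in> {1..2*m}" "j+1 \<in> {1..2*m}" "j \<noteq> j+1" using assms by auto
  show ?thesis using rfl_in_seps[OF assms(1) r, of 0] assms(4) by (simp add: separates_def)
qed

lemma step_less_affine:
  assumes "w \<in> Wt m" "m \<ge> 1" "rfl m (2*m) 1 1 \<notin> seps m w"
  shows "pos m w (2*m) < pos m w 1 + per m"
proof -
  have r: "2*m \<in> {1..2*m}" "1 \<in> {1..2*m}" "2*m \<noteq> 1" using assms by auto
  show ?thesis using rfl_in_seps[OF assms(1) r, of 1] assms(3) by (simp add: separates_def per_def)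
qed

text \<open>Beyond the middle, the wall between \<open>j\<close> and \<open>j+1\<close> is the wall
  of the opposite pair of neighbours.\<close>

lemma rfl_adjacent:
  assumes "1 \<le> j" "j < 2*m"
  shows "\<exists>i\<in>{1..m}. rfl m j (j+1) 0 = srefl m i"
proof (cases "j \<le> m")
  case True
  then show ?thesis using assms by (intro bexI[of _ j]) (auto simp: srefl_def)
next
  case False
  have r: "j \<in> {1..2*m}" "j+1 \<in> {1..2*m}" "j \<noteq> j+1" using assms by auto
  have "opp m (j+1) + 1 = opp m j" "opp m (j+1) \<noteq> 0" "opp m (j+1) \<in> {1..m}" using assms False by (auto simp: opp_def)
  then show ?thesis using rfl_opp[OF r, of 0]
    by (intro bexI[of _ "opp m (j+1)"]) (auto simp: srefl_def)
qed

lemma chain_mono: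
  fixes f :: "nat \<Rightarrow> 'b::order"
  assumes "\<And>j. a \<le> j \<Longrightarrow> j < b \<Longrightarrow> f j \<le> f (j+1)" and "a \<le> b"
  shows "f a \<le> f b"
  using assms(2,1)
proof (induction rule: dec_induct)
  case (step n)
  then have "f a \<le> f n" by simp
  also have "f n \<le> f (Suc n)" using step.prems[of n] step.hyps by (simp add: Suc_eq_plus1)
  finally show ?case .
qed simp

lemma chain_strict:
  fixes f :: "nat \<Rightarrow> 'b::order"
  assumes "\<And>j. a \<le> j \<Longrightarrow> j < b \<Longrightarrow> f j < f (j+1)" and "a < b"
  shows "f a < f b"
proof -
  have "f a < f (a+1)" using assms by simp
  also have "f (a+1) \<le> f b" using assms by (intro chain_mono[of "a+1" b f]) (auto simp: less_imp_le)
  finally show ?thesis .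
qed

lemma pos_sorted_imp_no_seps:
  assumes w: "w \<in> Wt m" and i: "\<And>j. 1 \<le> j \<Longrightarrow> j < 2*m \<Longrightarrow> pos m w j < pos m w (j+1)"
    and a: "pos m w (2*m) < pos m w 1 + per m"
  shows "seps m w = {}"
proof -
  have False if t: "t \<in> seps m w" for t
  proof -
    obtain a b k where ab: "a \<in> {1..2*m}" "b \<in> {1..2*m}" "a \<noteq> b"
      "int a - int b < per m * k" "pos m w a - pos m w b > per m * k"
      using seps_obtain[OF w t] by metis
    have "per m * (-1) < per m * k" using ab(4) range_diff[OF ab(1,2)] by linarith
    then have "k \<ge> 0" unfolding per_less_iff by simp
    have mono: "pos m w 1 \<le> pos m w j \<and> pos m w j \<le> pos m w (2*m)" if "j \<in> {1..2*m}" for j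
      using that chain_mono[of 1 j "pos m w"] chain_mono[of j "2*m" "pos m w"] i by (simp add: less_imp_le)
    have "per m * k < per m * 1" using mono[OF ab(1)] mono[OF ab(2)] a ab(5) by linarith
    then have "k = 0" using \<open>k \<ge> 0\<close> unfolding per_less_iff by simp
    then have "a < b" "pos m w a > pos m w b" using ab by auto
    then show False using chain_strict[of a b "pos m w"] i ab by force
  qed
  then show ?thesis by blast
qed

lemma descent_srefl:
  assumes "m \<ge> 1" "w \<in> Wt m" "\<And>i. i \<le> m \<Longrightarrow> srefl m i \<notin> seps m w"
  shows "seps m w = {}"
proof (rule pos_sorted_imp_no_seps[OF assms(2)])
  show "pos m w j < pos m w (j+1)" if "1 \<le> j" "j < 2*m" for j
    using step_less[OF assms(2) that] rfl_adjacent[OF that] assms(3) by fastforce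
  show "pos m w (2*m) < pos m w 1 + per m"
    using step_less_affine[OF assms(2,1)] assms(3)[of 0] by (simp add: srefl_def)
qed

lemma no_seps_imp_pos_sorted:
  assumes "m \<ge> 1" "w \<in> Wt m" "seps m w = {}"
  shows "\<And>j. 1 \<le> j \<Longrightarrow> j < 2*m \<Longrightarrow> pos m w j < pos m w (j+1)"
    and "pos m w (2*m) < pos m w 1 + per m"
  using step_less step_less_affine assms by blast+

text \<open>The closed base alcove of \<open>GL\<^sub>2\<^sub>m\<close>.\<close>
definition weak :: "nat \<Rightarrow> (nat \<Rightarrow> real) \<Rightarrow> bool" where
  "weak m x \<longleftrightarrow> (\<forall>j. 1 \<le> j \<and> j < 2*m \<longrightarrow> x j \<le> x (j+1)) \<and> x (2*m) \<le> x 1 + 1"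

lemma weak_le:
  assumes "weak m x" "a \<in> {1..2*m}" "b \<in> {1..2*m}" "int a - int b < per m * k"
  shows "x a - x b \<le> real_of_int k"
proof -
  have mono: "x c \<le> x d" if "c \<in> {1..2*m}" "d \<in> {1..2*m}" "c \<le> d" for c d
    using that assms(1) chain_mono[of c d x] by (simp add: weak_def)
  have "per m * (-1) < per m * k" using assms(4) range_diff[OF assms(2,3)] by linarith
  then have "k \<ge> 0" unfolding per_less_iff by simp
  then consider "k = 0" | "k \<ge> 1" by linarith
  then show ?thesis
  proof cases
    case 1
    then show ?thesis using assms mono[of a b] by simp
  next
    case 2
    have "x a \<le> x (2*m)" "x 1 \<le> x b" using assms(2,3) mono by auto
    then have "x a - x b \<le> 1" using assms(1) by (auto simp: weak_def)
    then show ?thesis using 2 by linarith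
  qed
qed

text \<open>If \<open>wA\<close> lies on one side of a hyperplane, then the image of a point of the
  closed alcove lies weakly on that side. The point may lie outside \<open>Vsp m\<close>; this is
  needed for the vertices \<open>omega (2*m) i\<close>.\<close>

lemma weak_act_le:
  assumes "weak m x" "a \<in> {1..2*m}" "b \<in> {1..2*m}" "w \<in> Wt m" "pos m w a - pos m w b < per m * k"
  shows "aw_act w x a - aw_act w x b \<le> real_of_int k"
  using weak_le[OF assms(1) Wt_inv_range[OF assms(4,2)] Wt_inv_range[OF assms(4,3)], of "k - fst w a + fst w b"]
    assms(5) by (simp add: pos_def aw_act_def algebra_simps)

lemma weak_act_ge:
  assumes "weak m x" "a \<in> {1..2*m}" "b \<in> {1..2*m}" "w \<in> Wt m" "pos m w a - pos m w b > per m * k"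
  shows "aw_act w x a - aw_act w x b \<ge> real_of_int k"
  using weak_act_le[OF assms(1,3,2,4), of "-k"] assms(5) by simp

section \<open>The real space V, its reflections and the closure of the alcove\<close>

lemma Vsp_pair:
  assumes "x \<in> Vsp m" "j \<in> {1..2*m}"
  shows "x j + x (opp m j) = x 1 + x (2*m)"
proof (cases "j \<le> m")
  case True
  then show ?thesis using assms by (auto simp: Vsp_def opp_def)
next
  case False
  then have "opp m j \<in> {1..m}" using assms by (auto simp: opp_def)
  then have "x (opp m j) + x (2*m+1 - opp m j) = x 1 + x (2*m)" using assms by (auto simp: Vsp_def)
  moreover have "2*m+1 - opp m j = j" using opp_opp[OF assms(2)] by (simp add: opp_def)
  ultimately show ?thesis by simp
qed

lemma VspI:
  assumes "\<And>j. j \<notin> {1..2*m} \<Longrightarrow> x j = 0"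
    and "\<And>j. j \<in> {1..2*m} \<Longrightarrow> x j + x (opp m j) = c"
  shows "x \<in> Vsp m"
proof (cases "m = 0")
  case True
  then show ?thesis using assms by (auto simp: Vsp_def)
next
  case False
  then have "x 1 + x (2*m) = c" using assms(2)[of 1] by (simp add: opp_def)
  then show ?thesis using assms by (auto simp: Vsp_def opp_def)
qed

lemma act_rfl:
  assumes "a \<in> {1..2*m}" "b \<in> {1..2*m}" "a \<noteq> b"
  shows "aw_act (rfl m a b k) x j =
    (if j = a then x b + k else if j = b then x a - k
     else if j = opp m a then x (opp m b) - k
     else if j = opp m b then x (opp m a) + k else x j)"
  unfolding aw_act_def inv_snd_rfl[OF assms]
  using opp_inj[OF assms(1,2)] assms(3) opp_opp[OF assms(1)] opp_opp[OF assms(2)]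
  by (auto simp: rfl_def)

lemma act_rfl_fix_iff:
  assumes "a \<in> {1..2*m}" "b \<in> {1..2*m}" "a \<noteq> b" "x \<in> Vsp m"
  shows "aw_act (rfl m a b k) x = x \<longleftrightarrow> x a - x b = real_of_int k"
proof
  assume "aw_act (rfl m a b k) x = x"
  from fun_cong[OF this, of a] show "x a - x b = real_of_int k" by (simp add: act_rfl[OF assms(1-3)])
next
  assume "x a - x b = real_of_int k"
  moreover from this have "x (opp m b) - x (opp m a) = real_of_int k"
    using Vsp_pair[OF assms(4,1)] Vsp_pair[OF assms(4,2)] by linarith
  ultimately show "aw_act (rfl m a b k) x = x"
    by (intro ext) (auto simp: act_rfl[OF assms(1-3)])
qed

lemma hyp_eq_fix:
  assumes "a \<in> {1..2*m}" "b \<in> {1..2*m}" "a \<noteq> b"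
  shows "hyp m a b k = {x \<in> Vsp m. aw_act (rfl m a b k) x = x}"
  using act_rfl_fix_iff[OF assms] by (auto simp: hyp_def)

lemma Wt_act_Vsp:
  assumes "w \<in> Wt m" "x \<in> Vsp m"
  shows "aw_act w x \<in> Vsp m"
proof (rule VspI[where c="of_int (cen m w) + (x 1 + x (2*m))"])
  fix j assume "j \<notin> {1..2*m}"
  then show "aw_act w x j = 0"
    using Xstar_zero[OF Wt_fst[OF assms(1)]] permutes_not_in[OF permutes_inv[OF Wt_permutes[OF assms(1)]]] assms(2)
    by (simp add: aw_act_def Vsp_def)
next
  fix j assume j: "j \<in> {1..2*m}"
  show "aw_act w x j + aw_act w x (opp m j) = of_int (cen m w) + (x 1 + x (2*m))"
    using Vsp_pair[OF assms(2) Wt_inv_range[OF assms(1) j]] Wt_inv_opp[OF assms(1) j]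
    by (simp add: aw_act_def flip: Wt_cen[OF assms(1) j])
qed

lemma Xstar_Vsp: "l \<in> Xstar m \<Longrightarrow> (\<lambda>j. of_int (l j) / c) \<in> Vsp m"
proof (rule VspI)
  fix j assume "l \<in> Xstar m" "j \<in> {1..2*m}"
  from Xstar_pair[OF this] have "real_of_int (l j) + of_int (l (opp m j)) = of_int (l 1 + l (2*m))"
    by (metis of_int_add)
  then show "of_int (l j) / c + of_int (l (opp m j)) / c = real_of_int (l 1 + l (2*m)) / c"
    by (simp flip: add_divide_distrib)
qed (simp add: Xstar_zero)

definition bary :: "nat \<Rightarrow> nat \<Rightarrow> real" where
  "bary m j = (if j \<in> {1..2*m} then real j / of_int (per m) else 0)"

lemma bary_Vsp: "bary m \<in> Vsp m"
proof (rule VspI)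
  fix j assume j: "j \<in> {1..2*m}"
  have "real (opp m j) = of_int (per m) - real j" using int_opp[OF j] by (metis of_int_diff of_int_of_nat_eq)
  then show "bary m j + bary m (opp m j) = 1"
    using j opp_range[OF j] per_pos[of m] by (simp add: bary_def field_simps)
qed (auto simp: bary_def)

lemma act_bary:
  assumes "w \<in> Wt m" "j \<in> {1..2*m}"
  shows "aw_act w (bary m) j = real_of_int (pos m w j) / of_int (per m)"
  using Wt_inv_range[OF assms] per_pos[of m] by (simp add: aw_act_def bary_def pos_def field_simps)

lemma bary_alcove: "m \<ge> 1 \<Longrightarrow> bary m \<in> alcove m"
  using bary_Vsp per_pos[of m] by (auto simp: alcove_def bary_def field_simps) (auto simp: per_def)

lemma alcove_weak_iff:
  assumes "x \<in> Vsp m" "m \<ge> 1"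
  shows "x \<in> alcove m \<longleftrightarrow> (\<forall>j. 1 \<le> j \<and> j < 2*m \<longrightarrow> x j < x (j+1)) \<and> x (2*m) < x 1 + 1"
    and "weak m x \<longleftrightarrow> (\<forall>j\<in>{1..m}. x j \<le> x (j+1)) \<and> x (2*m) \<le> x 1 + 1"
proof -
  have d: "x (j+1) - x j = x (opp m (j+1) + 1) - x (opp m (j+1))"
    if "1 \<le> j" "j < 2*m" for j
  proof -
    have r: "j \<in> {1..2*m}" "j+1 \<in> {1..2*m}" using that by auto
    have "opp m j = opp m (j+1) + 1" using r by (auto simp: opp_def)
    then show ?thesis using Vsp_pair[OF assms(1) r(1)] Vsp_pair[OF assms(1) r(2)] by simp
  qed
  have o: "opp m (j+1) \<in> {1..m}" if "\<not> j \<le> m" "j < 2*m" for j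
    using that by (auto simp: opp_def)
  show "x \<in> alcove m \<longleftrightarrow> (\<forall>j. 1 \<le> j \<and> j < 2*m \<longrightarrow> x j < x (j+1)) \<and> x (2*m) < x 1 + 1" (is "?L \<longleftrightarrow> ?R")
  proof
    assume L: ?L
    have "x j < x (j+1)" if j: "1 \<le> j" "j < 2*m" for j
    proof (cases "j \<le> m")
      case False
      have "x (opp m (j+1)) < x (opp m (j+1) + 1)" using L o[OF False j(2)] by (simp add: alcove_def)
      then show ?thesis using d[OF j] by linarith
    qed (use L j in \<open>simp add: alcove_def\<close>)
    then show ?R using L by (auto simp: alcove_def)
  qed (use assms in \<open>auto simp: alcove_def\<close>)
  show "weak m x \<longleftrightarrow> (\<forall>j\<in>{1..m}. x j \<le> x (j+1)) \<and> x (2*m) \<le> x 1 + 1" (is "_ \<longleftrightarrow> ?R")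
  proof
    assume L: ?R
    have "x j \<le> x (j+1)" if j: "1 \<le> j" "j < 2*m" for j
    proof (cases "j \<le> m")
      case False
      have "x (opp m (j+1)) \<le> x (opp m (j+1) + 1)" using L o[OF False j(2)] by simp
      then show ?thesis using d[OF j] by linarith
    qed (use L j in simp)
    then show "weak m x" using L by (auto simp: weak_def)
  qed (use assms in \<open>auto simp: weak_def\<close>)
qed

lemma closure_alcove:
  assumes "m \<ge> 1" "x \<in> Vsp m"
  shows "x \<in> closure (alcove m) \<longleftrightarrow> weak m x"
proof
  have "alcove m \<subseteq> {x. (\<forall>j\<in>{1..m}. x j \<le> x (j+1)) \<and> x (2*m) \<le> x 1 + 1}"
    by (auto simp: alcove_def less_imp_le)
  moreover have "{x::nat \<Rightarrow> real. (\<forall>j\<in>{1..m}. x j \<le> x (j+1)) \<and> x (2*m) \<le> x 1 + 1}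
      = (\<Inter>j\<in>{1..m}. {x. x j \<le> x (j+1)}) \<inter> {x. x (2*m) \<le> x 1 + 1}" by auto
  moreover have "closed \<dots>"
    by (intro closed_Int closed_INT ballI closed_Collect_le continuous_intros) auto
  ultimately have "closure (alcove m) \<subseteq> {x. (\<forall>j\<in>{1..m}. x j \<le> x (j+1)) \<and> x (2*m) \<le> x 1 + 1}"
    by (metis (no_types, lifting) closure_minimal)
  then show "x \<in> closure (alcove m) \<Longrightarrow> weak m x" using alcove_weak_iff(2)[OF assms(2,1)] by auto
next
  assume w: "weak m x"
  \<comment> \<open>The segment from \<open>x\<close> towards the interior point
    \<open>bary m\<close> lies in the open alcove for \<open>t > 0\<close>, so
    \<open>x = f 0\<close> is a limit of alcove points.\<close>
  define f where "f t = (\<lambda>j. x j + t * (bary m j - x j))" for t :: real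
  have A: "f t \<in> alcove m" if t: "0 < t" "t \<le> 1" for t
  proof -
    have V: "f t \<in> Vsp m"
    proof (rule VspI[where c="(1-t) * (x 1 + x (2*m)) + t * (bary m 1 + bary m (2*m))"])
      fix j assume j: "j \<in> {1..2*m}"
      have "f t j + f t (opp m j) = (1-t) * (x j + x (opp m j)) + t * (bary m j + bary m (opp m j))"
        by (simp add: f_def algebra_simps)
      then show "f t j + f t (opp m j) = (1-t) * (x 1 + x (2*m)) + t * (bary m 1 + bary m (2*m))"
        by (simp only: Vsp_pair[OF assms(2) j] Vsp_pair[OF bary_Vsp j])
    qed (use assms bary_Vsp in \<open>auto simp: f_def Vsp_def\<close>)
    have c: "(1-t) * u + t * v < (1-t) * u' + t * v' + s" if "u \<le> u' + s" "v < v' + s" for u v u' v' s :: real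
    proof -
      have "(1-t) * u \<le> (1-t) * (u' + s)" using that t by (intro mult_left_mono) auto
      moreover have "t * v < t * (v' + s)" using that t by simp
      ultimately show ?thesis by (simp add: algebra_simps)
    qed
    have f: "f t j = (1-t) * x j + t * bary m j" for j by (simp add: f_def algebra_simps)
    have b: "(\<forall>j. 1 \<le> j \<and> j < 2*m \<longrightarrow> bary m j < bary m (j+1)) \<and> bary m (2*m) < bary m 1 + 1"
      using bary_alcove assms bary_Vsp alcove_weak_iff(1) by blast
    show ?thesis unfolding alcove_weak_iff(1)[OF V assms(1)] f
      using c[where s=0] c[where s=1] b w by (auto simp: weak_def)
  qed
  have cont: "continuous_on S f" for S
    unfolding f_def by (intro continuous_on_coordinatewise_then_product continuous_intros)
  have "f ` closure {0<..1} \<subseteq> closure (alcove m)"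
  proof (rule image_closure_subset[OF cont])
    show "f ` {0<..1} \<subseteq> closure (alcove m)" using A closure_subset by fastforce
  qed auto
  moreover have "f 0 = x" by (simp add: f_def)
  ultimately show "x \<in> closure (alcove m)" by (force simp: closure_greaterThanAtMost)
qed

text \<open>One fixed point determines the translation part from the permutation; fixing the
  directions of the hyperplane then leaves only two permutations.\<close>

lemma fixes_hyp_cases:
  assumes s: "s \<in> Wt m" and ab: "a \<in> {1..2*m}" "b \<in> {1..2*m}" "a \<noteq> b"
    and fix_: "\<And>x. x \<in> hyp m a b k \<Longrightarrow> aw_act s x = x"
  shows "s = aw_one \<or> s = rfl m a b k"
proof -
  define \<tau> where "\<tau> = inv (snd s)"
  define r where "r = snd (rfl m a b k)"
  note w = rfl_Wt[OF ab]
  have \<tau>r: "\<tau> j \<in> {1..2*m}" if "j \<in> {1..2*m}" for j using Wt_inv_range[OF s that] by (simp add: \<tau>_def)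
  have \<tau>i: "\<tau> i = \<tau> j \<longleftrightarrow> i = j" for i j using Wt_inv_eq[OF s] by (simp add: \<tau>_def)
  have \<tau>o: "\<tau> (opp m j) = opp m (\<tau> j)" if "j \<in> {1..2*m}" for j using Wt_inv_opp[OF s that] by (simp add: \<tau>_def)
  \<comment> \<open>The midpoint of the origin and its mirror image, a convenient point of the
    hyperplane.\<close>
  define x0 where "x0 j = real_of_int (fst (rfl m a b k) j) / 2" for j
  have x0: "x0 \<in> Vsp m" unfolding x0_def using Xstar_Vsp[OF Wt_fst[OF w]] .
  have x0h: "x0 a - x0 b = of_int k" using ab(3) by (simp add: x0_def rfl_def)
  have \<lambda>: "of_int (fst s j) = x0 j - x0 (\<tau> j)" for j
    using fun_cong[OF fix_[of x0], of j] x0 x0h by (simp add: hyp_def aw_act_def \<tau>_def)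
  have dir: "d (\<tau> j) = d j" if d: "d \<in> Vsp m" "d a = d b" for d j
  proof -
    have "(\<lambda>j. x0 j + d j) \<in> Vsp m"
    proof (rule VspI)
      fix j assume j: "j \<in> {1..2*m}"
      show "x0 j + d j + (x0 (opp m j) + d (opp m j)) = (x0 1 + x0 (2*m)) + (d 1 + d (2*m))"
        using Vsp_pair[OF x0 j] Vsp_pair[OF d(1) j] by linarith
    qed (use x0 d in \<open>auto simp: Vsp_def\<close>)
    then have "(\<lambda>j. x0 j + d j) \<in> hyp m a b k" using x0h d by (simp add: hyp_def)
    from fun_cong[OF fix_[OF this], of j] show ?thesis using \<lambda>[of j] by (simp add: aw_act_def \<tau>_def)
  qed
  have other: "\<tau> p = p" if p: "p \<notin> {a, b, opp m a, opp m b}" for p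
  proof (cases "p \<in> {1..2*m}")
    case True
    \<comment> \<open>A direction of the hyperplane whose only coordinate \<open>1\<close> is at
      \<open>p\<close>, so invariance under \<tau> pins down \<open>p\<close>.\<close>
    define d :: "nat \<Rightarrow> real" where "d j = (if j = p then 1 else if j = opp m p then -1 else 0)" for j
    have "d \<in> Vsp m"
    proof (rule VspI[where c=0])
      fix j assume "j \<in> {1..2*m}"
      then show "d j + d (opp m j) = 0"
        using True opp_flip[of j m p] opp_inj[of j m p] by (auto simp: d_def)
    qed (use True opp_range[OF True] in \<open>auto simp: d_def\<close>)
    moreover have "d a = d b" using p True ab opp_opp by (auto simp: d_def)
    ultimately have "d (\<tau> p) = d p" by (rule dir)
    then show ?thesis by (simp add: d_def split: if_splits)
  next
    case False
    then show ?thesis using permutes_not_in[OF permutes_inv[OF Wt_permutes[OF s]]] by (simp add: \<tau>_def)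
  qed
  have in_ab: "\<tau> a \<in> {a, b} \<and> \<tau> b \<in> {a, b}"
  proof (cases "b = opp m a")
    case True
    then have "opp m b = a" using ab by simp
    then have "\<tau> c \<in> {a, b}" if "c \<in> {a, b}" for c
      using other[of "\<tau> c"] \<tau>i[of "\<tau> c" c] True that by auto
    then show ?thesis by simp
  next
    case False
    \<comment> \<open>Here the value \<open>1\<close> occurs exactly at \<open>a\<close> and
      \<open>b\<close>, so \<tau> preserves \<open>{a, b}\<close>.\<close>
    define d :: "nat \<Rightarrow> real" where
      "d j = (if j = a \<or> j = b then 1 else if j = opp m a \<or> j = opp m b then -1 else 0)" for j
    have "d \<in> Vsp m"
    proof (rule VspI[where c=0])
      fix j assume j: "j \<in> {1..2*m}"
      have *: "opp m j = a \<longleftrightarrow> j = opp m a" "opp m j = b \<longleftrightarrow> j = opp m b"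
        "opp m j = opp m a \<longleftrightarrow> j = a" "opp m j = opp m b \<longleftrightarrow> j = b"
        using opp_inj opp_flip ab j by blast+
      have "a \<noteq> opp m b" using False ab by auto
      then show "d j + d (opp m j) = 0" unfolding d_def * using False by auto
    qed (use ab opp_range[OF ab(1)] opp_range[OF ab(2)] in \<open>auto simp: d_def\<close>)
    moreover have "d a = d b" by (simp add: d_def)
    ultimately have "d (\<tau> a) = d a" "d (\<tau> b) = d b" using dir by blast+
    then show ?thesis by (auto simp: d_def split: if_splits)
  qed
  show ?thesis
  proof (cases "\<tau> a = a")
    case True
    then have "\<tau> b = b" using in_ab \<tau>i[of a b] ab(3) by auto
    then have t: "\<tau> j = j" for j using True other[of j] \<tau>o ab by force
    then have "fst s j = 0" for j using \<lambda>[of j] by simp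
    moreover have "snd s = id"
      using t Wt_bij[OF s] unfolding \<tau>_def by (metis bij_inv_eq_iff id_apply ext)
    ultimately have "s = aw_one" by (intro prod_eqI ext) (simp_all add: aw_one_def)
    then show ?thesis ..
  next
    case False
    then have ta: "\<tau> a = b" using in_ab by simp
    then have tb: "\<tau> b = a" using in_ab \<tau>i[of a b] ab(3) by auto
    have t: "\<tau> j = r j" for j
      using ta tb other[of j] \<tau>o ab by (auto simp: r_def rfl_def)
    then have "\<tau> = r" by blast
    have "fst s j = fst (rfl m a b k) j" for j
    proof -
      have "fst (rfl m a b k) (r j) = - fst (rfl m a b k) j"
        using ab opp_inj[OF ab(1,2)] opp_flip[OF ab(1,2)] opp_flip[OF ab(2,1)]
        by (auto simp: r_def rfl_def)
      then have "real_of_int (fst s j) = of_int (fst (rfl m a b k) j)"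
        using \<lambda>[of j] t by (simp add: x0_def)
      then show ?thesis by simp
    qed
    moreover have "snd s = r"
      using \<open>\<tau> = r\<close> Wt_bij[OF s] inv_snd_rfl[OF ab, of k] inv_inv_eq unfolding \<tau>_def r_def by metis
    ultimately have "s = rfl m a b k" by (intro prod_eqI ext) (simp_all add: r_def)
    then show ?thesis ..
  qed
qed

lemma Refl_eq: "Refl m = rfls m"
proof
  show "Refl m \<subseteq> rfls m"
  proof
    fix s assume "s \<in> Refl m"
    then obtain a b k where s: "s \<in> Wt m" "1 \<le> a" "a < b" "b \<le> 2*m"
      "\<And>x. x \<in> hyp m a b k \<Longrightarrow> aw_act s x = x" "\<exists>x\<in>Vsp m. aw_act s x \<noteq> x"
      by (auto simp: Refl_def Hyps_def)
    have r: "a \<in> {1..2*m}" "b \<in> {1..2*m}" "a \<noteq> b" using s by auto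
    have "s \<noteq> aw_one" using s(6) by (auto simp: aw_act_def aw_one_def)
    then have "s = rfl m a b k" using fixes_hyp_cases[OF s(1) r s(5)] by blast
    then show "s \<in> rfls m" using r by (auto simp: rfls_def)
  qed
  show "rfls m \<subseteq> Refl m"
  proof
    fix s assume "s \<in> rfls m"
    then obtain a b k where s: "a \<in> {1..2*m}" "b \<in> {1..2*m}" "a < b" "s = rfl m a b k"
      unfolding rfls_def using rfl_swap by (smt (verit) linorder_neqE_nat mem_Collect_eq)
    then have n: "a \<noteq> b" by simp
    have "hyp m a b k \<in> Hyps m" using s by (auto simp: Hyps_def)
    moreover have "\<forall>x\<in>hyp m a b k. aw_act s x = x" using hyp_eq_fix[OF s(1,2) n] s(4) by blast
    moreover have "bary m \<in> Vsp m" by (rule bary_Vsp)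
    moreover have "aw_act s (bary m) \<noteq> bary m"
    proof
      assume "aw_act s (bary m) = bary m"
      then have "bary m a - bary m b = of_int k" using act_rfl_fix_iff[OF s(1,2) n bary_Vsp] s(4) by blast
      then have "real a - real b = of_int (per m * k)" using s(1,2) per_pos[of m] by (simp add: bary_def field_simps)
      then have "int a - int b = per m * k" by linarith
      then show False using pos_neq[OF Wt_one s(1,2) n, of k] by simp
    qed
    ultimately show "s \<in> Refl m" using rfl_Wt[OF s(1,2) n] s(4) by (auto simp: Refl_def)
  qed
qed

lemma rfls_obtain_less:
  assumes "s \<in> rfls m"
  obtains a b k where "a \<in> {1..2*m}" "b \<in> {1..2*m}" "a < b" "s = rfl m a b k"
proof -
  obtain a b k where s: "a \<in> {1..2*m}" "b \<in> {1..2*m}" "a \<noteq> b" "s = rfl m a b k"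
    using assms by (auto simp: rfls_def)
  show ?thesis
  proof (cases "a < b")
    case True
    then show ?thesis using that s by blast
  next
    case False
    then show ?thesis using that[of b a "-k"] s rfl_swap[OF s(1-3), of k] by simp
  qed
qed

lemma Simple_eq:
  assumes m: "m \<ge> 1"
  shows "Simple m = srefl m ` {0..m}"
proof
  show "Simple m \<subseteq> srefl m ` {0..m}"
  proof
    fix s assume "s \<in> Simple m"
    then have s: "s \<in> rfls m" by (simp add: Simple_def Refl_eq)
    obtain H where wall: "is_wall m H" and fix_: "\<And>x. x \<in> H \<Longrightarrow> aw_act s x = x"
      using \<open>s \<in> Simple m\<close> by (auto simp: Simple_def)
    obtain p where H: "H \<in> Hyps m" "p \<in> H" "p \<in> closure (alcove m)"
      "\<And>H'. H' \<in> Hyps m \<Longrightarrow> p \<in> H' \<Longrightarrow> H' = H"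
      using wall unfolding is_wall_def by auto
    obtain a b k where ab: "1 \<le> a" "a < b" "b \<le> 2*m" "H = hyp m a b k"
      using H(1) by (auto simp: Hyps_def)
    have r: "a \<in> {1..2*m}" "b \<in> {1..2*m}" "a \<noteq> b" using ab by auto
    have sW: "s \<in> Wt m" using s rfl_Wt by (auto simp: rfls_def)
    have sN: "seps m s \<noteq> {}"
    proof -
      obtain c d l where cd: "c \<in> {1..2*m}" "d \<in> {1..2*m}" "c \<noteq> d" "s = rfl m c d l"
        using s by (auto simp: rfls_def)
      then show ?thesis using rfl_in_seps[OF sW cd(1-3)] separates_self[OF cd(1-3)] by blast
    qed
    then have "s \<noteq> aw_one" by (auto simp: seps_def separates_def)
    then have sr: "s = rfl m a b k" using fixes_hyp_cases[OF sW r] fix_ ab(4) by blast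
    have pV: "p \<in> Vsp m" using H(2) ab(4) by (simp add: hyp_def)
    have pw: "weak m p" using closure_alcove[OF m pV] H(3) by blast
    obtain i where i: "i \<le> m" "srefl m i \<in> seps m s" using descent_srefl[OF m sW] sN by blast
    obtain c d l where cd: "c \<in> {1..2*m}" "d \<in> {1..2*m}" "c \<noteq> d" "srefl m i = rfl m c d l"
      "int c - int d < per m * l" "pos m s c - pos m s d > per m * l"
      using seps_obtain[OF sW i(2)] by metis
    \<comment> \<open>The wall point \<open>p\<close> lies in the closure of \<open>A\<close> and is
      fixed by \<open>s\<close>. The hyperplane of \<open>srefl m i\<close> separates
      \<open>A\<close> from \<open>sA\<close>, so \<open>p\<close> lies on it, and uniqueness of the
      hyperplane through \<open>p\<close> identifies the two.\<close>
    have "p c - p d \<le> of_int l" using weak_le[OF pw cd(1,2,5)] .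
    moreover have "p c - p d \<ge> of_int l" using weak_act_ge[OF pw cd(1,2) sW cd(6)] fix_[OF H(2)] by simp
    ultimately have ph: "p \<in> hyp m c d l" using pV by (simp add: hyp_def)
    have "hyp m c d l \<in> Hyps m"
    proof (cases "c < d")
      case True
      then show ?thesis using cd by (auto simp: Hyps_def)
    next
      case False
      have "hyp m c d l = hyp m d c (-l)" by (auto simp: hyp_def)
      then show ?thesis using False cd by (force simp: Hyps_def)
    qed
    then have hyp_eq: "hyp m c d l = hyp m a b k" using H(4) ph ab(4) by blast
    have "srefl m i = aw_one \<or> srefl m i = rfl m a b k"
    proof (rule fixes_hyp_cases[OF srefl_Wt[OF m i(1)] r])
      fix x assume "x \<in> hyp m a b k"
      then have "x \<in> hyp m c d l" using hyp_eq by simp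
      then show "aw_act (srefl m i) x = x" using hyp_eq_fix[OF cd(1-3), of l] cd(4) by simp
    qed
    moreover have "srefl m i \<noteq> aw_one"
      using seps_srefl[OF m i(1)] by (auto simp: seps_def separates_def)
    ultimately show "s \<in> srefl m ` {0..m}" using sr i by (intro image_eqI[of _ _ i]) auto
  qed
  show "srefl m ` {0..m} \<subseteq> Simple m"
  proof
    fix s assume "s \<in> srefl m ` {0..m}"
    then obtain i where i: "i \<le> m" "s = srefl m i" by auto
    have sR: "s \<in> rfls m" and sW: "s \<in> Wt m" and sN: "seps m s = {s}"
      using i srefl_rfls[OF m] srefl_Wt[OF m] seps_srefl[OF m] by auto
    obtain a b k where ab: "a \<in> {1..2*m}" "b \<in> {1..2*m}" "a < b" "s = rfl m a b k"
      using rfls_obtain_less[OF sR] by metis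
    have ne: "a \<noteq> b" using ab by simp
    define P where "P = real_of_int (per m)"
    have P: "P > 0" using per_pos[of m] by (simp add: P_def)
    \<comment> \<open>The midpoint of the base point and its mirror image witnesses the wall: every
      hyperplane through \<open>p\<close> has the two points on opposite sides, and
      \<open>seps m s = {s}\<close> leaves only that of \<open>s\<close>.\<close>
    define p where "p j = (bary m j + aw_act s (bary m) j) / 2" for j
    have pj: "p j = (real j + of_int (pos m s j)) / (2 * P)" if "j \<in> {1..2*m}" for j
      using act_bary[OF sW that] that P by (simp add: p_def bary_def P_def field_simps)
    have pV: "p \<in> Vsp m"
    proof (rule VspI)
      fix j assume j: "j \<in> {1..2*m}"
      show "p j + p (opp m j) = ((bary m 1 + bary m (2*m)) + (aw_act s (bary m) 1 + aw_act s (bary m) (2*m))) / 2"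
      proof -
        have "p j + p (opp m j) = ((bary m j + bary m (opp m j)) + (aw_act s (bary m) j + aw_act s (bary m) (opp m j))) / 2"
          by (simp add: p_def field_simps)
        then show ?thesis by (simp only: Vsp_pair[OF bary_Vsp j] Vsp_pair[OF Wt_act_Vsp[OF sW bary_Vsp] j])
      qed
    qed (use bary_Vsp Wt_act_Vsp[OF sW bary_Vsp] in \<open>auto simp: p_def Vsp_def\<close>)
    have on_hyp: "rfl m c d l = s"
      if cd: "c \<in> {1..2*m}" "d \<in> {1..2*m}" "c \<noteq> d" "p c - p d = of_int l" for c d l
    proof -
      have "((int c - int d) + (pos m s c - pos m s d)) = 2 * (per m * l)"
      proof -
        have "real_of_int ((int c - int d) + (pos m s c - pos m s d)) = of_int (2 * (per m * l))"
          using cd(4) pj[OF cd(1)] pj[OF cd(2)] P by (simp add: P_def field_simps)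
        then show ?thesis by linarith
      qed
      then have "separates m s c d l"
        using pos_neq[OF Wt_one cd(1-3), of l] unfolding separates_def pos_one by linarith
      then show ?thesis using rfl_in_seps[OF sW cd(1-3)] sN by blast
    qed
    have "p a - p b = of_int k"
    proof -
      have pab: "pos m s a = int b + per m * k" "pos m s b = int a - per m * k"
        using ne by (simp_all add: ab(4) pos_rfl[OF ab(1,2) ne])
      have "p a = (real a + real b + P * k) / (2 * P)" "p b = (real a + real b - P * k) / (2 * P)"
        unfolding pj[OF ab(1)] pj[OF ab(2)] pab by (simp_all add: P_def algebra_simps)
      then have "p a - p b = (2 * P * k) / (2 * P)" by (simp flip: diff_divide_distrib)
      then show ?thesis using P by simp
    qed
    then have ph: "p \<in> hyp m a b k" using pV by (simp add: hyp_def)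
    have pw: "weak m p"
      unfolding weak_def
    proof (intro conjI allI impI)
      fix j assume j: "1 \<le> j \<and> j < 2*m"
      then have r: "j \<in> {1..2*m}" "j+1 \<in> {1..2*m}" "j \<noteq> j+1" by auto
      have "pos m s j \<le> pos m s (j+1) + 1"
      proof (cases "rfl m j (j+1) 0 \<in> seps m s")
        case True
        then have "s = rfl m j (j+1) 0" using sN by simp
        then show ?thesis by (simp add: pos_rfl[OF r])
      next
        case False
        then show ?thesis using step_less[OF sW _ _ False] j by simp
      qed
      then have "real j + of_int (pos m s j) \<le> real (j+1) + of_int (pos m s (j+1))" by linarith
      then show "p j \<le> p (j+1)" using pj[OF r(1)] pj[OF r(2)] P by (simp add: divide_right_mono)
    next
      have r: "2*m \<in> {1..2*m}" "1 \<in> {1..2*m}" "2*m \<noteq> 1" using m by auto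
      have "pos m s (2*m) \<le> pos m s 1 + per m + 2"
      proof (cases "rfl m (2*m) 1 1 \<in> seps m s")
        case True
        then have "s = rfl m (2*m) 1 1" using sN by simp
        then show ?thesis using r by (simp add: pos_rfl[OF r] per_def)
      next
        case False
        then show ?thesis using step_less_affine[OF sW m False] by simp
      qed
      then have "real (2*m) + of_int (pos m s (2*m)) \<le> real 1 + of_int (pos m s 1) + 2 * P"
        by (simp add: P_def per_def)
      then have "p (2*m) \<le> (real 1 + of_int (pos m s 1) + 2 * P) / (2 * P)"
        unfolding pj[OF r(1)] using P by (simp add: divide_right_mono)
      also have "\<dots> = p 1 + 1" unfolding pj[OF r(2)] using P by (simp add: add_divide_distrib)
      finally show "p (2*m) \<le> p 1 + 1" .
    qed
    have "is_wall m (hyp m a b k)"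
      unfolding is_wall_def
    proof (intro conjI bexI[of _ p] ballI impI)
      show "hyp m a b k \<in> Hyps m" using ab by (auto simp: Hyps_def)
      show "p \<in> hyp m a b k \<inter> closure (alcove m)" using ph closure_alcove[OF m pV] pw by blast
      fix H' assume "H' \<in> Hyps m" "p \<in> H'"
      then obtain c d l where "1 \<le> c" "c < d" "d \<le> 2*m" and H': "H' = hyp m c d l" "p \<in> hyp m c d l"
        by (auto simp: Hyps_def)
      then have cd: "c \<in> {1..2*m}" "d \<in> {1..2*m}" "c \<noteq> d" by auto
      then have "rfl m c d l = s" using on_hyp H'(2) by (simp add: hyp_def)
      then show "H' = hyp m a b k" using hyp_eq_fix[OF cd(1-3)] hyp_eq_fix[OF ab(1,2) ne] H'(1) ab(4) by simp
    qed
    moreover have "\<forall>x\<in>hyp m a b k. aw_act s x = x" using hyp_eq_fix[OF ab(1,2) ne] ab(4) by blast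
    ultimately show "s \<in> Simple m" unfolding Simple_def Refl_eq using sR by blast
  qed
qed

lemma reflection_cocycle_affW:
  assumes m: "m \<ge> 1"
  shows "reflection_cocycle (affW m) (rfls m) (Simple m) (seps m)"
proof -
  interpret group "affW m" by (rule group_affW)
  show ?thesis
  proof
    show "t \<in> carrier (affW m)" if "t \<in> rfls m" for t using that rfl_Wt by (auto simp: rfls_def)
    show "s \<in> rfls m" if "s \<in> Simple m" for s using that Refl_eq by (auto simp: Simple_def)
    show "t \<otimes>\<^bsub>affW m\<^esub> t = \<one>\<^bsub>affW m\<^esub>" if "t \<in> rfls m" for t
      using that rfl_invol by (auto simp: rfls_def)
    show "m_inv (affW m) g \<otimes>\<^bsub>affW m\<^esub> t \<otimes>\<^bsub>affW m\<^esub> g \<in> rfls m" if "g \<in> carrier (affW m)" "t \<in> rfls m" for g t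
    proof -
      obtain a b k where ab: "a \<in> {1..2*m}" "b \<in> {1..2*m}" "a \<noteq> b" "t = rfl m a b k"
        using \<open>t \<in> rfls m\<close> by (auto simp: rfls_def)
      have g: "g \<in> Wt m" using that by simp
      have "inv (snd g) a \<in> {1..2*m}" "inv (snd g) b \<in> {1..2*m}" "inv (snd g) a \<noteq> inv (snd g) b"
        using Wt_inv_range[OF g] Wt_inv_eq[OF g] ab by blast+
      then show ?thesis using rfl_conj[OF g ab(1-3)] ab(4) g by (auto simp: rfls_def)
    qed
    show "t \<in> rfls m" if "t \<in> seps m g" for g t using that by (auto simp: seps_def rfls_def)
    show "finite (seps m g)" if "g \<in> carrier (affW m)" for g using that finite_seps by simp
    show "t \<in> seps m (u \<otimes>\<^bsub>affW m\<^esub> w) \<longleftrightarrow>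
        (t \<in> seps m u) \<noteq> (m_inv (affW m) u \<otimes>\<^bsub>affW m\<^esub> t \<otimes>\<^bsub>affW m\<^esub> u \<in> seps m w)"
      if "u \<in> carrier (affW m)" "w \<in> carrier (affW m)" "t \<in> rfls m" for u w t
    proof -
      obtain a b k where ab: "a \<in> {1..2*m}" "b \<in> {1..2*m}" "a \<noteq> b" "t = rfl m a b k"
        using \<open>t \<in> rfls m\<close> by (auto simp: rfls_def)
      have u: "u \<in> Wt m" and w: "w \<in> Wt m" using that by auto
      have r: "inv (snd u) a \<in> {1..2*m}" "inv (snd u) b \<in> {1..2*m}" "inv (snd u) a \<noteq> inv (snd u) b"
        using Wt_inv_range[OF u] Wt_inv_eq[OF u] ab by blast+
      show ?thesis
        using rfl_in_seps[OF Wt_mult[OF u w] ab(1-3), of k] rfl_in_seps[OF u ab(1-3), of k]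
          rfl_in_seps[OF w r] rfl_conj[OF u ab(1-3), of k] separates_mult[OF u w, of a b k] u ab(4)
        by simp
    qed
    show "seps m s = {s}" if "s \<in> Simple m" for s using that Simple_eq[OF m] seps_srefl[OF m] by auto
    show "t \<in> seps m t" if "t \<in> rfls m" for t
    proof -
      obtain a b k where ab: "a \<in> {1..2*m}" "b \<in> {1..2*m}" "a \<noteq> b" "t = rfl m a b k"
        using \<open>t \<in> rfls m\<close> by (auto simp: rfls_def)
      show ?thesis using rfl_in_seps[OF rfl_Wt[OF ab(1-3)] ab(1-3)] separates_self[OF ab(1-3)] ab(4) by blast
    qed
    show "seps m w = {}" if "w \<in> carrier (affW m)" "seps m w \<inter> Simple m = {}" for w
    proof (rule descent_srefl[OF m])
      show "srefl m i \<notin> seps m w" if "i \<le> m" for i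
        using \<open>seps m w \<inter> Simple m = {}\<close> \<open>i \<le> m\<close> unfolding Simple_eq[OF m] by auto
    qed (use that in simp)
  qed
qed

section \<open>Comparison with the Coxeter group structure\<close>

lemma aw_act_one [simp]: "aw_act aw_one x = x"
  by (simp add: aw_act_def aw_one_def)

context
  fixes m :: nat
  assumes m: "m \<ge> 1"
begin

interpretation reflection_cocycle "affW m" "rfls m" "Simple m" "seps m"
  by (rule reflection_cocycle_affW[OF m])

lemma cen_one_rfls:
  "cen m aw_one = 0" "s \<in> rfls m \<Longrightarrow> cen m s = 0"
proof -
  show "cen m aw_one = 0" by (simp add: cen_def aw_one_def)
  assume "s \<in> rfls m"
  then obtain a b k where ab: "a \<in> {1..2*m}" "b \<in> {1..2*m}" "a \<noteq> b" "s = rfl m a b k"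
    by (auto simp: rfls_def)
  have "cen m s + cen m s = cen m (aw_mult s s)"
    using cen_mult[OF m rfl_Wt[OF ab(1-3)] rfl_Wt[OF ab(1-3)]] ab(4) by simp
  also have "\<dots> = 0" using rfl_invol[OF ab(1-3)] ab(4) by (simp add: cen_def aw_one_def)
  finally show "cen m s = 0" by simp
qed

text \<open>\<open>pos m w\<close> is strictly increasing, and vanishing \<open>cen\<close> makes it
  symmetric under \<open>opp\<close>. Closeness of its ends gives \<open>pos m w 1 \<ge> 1\<close>,
  hence \<open>pos m w j \<ge> j\<close> for all \<open>j\<close>, and the symmetry turns this into
  equality.\<close>

lemma length0_cen0:
  assumes "w \<in> Wt m" "seps m w = {}" "cen m w = 0"
  shows "w = aw_one"
proof (rule pos_inject[OF assms(1) Wt_one])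
  note st = no_seps_imp_pos_sorted[OF m assms(1,2)]
  have o: "pos m w (2*m) = per m - pos m w 1"
    using pos_opp[OF assms(1), of 1] m assms(3) by (simp add: opp_def)
  have "2 * pos m w 1 > 0" using st(2) o by linarith
  then have p1: "pos m w 1 \<ge> 1" by simp
  have lower: "int j \<le> pos m w j" if "1 \<le> j" "j \<le> 2*m" for j
    using that
  proof (induction j rule: dec_induct)
    case base
    then show ?case using p1 by simp
  next
    case (step n)
    then have "pos m w n < pos m w (Suc n)" using st(1)[of n] by (simp add: Suc_eq_plus1)
    then show ?case using step by simp
  qed
  fix j assume j: "j \<in> {1..2*m}"
  have "int (opp m j) \<le> pos m w (opp m j)" using lower opp_range[OF j] by simp
  then have "pos m w j \<le> int j" using pos_opp[OF assms(1) j] int_opp[OF j] assms(3) by simp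
  then show "pos m w j = pos m aw_one j" using lower[of j] j by simp
qed

lemma Wa_subset: "w \<in> Wa m \<Longrightarrow> w \<in> Wt m \<and> cen m w = 0"
proof (induction rule: Wa.induct)
  case Wa_one
  then show ?case using Wt_one cen_one_rfls by simp
next
  case (Wa_step s w)
  then have "s \<in> rfls m" by (simp add: Refl_eq)
  then show ?case using Wa_step T_carrier[of s] Wt_mult cen_mult[OF m] cen_one_rfls(2)[of s] by simp
qed

text \<open>Stripping left descents until none is left; the remainder has length zero and is the
  factor in \<open>Omega m\<close>.\<close>

lemma word_decomposition:
  "w \<in> Wt m \<Longrightarrow> \<exists>ss \<omega>. set ss \<subseteq> Simple m \<and> length ss = ell w \<and> \<omega> \<in> Wt m \<and> seps m \<omega> = {} \<and>
    w = aw_mult (foldr aw_mult ss aw_one) \<omega> \<and> foldr aw_mult ss aw_one \<in> Wa m"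
proof (induction "ell w" arbitrary: w)
  case 0
  then have "seps m w = {}" using ell_0 by simp
  then show ?case using 0 by (intro exI[of _ "[]"] exI[of _ w]) (auto intro: Wa_one)
next
  case (Suc n)
  then obtain s where s: "s \<in> Simple m" "s \<in> seps m w"
    using exists_descent[of w] ell_0[of w] by auto
  have sW: "s \<in> Wt m" and sT: "s \<in> rfls m" using s S_T T_carrier by auto
  have n: "n = ell (aw_mult s w)" using ell_down[OF s(1) _ s(2)] Suc by simp
  obtain ss \<omega> where ss: "set ss \<subseteq> Simple m" "length ss = n" "\<omega> \<in> Wt m" "seps m \<omega> = {}"
    "aw_mult s w = aw_mult (foldr aw_mult ss aw_one) \<omega>" "foldr aw_mult ss aw_one \<in> Wa m"
    using Suc(1)[OF n Wt_mult[OF sW Suc(3)]] n by auto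
  have "w = aw_mult s (aw_mult s w)" using T_cancel[OF sT, of w] Suc(3) by simp
  also have "\<dots> = aw_mult (aw_mult s (foldr aw_mult ss aw_one)) \<omega>"
    unfolding ss(5) using m_assoc[of s "foldr aw_mult ss aw_one" \<omega>] sW Wa_subset[OF ss(6)] ss(3) by simp
  finally show ?case using ss s Suc(2) sT Refl_eq
    by (intro exI[of _ "s # ss"] exI[of _ \<omega>]) (auto intro: Wa_step)
qed

lemma Wa_word:
  assumes "w \<in> Wt m" "cen m w = 0"
  shows "\<exists>ss. set ss \<subseteq> Simple m \<and> length ss = ell w \<and> foldr aw_mult ss aw_one = w" and "w \<in> Wa m"
proof -
  obtain ss \<omega> where ss: "set ss \<subseteq> Simple m" "length ss = ell w" "\<omega> \<in> Wt m" "seps m \<omega> = {}"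
    "w = aw_mult (foldr aw_mult ss aw_one) \<omega>" "foldr aw_mult ss aw_one \<in> Wa m"
    using word_decomposition[OF assms(1)] by blast
  have "cen m \<omega> = 0" using cen_mult[OF m, of "foldr aw_mult ss aw_one" \<omega>] Wa_subset[OF ss(6)] ss assms by simp
  then have "\<omega> = aw_one" using length0_cen0 ss by blast
  then show "\<exists>ss. set ss \<subseteq> Simple m \<and> length ss = ell w \<and> foldr aw_mult ss aw_one = w" "w \<in> Wa m"
    using ss by auto
qed

lemma Wa_eq: "Wa m = {w \<in> Wt m. cen m w = 0}"
  using Wa_word(2) Wa_subset by blast

lemma ell_word: "set ss \<subseteq> Simple m \<Longrightarrow> foldr aw_mult ss aw_one \<in> Wt m \<and> ell (foldr aw_mult ss aw_one) \<le> length ss"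
proof (induction ss)
  case Nil
  then show ?case using N_one by (simp add: ell_def Wt_one)
next
  case (Cons s ss)
  define w where "w = foldr aw_mult ss aw_one"
  have w: "w \<in> Wt m" "ell w \<le> length ss" using Cons by (auto simp: w_def)
  have s: "s \<in> Simple m" "s \<in> Wt m" using Cons S_T T_carrier by auto
  have "ell (aw_mult s w) \<le> Suc (ell w)"
    using ell_up[OF s(1), of w] ell_down[OF s(1), of w] w by (cases "s \<in> seps m w") auto
  then show ?case using w s Wt_mult by (simp flip: w_def)
qed

lemma len_eq_ell:
  assumes "w \<in> Wa m"
  shows "len m w = ell w"
  unfolding len_def
proof (rule Least_equality)
  show "\<exists>ss. set ss \<subseteq> Simple m \<and> length ss = ell w \<and> foldr aw_mult ss aw_one = w"
    using Wa_word(1) assms Wa_subset by blast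
  show "ell w \<le> y" if "\<exists>ss. set ss \<subseteq> Simple m \<and> length ss = y \<and> foldr aw_mult ss aw_one = w" for y
    using that ell_word by blast
qed

lemma Wa_mult: "\<lbrakk>u \<in> Wa m; w \<in> Wa m\<rbrakk> \<Longrightarrow> aw_mult u w \<in> Wa m"
  using cen_mult[OF m] Wt_mult by (simp add: Wa_eq)

lemma rfls_Wa: "t \<in> rfls m \<Longrightarrow> t \<in> Wa m"
  using cen_one_rfls(2) T_carrier by (simp add: Wa_eq)

lemma seps_conjugate_simple:
  "\<lbrakk>w \<in> Wa m; t \<in> seps m w\<rbrakk> \<Longrightarrow> \<exists>u\<in>Wa m. \<exists>s\<in>Simple m. t = aw_mult (aw_mult u s) (aw_inv u)"
proof (induction "ell w" arbitrary: w t rule: less_induct)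
  case less
  have wW: "w \<in> Wt m" using less Wa_subset by blast
  obtain s where s: "s \<in> Simple m" "s \<in> seps m w"
    using exists_descent[of w] less(3) wW unfolding affW_simps by blast
  have sT: "s \<in> rfls m" and tT: "t \<in> rfls m" using s S_T N_T less wW by auto
  have sW: "s \<in> Wt m" "s \<in> Wa m" and tW: "t \<in> Wt m" using sT tT T_carrier rfls_Wa by auto
  show ?case
  proof (cases "t = s")
    case True
    then show ?thesis using s Wa_one by (intro bexI[of _ aw_one] bexI[of _ s]) (auto simp: aw_inv_def aw_one_def aw_mult_def)
  next
    case False
    define r where "r = aw_mult (aw_mult s t) s"
    have rT: "r \<in> rfls m" using sconj_T[OF sT tT] by (simp add: r_def)
    have tr: "t = aw_mult (aw_mult s r) s" using conj_invol[OF sT tT] by (simp add: r_def)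
    have "r \<noteq> s"
    proof
      assume "r = s"
      then have "t = s" using tr T_invol[OF sT] sW by simp
      then show False using False by simp
    qed
    have "r \<in> seps m (aw_mult s w)"
      using N_smult[OF s(1) _ rT, of w] \<open>r \<noteq> s\<close> wW less(3) tr by simp
    moreover have "ell (aw_mult s w) < ell w" using ell_down[OF s(1) _ s(2)] wW by simp
    ultimately obtain u s' where u: "u \<in> Wa m" "s' \<in> Simple m" "r = aw_mult (aw_mult u s') (aw_inv u)"
      using less(1)[of "aw_mult s w" r] Wa_mult sW less(2) by blast
    have uW: "u \<in> Wt m" "s' \<in> Wt m" using u Wa_subset S_T T_carrier by auto
    have "t = aw_mult (aw_mult (aw_mult s u) s') (m_inv (affW m) (aw_mult s u))"
      using tr u(3) uW sW m_assoc inv_mult_group[of s u] inv_T[OF sT] Wt_inv Wt_mult by simp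
    then show ?thesis using u uW sW Wa_mult Wt_mult by (intro bexI[of _ "aw_mult s u"] bexI[of _ s']) auto
  qed
qed

lemma CoxRefl_eq: "CoxRefl m = rfls m"
proof
  show "CoxRefl m \<subseteq> rfls m"
  proof
    fix t assume "t \<in> CoxRefl m"
    then obtain u s where u: "u \<in> Wa m" "s \<in> Simple m" "t = aw_mult (aw_mult u s) (aw_inv u)"
      by (auto simp: CoxRefl_def)
    then show "t \<in> rfls m" using conj_T[of u s] Wa_subset[of u] S_T by simp
  qed
  show "rfls m \<subseteq> CoxRefl m"
    using seps_conjugate_simple[OF rfls_Wa N_self] by (fastforce simp: CoxRefl_def)
qed

lemma Omega_eq: "Omega m = {w \<in> Wt m. seps m w = {}}"
proof -
  have "aw_act w x \<in> alcove m" if w: "w \<in> Wt m" "seps m w = {}" and x: "x \<in> alcove m" for w x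
  proof -
    have xV: "x \<in> Vsp m" using x by (simp add: alcove_def)
    note st = no_seps_imp_pos_sorted[OF m w]
    have lt: "x a - x b < of_int k" if "a \<in> {1..2*m}" "b \<in> {1..2*m}" "int a - int b < per m * k" for a b k
    proof -
      have x': "x i < x j" if "1 \<le> i" "i < j" "j \<le> 2*m" for i j
        using that alcove_weak_iff(1)[OF xV m] x by (intro chain_strict[of i j x]) auto
      have "x a - x b \<le> of_int k"
        using weak_le[OF _ that] x alcove_weak_iff[OF xV m] by (auto simp: less_imp_le alcove_def)
      \<comment> \<open>All coordinate differences of a point of the open alcove are below 1 in
        absolute value, so only \<open>k = 0\<close> could occur, and the coordinates are
        distinct.\<close>
      moreover have "x a - x b \<noteq> of_int k"
      proof
        assume e: "x a - x b = of_int k"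
        have ne: "a \<noteq> b" using e that by auto
        have bd: "x 1 \<le> x c \<and> x c \<le> x (2*m)" if "c \<in> {1..2*m}" for c
          using x'[of 1 c] x'[of c "2*m"] x'[of 1 "2*m"] m that by (cases "c = 1"; cases "c = 2*m") auto
        have "x (2*m) < x 1 + 1" using x alcove_weak_iff(1)[OF xV m] by blast
        then have "\<bar>x a - x b\<bar> < 1" using bd[OF that(1)] bd[OF that(2)] by linarith
        then have "k = 0" using e by linarith
        then show False using e x'[of a b] that by simp
      qed
      ultimately show ?thesis by simp
    qed
    have V: "aw_act w x \<in> Vsp m" using Wt_act_Vsp[OF w(1) xV] .
    have act: "aw_act w x a - aw_act w x b < of_int k"
      if "a \<in> {1..2*m}" "b \<in> {1..2*m}" "pos m w a - pos m w b < per m * k" for a b k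
      using lt[OF Wt_inv_range[OF w(1) that(1)] Wt_inv_range[OF w(1) that(2)], of "k - fst w a + fst w b"] that(3)
      by (simp add: pos_def aw_act_def algebra_simps)
    show ?thesis unfolding alcove_weak_iff(1)[OF V m]
      using act[of _ _ 0] act[of "2*m" 1 1] st m by force
  qed
  note A = this
  have "w \<in> Omega m" if w: "w \<in> Wt m" "seps m w = {}" for w
  proof -
    have iW: "aw_inv w \<in> Wt m" using w Wt_inv by blast
    have "ell (m_inv (affW m) w) = ell w" by (rule ell_inv) (use w in simp)
    then have "seps m (aw_inv w) = {}" using ell_0[of w] ell_0[of "aw_inv w"] w iW by simp
    note B = A[OF iW this]
    have "x \<in> aw_act w ` alcove m" if x: "x \<in> alcove m" for x
    proof (rule image_eqI)
      show "aw_act (aw_inv w) x \<in> alcove m" using B[OF x] .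
      show "x = aw_act w (aw_act (aw_inv w) x)"
        using aw_act_mult[OF Wt_bij[OF w(1)] Wt_bij[OF iW], of x] aw_inv_right[OF Wt_bij[OF w(1)]] by simp
    qed
    then have "aw_act w ` alcove m = alcove m" using A[OF w] by blast
    then show ?thesis using w by (simp add: Omega_def)
  qed
  moreover have "seps m w = {}" if w: "w \<in> Omega m" for w
  proof -
    have wW: "w \<in> Wt m" using w by (simp add: Omega_def)
    have x: "aw_act w (bary m) \<in> alcove m" using w bary_alcove[OF m] by (auto simp: Omega_def)
    have V: "aw_act w (bary m) \<in> Vsp m" using x by (simp add: alcove_def)
    have P: "real_of_int (per m) > 0" using per_pos[of m] by simp
    have *: "(\<forall>j. 1 \<le> j \<and> j < 2*m \<longrightarrow> aw_act w (bary m) j < aw_act w (bary m) (j+1)) \<and>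
        aw_act w (bary m) (2*m) < aw_act w (bary m) 1 + 1"
      using alcove_weak_iff(1)[OF V m] x by blast
    show ?thesis
    proof (rule pos_sorted_imp_no_seps[OF wW])
      fix j assume j: "1 \<le> j" "j < 2*m"
      then have "aw_act w (bary m) j < aw_act w (bary m) (j+1)" using * by blast
      then have "real_of_int (pos m w j) / of_int (per m) < of_int (pos m w (j+1)) / of_int (per m)"
        using act_bary[OF wW, of j] act_bary[OF wW, of "j+1"] j by simp
      then show "pos m w j < pos m w (j+1)" using P by (simp add: divide_less_cancel)
    next
      have "real_of_int (pos m w (2*m)) / of_int (per m) < of_int (pos m w 1) / of_int (per m) + 1"
        using * act_bary[OF wW, of "2*m"] act_bary[OF wW, of 1] m by simp
      also have "\<dots> = of_int (pos m w 1 + per m) / of_int (per m)" using P by (simp add: field_simps)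
      finally show "pos m w (2*m) < pos m w 1 + per m"
        using P by (metis divide_less_cancel not_less_iff_gr_or_eq of_int_less_iff)
    qed
  qed
  ultimately show ?thesis by (auto simp: Omega_def)
qed

lemma seps_mult_Omega:
  assumes "x \<in> Wt m" "\<omega> \<in> Omega m"
  shows "seps m (aw_mult x \<omega>) = seps m x"
proof (rule Set.set_eqI)
  fix t
  have w: "\<omega> \<in> Wt m" "seps m \<omega> = {}" using assms Omega_eq by auto
  show "t \<in> seps m (aw_mult x \<omega>) \<longleftrightarrow> t \<in> seps m x"
  proof (cases "t \<in> rfls m")
    case True
    then show ?thesis using N_mult[of x \<omega> t] w assms by simp
  next
    case False
    then show ?thesis using N_T[of x t] N_T[of "aw_mult x \<omega>" t] Wt_mult[OF assms(1) w(1)] assms(1) by auto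
  qed
qed

lemma Wa_Omega_decomposition: "w \<in> Wt m \<Longrightarrow> \<exists>x\<in>Wa m. \<exists>\<omega>\<in>Omega m. w = aw_mult x \<omega>"
  using word_decomposition Omega_eq by blast

lemma ext_len_eq:
  assumes "w \<in> Wt m"
  shows "ext_len m w = ell w"
proof -
  have 1: "len m x = ell w" if "x \<in> Wa m" "\<omega> \<in> Omega m" "w = aw_mult x \<omega>" for x \<omega>
    using that seps_mult_Omega[of x \<omega>] Wa_subset[of x] len_eq_ell by (simp add: ell_def)
  obtain x \<omega> where "x \<in> Wa m" "\<omega> \<in> Omega m" "w = aw_mult x \<omega>"
    using Wa_Omega_decomposition[OF assms] by blast
  then show ?thesis unfolding ext_len_def using 1 by (intro Least_equality) (metis, metis order_refl)
qed

text \<open>The definition multiplies by reflections on the right, \<open>le\<close> on the left;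
  conjugation by the element itself translates one into the other.\<close>

lemma bruhat_le_imp:
  assumes "bruhat_le m x y"
  shows "le x y"
proof -
  have "le u v" if "u \<in> Wa m" "t \<in> CoxRefl m" "len m u < len m v" "v = aw_mult u t" for u v t
  proof -
    have tT: "t \<in> rfls m" using that CoxRefl_eq by simp
    have W: "u \<in> Wt m" "t \<in> Wt m" "v \<in> Wa m" using that tT T_carrier[of t] Wa_subset Wa_mult rfls_Wa by auto
    define r where "r = aw_mult (aw_mult u t) (aw_inv u)"
    have rT: "r \<in> rfls m" using conj_T[of u t] W tT by (simp add: r_def)
    have v: "v = aw_mult r u" unfolding r_def that(4)
      using m_assoc[of "aw_mult u t" "aw_inv u" u] W Wt_inv Wt_mult aw_inv_left[OF Wt_bij] by simp
    have "ell u < ell (aw_mult r u)" using that(1,3) W v len_eq_ell by simp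
    then have "r \<notin> seps m u" using ell_reflect_iff[of u r] W rT by simp
    then show ?thesis using le_up[of u r] W rT v by simp
  qed
  then have step: "(u, v) \<in> {(u, aw_mult u t) | u t. u \<in> Wa m \<and> t \<in> CoxRefl m \<and> len m u < len m (aw_mult u t)}
      \<Longrightarrow> le u v" for u v by blast
  have x: "x \<in> Wt m" and
    c: "(x, y) \<in> {(u, aw_mult u t) | u t. u \<in> Wa m \<and> t \<in> CoxRefl m \<and> len m u < len m (aw_mult u t)}\<^sup>*"
    using assms Wa_subset by (auto simp: bruhat_le_def)
  from c show ?thesis
    by (induction rule: rtrancl_induct) (use x le_refl step le_trans in auto)
qed

text \<open>Right multiplication by an element of \<open>Omega m\<close> does not change
  \<open>seps\<close>, and steps of \<open>le\<close> act on the left; so a chain of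
  \<open>le\<close> keeps one common factor \<omega>.\<close>

lemma ext_le_iff: "ext_le m w w' \<longleftrightarrow> le w w'"
proof
  assume "ext_le m w w'"
  then obtain x x' \<omega> where x: "x \<in> Wa m" "x' \<in> Wa m" "\<omega> \<in> Omega m" "w = aw_mult x \<omega>"
    "w' = aw_mult x' \<omega>" "bruhat_le m x x'" by (auto simp: ext_le_def)
  have wW: "\<omega> \<in> Wt m" using x Omega_eq by simp
  have "le u v \<Longrightarrow> le (aw_mult u \<omega>) (aw_mult v \<omega>)" for u v
  proof (induction rule: le.induct)
    case (le_refl u)
    then show ?case using le.le_refl[of "aw_mult u \<omega>"] Wt_mult wW by simp
  next
    case (le_step u t v)
    then have W: "u \<in> Wt m" "t \<in> Wt m" using T_carrier by auto
    have "t \<notin> seps m (aw_mult u \<omega>)" using le_step seps_mult_Omega[OF W(1) x(3)] by simp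
    moreover have "aw_mult t (aw_mult u \<omega>) = aw_mult (aw_mult t u) \<omega>"
      using m_assoc[of t u \<omega>] W wW by simp
    ultimately show ?case using le.le_step[of "aw_mult u \<omega>" t] le_step W wW Wt_mult by simp
  qed
  then show "le w w'" using bruhat_le_imp x by blast
next
  assume "le w w'"
  have W: "w \<in> Wt m" "w' \<in> Wt m" using le_carrier[OF \<open>le w w'\<close>] by auto
  obtain x' \<omega> where x': "x' \<in> Wa m" "\<omega> \<in> Omega m" "w' = aw_mult x' \<omega>"
    using Wa_Omega_decomposition[OF W(2)] by blast
  have wW: "\<omega> \<in> Wt m" using x' Omega_eq by simp
  have "le w v \<Longrightarrow> v = aw_mult x' \<omega> \<Longrightarrow> \<exists>x\<in>Wa m. w = aw_mult x \<omega> \<and> bruhat_le m x x'" for v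
  proof (induction rule: le.induct)
    case (le_refl u)
    then show ?case using x' by (intro bexI[of _ x']) (auto simp: bruhat_le_def)
  next
    case (le_step u t v)
    obtain x where x: "x \<in> Wa m" "aw_mult t u = aw_mult x \<omega>" "bruhat_le m x x'"
      using le_step(5)[OF le_step(6)] by auto
    have tW: "t \<in> Wt m" "u \<in> Wt m" "t \<in> Wa m" "x \<in> Wt m" using le_step T_carrier rfls_Wa x Wa_subset by auto
    define z where "z = aw_mult t x"
    have zW: "z \<in> Wa m" "z \<in> Wt m" using Wa_mult tW x Wa_subset by (auto simp: z_def)
    have tz: "aw_mult t z = x" using T_cancel[OF le_step(2), of x] tW by (simp add: z_def)
    have "u = aw_mult t (aw_mult t u)" using T_cancel[OF le_step(2), of u] tW by simp
    also have "\<dots> = aw_mult z \<omega>" unfolding x(2) z_def using m_assoc[of t x \<omega>] tW wW by simp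
    finally have u: "u = aw_mult z \<omega>" .
    have "t \<notin> seps m z" using le_step(3) seps_mult_Omega[OF zW(2) x'(2)] u by simp
    then have l: "len m z < len m x" using ell_reflect_iff[of z t] le_step(2) zW tz len_eq_ell x(1) by simp
    define r where "r = aw_mult (aw_mult (aw_inv z) t) z"
    have rT: "r \<in> CoxRefl m" using T_conj[of z t] zW le_step(2) CoxRefl_eq by (simp add: r_def)
    have "aw_mult z r = x" unfolding r_def tz[symmetric]
      using m_assoc zW tW Wt_inv Wt_mult mult_inv_cancel[of z "aw_mult t z"] by simp
    then have "(z, x) \<in> {(u, aw_mult u t) | u t. u \<in> Wa m \<and> t \<in> CoxRefl m \<and> len m u < len m (aw_mult u t)}"
      using zW rT l by blast
    then have "bruhat_le m z x'" using x(3) zW unfolding bruhat_le_def by (meson converse_rtrancl_into_rtrancl)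
    then show ?case using zW u by blast
  qed
  then obtain x where "x \<in> Wa m" "w = aw_mult x \<omega>" "bruhat_le m x x'"
    using \<open>le w w'\<close> x'(3) by blast
  then show "ext_le m w w'" unfolding ext_le_def using x' by blast
qed

end

section \<open>Parahoric subgroups and permissibility\<close>

lemma omega_weak:
  assumes "m \<ge> 1"
  shows "weak m (omega (2*m) i)"
proof -
  have "i mod int (2*m) < int (2*m)" using assms by (intro pos_mod_bound) simp
  then show ?thesis using assms by (auto simp: weak_def omega_def)
qed

lemma weak_mono: "\<lbrakk>weak m x; 1 \<le> a; a \<le> b; b \<le> 2*m\<rbrakk> \<Longrightarrow> x a \<le> x b"
  using chain_mono[of a b x] by (simp add: weak_def)

lemma act_rfl_fixI:
  assumes "a \<in> {1..2*m}" "b \<in> {1..2*m}" "a \<noteq> b" "x a - x b = real_of_int k" "x (opp m b) - x (opp m a) = real_of_int k"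
  shows "aw_act (rfl m a b k) x = x"
  using assms(4,5) by (intro ext) (auto simp: act_rfl[OF assms(1-3)])

lemma act_rfl_fixD:
  assumes "a \<in> {1..2*m}" "b \<in> {1..2*m}" "a \<noteq> b" "aw_act (rfl m a b k) x = x"
  shows "x a - x b = real_of_int k" "x (opp m b) - x (opp m a) = real_of_int k"
proof -
  show "x a - x b = real_of_int k"
    using fun_cong[OF assms(4), of a] by (simp add: act_rfl[OF assms(1-3)])
  have o: "opp m b \<noteq> opp m a" using assms opp_inj by blast
  note r = opp_range[OF assms(2)] opp_range[OF assms(1)]
  have "aw_act (rfl m (opp m b) (opp m a) k) x = x" using rfl_opp[OF assms(1-3)] assms(4) by simp
  from fun_cong[OF this, of "opp m b"] show "x (opp m b) - x (opp m a) = real_of_int k"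
    by (simp add: act_rfl[OF r o])
qed

lemma sum_opp: "(\<Sum>j=1..2*m. f (opp m j)) = (\<Sum>j=1..2*m. f j)"
  by (rule sum.reindex_bij_witness[where i="opp m" and j="opp m"]) (auto simp: opp_def)

lemma sum_fst:
  assumes "w \<in> Wt m"
  shows "(\<Sum>j=1..2*m. fst w j) = int m * cen m w"
proof -
  have "2 * (\<Sum>j=1..2*m. fst w j) = (\<Sum>j=1..2*m. fst w j) + (\<Sum>j=1..2*m. fst w (opp m j))"
    by (simp add: sum_opp)
  also have "\<dots> = (\<Sum>j=1..2*m. cen m w)"
    unfolding sum.distrib[symmetric] by (intro sum.cong refl Wt_cen[OF assms])
  finally show ?thesis by simp
qed

lemma sum_act:
  assumes "w \<in> Wt m"
  shows "(\<Sum>j=1..2*m. aw_act w x j) = of_int (int m * cen m w) + (\<Sum>j=1..2*m. x j)"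
proof -
  have "(\<Sum>j=1..2*m. x (inv (snd w) j)) = (\<Sum>j=1..2*m. x j)"
    using sum.permute[OF permutes_inv[OF Wt_permutes[OF assms]], of x] by (simp add: o_def)
  then show ?thesis unfolding sum_fst[OF assms, symmetric] by (simp add: aw_act_def sum.distrib)
qed

text \<open>The sum of the coordinates grows by \<open>m * cen m w\<close> under \<open>w\<close>,
  so an element with a fixed point has \<open>cen\<close> zero.\<close>

lemma fix_cen:
  assumes "m \<ge> 1" "w \<in> Wt m" "aw_act w x = x"
  shows "cen m w = 0"
  using sum_act[OF assms(2), of x] assms(1,3) by simp

lemma subgroup_W_I: "subgroup (W_I m I) (affW m)"
proof
  show "W_I m I \<subseteq> carrier (affW m)" by (auto simp: W_I_def stab_in_def)
  show "x \<otimes>\<^bsub>affW m\<^esub> y \<in> W_I m I" if "x \<in> W_I m I" "y \<in> W_I m I" for x y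
    using that aw_act_mult[OF Wt_bij[of x m] Wt_bij[of y m]] Wt_mult by (simp add: W_I_def stab_in_def)
  show "\<one>\<^bsub>affW m\<^esub> \<in> W_I m I" using Wt_one by (auto simp: W_I_def stab_in_def)
  fix x assume x: "x \<in> W_I m I"
  then have W: "x \<in> Wt m" "aw_inv x \<in> Wt m" using Wt_inv by (auto simp: W_I_def stab_in_def)
  have "aw_act (aw_inv x) (omega (2*m) i) = omega (2*m) i" if "i \<in> idx (2*m) I" for i
  proof -
    have "aw_act (aw_inv x) (aw_act x (omega (2*m) i)) = omega (2*m) i"
      using aw_act_mult[OF Wt_bij[OF W(2)] Wt_bij[OF W(1)]] aw_inv_left[OF Wt_bij[OF W(1)]] by simp
    then show ?thesis using x that by (simp add: W_I_def stab_in_def)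
  qed
  then show "m_inv (affW m) x \<in> W_I m I" using W by (simp add: W_I_def stab_in_def)
qed

text \<open>All three axioms are read off from the coordinates of the vertices, which are weakly
  increasing with a spread of at most 1.\<close>

lemma reflection_parabolic_W_I:
  assumes m: "m \<ge> 1" and I: "I \<noteq> {}"
  shows "reflection_parabolic (affW m) (rfls m) (Simple m) (seps m) (W_I m I)"
proof -
  interpret reflection_cocycle "affW m" "rfls m" "Simple m" "seps m"
    by (rule reflection_cocycle_affW[OF m])
  interpret subgroup "W_I m I" "affW m" by (rule subgroup_W_I)
  have WI: "w \<in> Wt m" "aw_act w (omega (2*m) i) = omega (2*m) i" if "w \<in> W_I m I" "i \<in> idx (2*m) I" for w i
    using that by (auto simp: W_I_def stab_in_def)
  obtain i0 where i0: "i0 \<in> idx (2*m) I"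
    using I by (auto simp: idx_def)
  show ?thesis
  proof
    fix h assume h: "h \<in> W_I m I"
    note hW = WI(1)[OF h i0]
    show "seps m h \<subseteq> W_I m I"
    proof
      fix t assume "t \<in> seps m h"
      then obtain a b k where ab: "a \<in> {1..2*m}" "b \<in> {1..2*m}" "a \<noteq> b" "t = rfl m a b k"
        "int a - int b < per m * k" "pos m h a - pos m h b > per m * k"
        using seps_obtain[OF hW] by metis
      have "aw_act t (omega (2*m) i) = omega (2*m) i" if i: "i \<in> idx (2*m) I" for i
      proof -
        note w = omega_weak[OF m, of i]
        \<comment> \<open>The vertex lies in the closures of \<open>A\<close> and of
          \<open>hA\<close>, hence weakly on both sides. The opposite pair of indices needs the same
          argument separately, since the vertex may lie outside \<open>Vsp m\<close>.\<close>
        have eq: "omega (2*m) i c - omega (2*m) i d = of_int k"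
          if "c \<in> {1..2*m}" "d \<in> {1..2*m}" "int c - int d < per m * k" "pos m h c - pos m h d > per m * k" for c d
          using weak_le[OF w that(1-3)] weak_act_ge[OF w that(1,2) hW that(4)] WI(2)[OF h i] by simp
        show ?thesis unfolding ab(4)
          using eq[OF ab(1,2,5,6)] eq[OF opp_range[OF ab(2)] opp_range[OF ab(1)]]
            int_opp[OF ab(1)] int_opp[OF ab(2)] pos_opp[OF hW ab(1)] pos_opp[OF hW ab(2)] ab(5,6)
          by (intro act_rfl_fixI[OF ab(1-3)]) auto
      qed
      then show "t \<in> W_I m I" using rfl_Wt[OF ab(1-3)] ab(4) by (simp add: W_I_def stab_in_def)
    qed
  next
    fix w assume "w \<in> carrier (affW m)" and none: "seps m w \<inter> Simple m \<inter> W_I m I = {}"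
    then have wW: "w \<in> Wt m" by simp
    have w: "weak m (omega (2*m) i)" for i by (rule omega_weak[OF m])
    \<comment> \<open>Vertices that agree at \<open>c\<close> and \<open>d\<close>, and at the
      opposite indices, are constant in between by monotonicity. So each simple reflection along the
      way lies in \<open>W_I\<close> and, by assumption, does not separate.\<close>
    have step: "pos m w j < pos m w (j+1)"
      if j: "1 \<le> c" "c \<le> j" "j < d" "d \<le> 2*m"
        and le: "\<And>i. i \<in> idx (2*m) I \<Longrightarrow> omega (2*m) i d \<le> omega (2*m) i c \<and>
          omega (2*m) i (opp m c) \<le> omega (2*m) i (opp m d)" for c d j
    proof -
      have j': "1 \<le> j" "j < 2*m" using j by auto
      have r: "j \<in> {1..2*m}" "j+1 \<in> {1..2*m}" "j \<noteq> j+1" using j by auto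
      have oj: "1 \<le> opp m d" "opp m d \<le> opp m (j+1)" "opp m (j+1) \<le> opp m j" "opp m j \<le> opp m c" "opp m c \<le> 2*m"
        using j by (auto simp: opp_def)
      have "aw_act (rfl m j (j+1) 0) (omega (2*m) i) = omega (2*m) i" if i: "i \<in> idx (2*m) I" for i
      proof (rule act_rfl_fixI[OF r])
        note mono = weak_mono[OF w, of _ _ i]
        show "omega (2*m) i j - omega (2*m) i (j+1) = of_int 0"
          using mono[of c j] mono[of j "j+1"] mono[of "j+1" d] le[OF i] j by simp
        show "omega (2*m) i (opp m (j+1)) - omega (2*m) i (opp m j) = of_int 0"
          using mono[of "opp m d" "opp m (j+1)"] mono[of "opp m (j+1)" "opp m j"] mono[of "opp m j" "opp m c"]
            le[OF i] oj by simp
      qed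
      then have "rfl m j (j+1) 0 \<in> W_I m I" using rfl_Wt[OF r] by (simp add: W_I_def stab_in_def)
      moreover have "rfl m j (j+1) 0 \<in> Simple m" using rfl_adjacent[OF j'] Simple_eq[OF m] by force
      ultimately show ?thesis using none step_less[OF wW j'] by blast
    qed
    have False if t: "t \<in> seps m w" "t \<in> W_I m I" for t
    proof -
      obtain a b k where ab: "a \<in> {1..2*m}" "b \<in> {1..2*m}" "a \<noteq> b" "t = rfl m a b k"
        "int a - int b < per m * k" "pos m w a - pos m w b > per m * k"
        using seps_obtain[OF wW t(1)] by metis
      have t': "aw_act (rfl m a b k) (omega (2*m) i) = omega (2*m) i" if "i \<in> idx (2*m) I" for i
        using WI(2)[OF t(2) that] ab(4) by simp
      note eq = act_rfl_fixD[OF ab(1-3) t']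
      have "per m * (-1) < per m * k" using ab(5) range_diff[OF ab(1,2)] by linarith
      then have k0: "k \<ge> 0" unfolding per_less_iff by simp
      have bd: "omega (2*m) i 1 \<le> omega (2*m) i c \<and> omega (2*m) i c \<le> omega (2*m) i (2*m)"
        if "c \<in> {1..2*m}" for c i using weak_mono[OF w] that by auto
      have sp: "omega (2*m) i (2*m) \<le> omega (2*m) i 1 + 1" for i using w by (simp add: weak_def)
      have "of_int k \<le> (1::real)" using eq(1)[OF i0] bd[OF ab(1), of i0] bd[OF ab(2), of i0] sp[of i0] by linarith
      then consider "k = 0" | "k = 1" using k0 by fastforce
      then show False
      proof cases
        case 1
        then have l: "a < b" "pos m w a > pos m w b" using ab by auto
        have "pos m w j < pos m w (j+1)" if "a \<le> j" "j < b" for j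
          using step[of a j b] that ab eq 1 by simp
        then show False using chain_strict[of a b "pos m w"] l by force
      next
        case 2
        \<comment> \<open>A difference of 1 uses up the whole spread, so each vertex is constant on
          \<open>1..b\<close> and on \<open>a..2m\<close>; the chain of inequalities then runs
          through the affine wall.\<close>
        have e1: "omega (2*m) i b \<le> omega (2*m) i 1" "omega (2*m) i (2*m) \<le> omega (2*m) i a"
          "omega (2*m) i (opp m a) \<le> omega (2*m) i 1" "omega (2*m) i (2*m) \<le> omega (2*m) i (opp m b)"
          if "i \<in> idx (2*m) I" for i
          using eq[OF that] 2 sp[of i] bd[OF ab(1), of i] bd[OF ab(2), of i]
            bd[OF opp_range[OF ab(1)], of i] bd[OF opp_range[OF ab(2)], of i] by linarith+
        have o: "opp m 1 = 2*m" "opp m (2*m) = 1" by (auto simp: opp_def)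
        have lo: "pos m w j < pos m w (j+1)" if "1 \<le> j" "j < b" for j
          using step[of 1 j b] that ab e1 o by simp
        have hi: "pos m w j < pos m w (j+1)" if "a \<le> j" "j < 2*m" for j
          using step[of a j "2*m"] that ab e1 o by simp
        have "pos m w 1 \<le> pos m w b" using chain_mono[of 1 b "pos m w"] lo ab by (simp add: less_imp_le)
        moreover have "pos m w a \<le> pos m w (2*m)" using chain_mono[of a "2*m" "pos m w"] hi ab by (simp add: less_imp_le)
        moreover have "pos m w (2*m) < pos m w 1 + per m"
        proof (rule step_less_affine[OF wW m])
          have r: "2*m \<in> {1..2*m}" "1 \<in> {1..2*m}" "2*m \<noteq> 1" using m by auto
          have "omega (2*m) i (2*m) - omega (2*m) i 1 = 1" if "i \<in> idx (2*m) I" for i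
            using eq(1)[OF that] 2 sp[of i] bd[OF ab(1), of i] bd[OF ab(2), of i] by simp
          then have "rfl m (2*m) 1 1 \<in> W_I m I"
            using rfl_Wt[OF r] act_rfl_fixI[OF r] by (simp add: W_I_def stab_in_def o)
          moreover have "rfl m (2*m) 1 1 \<in> Simple m"
            unfolding Simple_eq[OF m] by (intro image_eqI[of _ _ 0]) (auto simp: srefl_def)
          ultimately show "rfl m (2*m) 1 1 \<notin> seps m w" using none by blast
        qed
        ultimately show False using ab(6) 2 by simp
      qed
    qed
    then show "seps m w \<inter> W_I m I = {}" by blast
  next
    fix h assume h: "h \<in> W_I m I" "seps m h = {}"
    show "h = \<one>\<^bsub>affW m\<^esub>"
      using length0_cen0[OF m WI(1)[OF h(1) i0] h(2)] fix_cen[OF m WI[OF h(1) i0]] by simp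
  qed
qed

section \<open>Convex hulls of orbits and transfers between coordinates\<close>

lemma conv_convex:
  assumes "y \<in> conv A" "z \<in> conv A" "0 \<le> s" "s \<le> 1"
  shows "(\<lambda>j. (1-s) * y j + s * z j) \<in> conv A"
proof -
  obtain F c where F: "finite F" "F \<subseteq> A" "F \<noteq> {}" "\<And>v. v \<in> F \<Longrightarrow> 0 \<le> c v" "sum c F = 1"
    "y = (\<lambda>j. \<Sum>v\<in>F. c v * v j)" using assms(1) by (auto simp: conv_def)
  obtain H d where H: "finite H" "H \<subseteq> A" "H \<noteq> {}" "\<And>v. v \<in> H \<Longrightarrow> 0 \<le> d v" "sum d H = 1"
    "z = (\<lambda>j. \<Sum>v\<in>H. d v * v j)" using assms(2) by (auto simp: conv_def)
  define e where "e v = (1-s) * (if v \<in> F then c v else 0) + s * (if v \<in> H then d v else 0)" for v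
  have 1: "(\<Sum>v\<in>F \<union> H. e v * g v) = (1-s) * (\<Sum>v\<in>F. c v * g v) + s * (\<Sum>v\<in>H. d v * g v)" for g
  proof -
    have "(\<Sum>v\<in>F \<union> H. e v * g v) = (1-s) * (\<Sum>v\<in>F \<union> H. if v \<in> F then c v * g v else 0)
        + s * (\<Sum>v\<in>F \<union> H. if v \<in> H then d v * g v else 0)"
      unfolding sum_distrib_left sum.distrib[symmetric] by (intro sum.cong) (auto simp: e_def algebra_simps)
    also have "(\<Sum>v\<in>F \<union> H. if v \<in> F then c v * g v else 0) = (\<Sum>v\<in>F. c v * g v)"
      using F H by (intro sum.mono_neutral_cong_right) auto
    also have "(\<Sum>v\<in>F \<union> H. if v \<in> H then d v * g v else 0) = (\<Sum>v\<in>H. d v * g v)"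
      using F H by (intro sum.mono_neutral_cong_right) auto
    finally show ?thesis .
  qed
  show ?thesis
    unfolding conv_def mem_Collect_eq
  proof (intro exI[of _ "F \<union> H"] exI[of _ e] conjI)
    show "sum e (F \<union> H) = 1" using 1[of "\<lambda>_. 1"] F H by simp
    show "\<forall>v\<in>F \<union> H. 0 \<le> e v" using F H assms by (auto simp: e_def)
    show "(\<lambda>j. (1 - s) * y j + s * z j) = (\<lambda>j. \<Sum>v\<in>F \<union> H. e v * v j)"
      unfolding 1 F H by simp
  qed (use F H in auto)
qed

lemma conv_permute:
  assumes "y \<in> conv A" "bij \<tau>" "\<And>v. v \<in> A \<Longrightarrow> v \<circ> \<tau> \<in> A"
  shows "y \<circ> \<tau> \<in> conv A"
proof -
  obtain F c where F: "finite F" "F \<subseteq> A" "F \<noteq> {}" "\<And>v. v \<in> F \<Longrightarrow> 0 \<le> c v" "sum c F = 1"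
    "y = (\<lambda>j. \<Sum>v\<in>F. c v * v j)" using assms(1) by (auto simp: conv_def)
  have b: "(v \<circ> \<tau>) \<circ> inv \<tau> = v" for v :: "nat \<Rightarrow> real"
    using assms(2) by (simp add: fun_eq_iff surj_f_inv_f bij_is_surj)
  then have inj: "inj_on (\<lambda>v. v \<circ> \<tau>) F" by (metis inj_onI)
  define d where "d v = c (v \<circ> inv \<tau>)" for v
  have 1: "(\<Sum>v\<in>(\<lambda>v. v \<circ> \<tau>) ` F. d v * g v) = (\<Sum>v\<in>F. c v * g (v \<circ> \<tau>))" for g
    unfolding sum.reindex[OF inj] by (simp add: d_def b)
  show ?thesis
    unfolding conv_def mem_Collect_eq
  proof (intro exI[of _ "(\<lambda>v. v \<circ> \<tau>) ` F"] exI[of _ d] conjI)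
    show "sum d ((\<lambda>v. v \<circ> \<tau>) ` F) = 1" using 1[of "\<lambda>_. 1"] F by simp
    show "\<forall>v\<in>(\<lambda>v. v \<circ> \<tau>) ` F. 0 \<le> d v" using F by (auto simp: d_def b)
    show "y \<circ> \<tau> = (\<lambda>j. \<Sum>v\<in>(\<lambda>v. v \<circ> \<tau>) ` F. d v * v j)" unfolding 1 F by auto
  qed (use F assms in auto)
qed

text \<open>The factor \<open>s\<close> can be a sign: a linear form that is constant on
  \<open>A\<close> is then constant on the hull by two applications.\<close>

lemma conv_sum_le:
  assumes "y \<in> conv A" "\<And>v. v \<in> A \<Longrightarrow> (\<Sum>j\<in>J. s * v (h j)) \<le> B"
  shows "(\<Sum>j\<in>J. s * y (h j)) \<le> B"
proof -
  obtain F c where F: "finite F" "F \<subseteq> A" "F \<noteq> {}" "\<And>v. v \<in> F \<Longrightarrow> 0 \<le> c v" "sum c F = 1"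
    "y = (\<lambda>j. \<Sum>v\<in>F. c v * v j)" using assms(1) by (auto simp: conv_def)
  have "(\<Sum>j\<in>J. s * y (h j)) = (\<Sum>j\<in>J. \<Sum>v\<in>F. c v * (s * v (h j)))"
    unfolding F sum_distrib_left by (simp add: mult.left_commute)
  also have "\<dots> = (\<Sum>v\<in>F. c v * (\<Sum>j\<in>J. s * v (h j)))"
    unfolding sum_distrib_left by (rule sum.swap)
  also have "\<dots> \<le> (\<Sum>v\<in>F. c v * B)"
    using F assms(2) by (intro sum_mono mult_left_mono) auto
  also have "\<dots> = B" using F(5) by (simp flip: sum_distrib_right)
  finally show ?thesis .
qed

lemma conv_base: "v \<in> A \<Longrightarrow> v \<in> conv A"
  unfolding conv_def mem_Collect_eq by (intro exI[of _ "{v}"] exI[of _ "\<lambda>_. 1"]) auto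

definition orbit_hull :: "nat \<Rightarrow> (nat \<Rightarrow> int) \<Rightarrow> (nat \<Rightarrow> real) set" where
  "orbit_hull n \<mu> = conv {of_int_vec (perm_vec \<sigma> \<mu>) | \<sigma>. \<sigma> permutes {1..n}}"

lemma orbit_hull_permute:
  assumes "y \<in> orbit_hull n \<mu>" "\<tau> permutes {1..n}"
  shows "y \<circ> \<tau> \<in> orbit_hull n \<mu>"
  unfolding orbit_hull_def
proof (rule conv_permute)
  show "y \<in> conv {of_int_vec (perm_vec \<sigma> \<mu>) |\<sigma>. \<sigma> permutes {1..n}}" using assms by (simp add: orbit_hull_def)
  show "bij \<tau>" using assms permutes_bij by blast
  fix v assume "v \<in> {of_int_vec (perm_vec \<sigma> \<mu>) |\<sigma>. \<sigma> permutes {1..n}}"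
  then obtain \<sigma> where s: "\<sigma> permutes {1..n}" "v = of_int_vec (perm_vec \<sigma> \<mu>)" by blast
  have i: "inv (inv \<tau> \<circ> \<sigma>) = inv \<sigma> \<circ> \<tau>"
    using s(1) assms(2) by (metis inv_inv_eq o_inv_distrib permutes_bij permutes_inv)
  have "v \<circ> \<tau> = of_int_vec (perm_vec (inv \<tau> \<circ> \<sigma>) \<mu>)"
    unfolding s(2) of_int_vec_def perm_vec_def i by auto
  moreover have "inv \<tau> \<circ> \<sigma> permutes {1..n}" using s(1) assms(2) permutes_compose permutes_inv by blast
  ultimately show "v \<circ> \<tau> \<in> {of_int_vec (perm_vec \<sigma> \<mu>) |\<sigma>. \<sigma> permutes {1..n}}" by blast
qed

text \<open>The transfer is a convex combination of \<open>y\<close> and its image under the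
  transposition of \<open>a\<close> and \<open>b\<close>.\<close>

lemma orbit_hull_transfer:
  assumes y: "y \<in> orbit_hull n \<mu>" and ab: "a \<in> {1..n}" "b \<in> {1..n}" "a \<noteq> b" and d: "0 \<le> d" "d \<le> y a - y b"
  shows "y(a := y a - d, b := y b + d) \<in> orbit_hull n \<mu>"
proof (cases "d = 0")
  case False
  define s where "s = d / (y a - y b)"
  have p: "y a - y b > 0" using False d by linarith
  have s: "0 \<le> s" "s \<le> 1" using d p by (auto simp: s_def)
  have sd: "s * (y a - y b) = d" using p by (simp add: s_def)
  have "y \<circ> Transposition.transpose a b \<in> orbit_hull n \<mu>"
    using orbit_hull_permute[OF y permutes_swap_id[OF ab(1,2)]] .
  then have "(\<lambda>j. (1-s) * y j + s * (y \<circ> Transposition.transpose a b) j) \<in> orbit_hull n \<mu>"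
    using conv_convex y s unfolding orbit_hull_def by blast
  also have "(\<lambda>j. (1-s) * y j + s * (y \<circ> Transposition.transpose a b) j) = y(a := y a - d, b := y b + d)"
    using sd ab(3) by (auto simp: transpose_def algebra_simps)
  finally show ?thesis .
qed (use y in simp)

definition permissible :: "nat \<Rightarrow> int \<Rightarrow> (nat \<Rightarrow> int) \<Rightarrow> aw \<Rightarrow> bool" where
  "permissible m i \<mu> w \<longleftrightarrow>
    (\<lambda>j. aw_act w (omega (2*m) i) j - omega (2*m) i j) \<in> orbit_hull (2*m) \<mu>"

lemma permissible_reflect:
  assumes m: "m \<ge> 1" and x: "x \<in> Wt m" and t: "t \<in> rfls m" "t \<notin> seps m x"
    and perm: "permissible m i \<mu> (aw_mult t x)"
  shows "permissible m i \<mu> x"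
proof -
  obtain a b k where ab: "a \<in> {1..2*m}" "b \<in> {1..2*m}" "a \<noteq> b" "t = rfl m a b k" "int a - int b < per m * k"
  proof -
    obtain a b k where ab: "a \<in> {1..2*m}" "b \<in> {1..2*m}" "a \<noteq> b" "t = rfl m a b k"
      using t(1) by (auto simp: rfls_def)
    show ?thesis
    proof (cases "int a - int b < per m * k")
      case True
      then show ?thesis using that ab by blast
    next
      case False
      then have "int b - int a < per m * (-k)" using pos_neq[OF Wt_one ab(1-3), of k] by simp
      then show ?thesis using that[of b a "-k"] ab rfl_swap[OF ab(1-3), of k] by simp
    qed
  qed
  have px: "pos m x a - pos m x b < per m * k"
    using t(2) rfl_in_seps[OF x ab(1-3), of k] ab(4,5) by (simp add: separates_def)
  define \<omega> where "\<omega> = omega (2*m) i"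
  define y where "y = aw_act x \<omega>"
  have tx: "aw_act (aw_mult t x) \<omega> = aw_act t y"
    using aw_act_mult[OF Wt_bij[OF rfl_Wt[OF ab(1-3)]] Wt_bij[OF x]] ab(4) by (simp add: y_def)
  have w: "weak m \<omega>" unfolding \<omega>_def by (rule omega_weak[OF m])
  define v where "v j = aw_act t y j - \<omega> j" for j
  have v: "v \<in> orbit_hull (2*m) \<mu>" using perm unfolding permissible_def v_def tx[symmetric] \<omega>_def .
  define d where "d = of_int k - (y a - y b)"
  have d: "0 \<le> d" using weak_act_le[OF w ab(1,2) x px] by (simp add: d_def y_def)
  have e: "\<omega> a - \<omega> b \<le> of_int k" using weak_le[OF w ab(1,2,5)] .
  have va: "v a = y b + of_int k - \<omega> a" "v b = y a - of_int k - \<omega> b"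
    using ab(3) by (simp_all add: v_def ab(4) act_rfl[OF ab(1-3)])
  define v1 where "v1 = v(a := v a - d, b := v b + d)"
  \<comment> \<open>The amount is admissible because \<open>v a - v b\<close> exceeds
    \<open>d\<close> by \<open>k - (\<omega> a - \<omega> b)\<close>, which is nonnegative as
    \<omega> lies in the closed alcove.\<close>
  have v1: "v1 \<in> orbit_hull (2*m) \<mu>"
    unfolding v1_def using d e by (intro orbit_hull_transfer[OF v ab(1-3)]) (auto simp: va d_def)
  define goal where "goal = (\<lambda>j. y j - \<omega> j)"
  have "goal \<in> orbit_hull (2*m) \<mu>"
  proof (cases "b = opp m a")
    case True
    then have o: "opp m b = a" using ab by simp
    have "v1 = goal"
      unfolding v1_def goal_def va d_def v_def ab(4) act_rfl[OF ab(1-3)]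
      using ab(3) True o by (intro ext) auto
    then show ?thesis using v1 by simp
  next
    case False
    \<comment> \<open>The opposite pair needs a second transfer with its own amount, which may
      differ from \<open>d\<close> because \<omega> need not lie in \<open>Vsp m\<close>.\<close>
    let ?a = "opp m b" and ?b = "opp m a"
    have r: "?a \<in> {1..2*m}" "?b \<in> {1..2*m}" "?a \<noteq> ?b" using ab opp_inj opp_range by blast+
    have ne: "?a \<noteq> a" "?b \<noteq> b" "?a \<noteq> b" "?b \<noteq> a" using False ab opp_opp[OF ab(2)] by auto
    have e': "int ?a - int ?b < per m * k" "pos m x ?a - pos m x ?b < per m * k"
      using int_opp[OF ab(1)] int_opp[OF ab(2)] pos_opp[OF x ab(1)] pos_opp[OF x ab(2)] ab(5) px by simp_all
    define d' where "d' = of_int k - (y ?a - y ?b)"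
    have d': "0 \<le> d'" using weak_act_le[OF w r(1,2) x e'(2)] by (simp add: d'_def y_def)
    have f: "\<omega> ?a - \<omega> ?b \<le> of_int k" using weak_le[OF w r(1,2) e'(1)] .
    have vb: "v1 ?a = y ?b + of_int k - \<omega> ?a" "v1 ?b = y ?a - of_int k - \<omega> ?b"
      using ne r(3) by (auto simp: v1_def v_def ab(4) act_rfl[OF ab(1-3)])
    have "v1(?a := v1 ?a - d', ?b := v1 ?b + d') \<in> orbit_hull (2*m) \<mu>"
      using d' f by (intro orbit_hull_transfer[OF v1 r]) (auto simp: vb d'_def)
    moreover have "v1(?a := v1 ?a - d', ?b := v1 ?b + d') = goal"
    proof (rule ext)
      fix j
      consider "j = a" | "j = b" | "j = ?a" | "j = ?b" | "j \<notin> {a, b, ?a, ?b}" by blast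
      then show "(v1(?a := v1 ?a - d', ?b := v1 ?b + d')) j = goal j"
        using ne r(3) ab(3)
        by cases (simp_all add: vb d'_def goal_def, simp_all add: v1_def va d_def v_def ab(4) act_rfl[OF ab(1-3)])
    qed
    ultimately show ?thesis by simp
  qed
  then show ?thesis by (simp add: permissible_def goal_def y_def \<omega>_def)
qed

section \<open>Raising a vector by reflections\<close>

text \<open>Passing to opposite indices reverses the order of \<kappa>, so the ranks of
  \<open>j\<close> and \<open>opp m j\<close> are opposite and the ranking lies in
  \<open>Sstar m\<close>; its inverse sorts.\<close>

lemma exists_Sstar_sort:
  fixes \<kappa> :: "nat \<Rightarrow> int"
  assumes inj: "inj_on \<kappa> {1..2*m}" and K: "\<And>j. j \<in> {1..2*m} \<Longrightarrow> \<kappa> j + \<kappa> (opp m j) = K"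
  shows "\<exists>\<pi>\<in>Sstar m. \<forall>i j. 1 \<le> i \<and> i < j \<and> j \<le> 2*m \<longrightarrow> \<kappa> (\<pi> j) < \<kappa> (\<pi> i)"
proof -
  define R where "R = {1..2*m}"
  define r where "r j = (if j \<in> R then card {l \<in> R. \<kappa> j \<le> \<kappa> l} else j)" for j
  have fin: "finite R" by (simp add: R_def)
  have less: "r i < r j" if "i \<in> R" "j \<in> R" "\<kappa> j < \<kappa> i" for i j
  proof -
    have "{l \<in> R. \<kappa> i \<le> \<kappa> l} \<subset> {l \<in> R. \<kappa> j \<le> \<kappa> l}" using that by force
    then show ?thesis using that fin by (simp add: r_def psubset_card_mono)
  qed
  have rR: "r j \<in> R" if "j \<in> R" for j
  proof -
    have "{j} \<subseteq> {l \<in> R. \<kappa> j \<le> \<kappa> l}" using that by auto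
    then have "card {j} \<le> card {l \<in> R. \<kappa> j \<le> \<kappa> l}" using fin by (intro card_mono) auto
    moreover have "card {l \<in> R. \<kappa> j \<le> \<kappa> l} \<le> card R" using fin by (intro card_mono) auto
    ultimately show ?thesis using that by (simp add: r_def R_def)
  qed
  have "inj_on r R"
  proof (rule inj_onI)
    fix i j assume ij: "i \<in> R" "j \<in> R" "r i = r j"
    then have "\<kappa> i = \<kappa> j" using less[of i j] less[of j i] by (cases "\<kappa> i" "\<kappa> j" rule: linorder_cases) auto
    then show "i = j" using inj_onD[OF inj] ij unfolding R_def by blast
  qed
  then have "bij_betw r R R" using rR fin by (simp add: bij_betw_def card_subset_eq card_image image_subsetI)
  then have perm: "r permutes {1..2*m}"
    by (intro bij_imp_permutes) (auto simp: R_def r_def)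
  have rS: "r \<in> Sstar m"
  proof (rule SstarI[OF perm])
    fix j assume j: "j \<in> {1..2*m}"
    then have jR: "j \<in> R" "opp m j \<in> R" using opp_range by (auto simp: R_def simp del: atLeastAtMost_iff)
    have "card {l \<in> R. \<kappa> (opp m j) \<le> \<kappa> l} = card {l \<in> R. \<kappa> l \<le> \<kappa> j}"
    proof (rule bij_betw_same_card[of "opp m"])
      have "\<kappa> (opp m l) \<le> \<kappa> j \<longleftrightarrow> \<kappa> (opp m j) \<le> \<kappa> l" "\<kappa> (opp m j) \<le> \<kappa> (opp m l) \<longleftrightarrow> \<kappa> l \<le> \<kappa> j"
        if "l \<in> R" for l
        using K[OF j] K[of l] that by (auto simp: R_def)
      then show "bij_betw (opp m) {l \<in> R. \<kappa> (opp m j) \<le> \<kappa> l} {l \<in> R. \<kappa> l \<le> \<kappa> j}"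
        by (intro bij_betwI[where g="opp m"]) (auto simp: R_def opp_def)
    qed
    \<comment> \<open>The two sets cover all indices and, by injectivity, share only
      \<open>j\<close>; hence the extra 1.\<close>
    moreover have "card {l \<in> R. \<kappa> l \<le> \<kappa> j} + card {l \<in> R. \<kappa> j \<le> \<kappa> l} = 2*m + 1"
    proof -
      have "card {l \<in> R. \<kappa> l \<le> \<kappa> j} + card {l \<in> R. \<kappa> j \<le> \<kappa> l} =
        card ({l \<in> R. \<kappa> l \<le> \<kappa> j} \<union> {l \<in> R. \<kappa> j \<le> \<kappa> l}) + card ({l \<in> R. \<kappa> l \<le> \<kappa> j} \<inter> {l \<in> R. \<kappa> j \<le> \<kappa> l})"
        using fin by (intro card_Un_Int) auto
      also have "{l \<in> R. \<kappa> l \<le> \<kappa> j} \<union> {l \<in> R. \<kappa> j \<le> \<kappa> l} = R" by auto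
      also have "{l \<in> R. \<kappa> l \<le> \<kappa> j} \<inter> {l \<in> R. \<kappa> j \<le> \<kappa> l} = {j}"
        using jR inj_onD[OF inj] unfolding R_def by (auto dest!: antisym simp del: atLeastAtMost_iff)
      finally show ?thesis by (simp add: R_def)
    qed
    ultimately have "r (opp m j) + r j = 2*m + 1" using jR by (simp add: r_def)
    then show "r (opp m j) = opp m (r j)" by (simp add: opp_def)
  qed
  show ?thesis
  proof (intro bexI[of _ "inv r"] allI impI)
    show "inv r \<in> Sstar m" using Sstar_inv[OF rS] .
    fix i j assume ij: "1 \<le> i \<and> i < j \<and> j \<le> 2*m"
    then have R: "inv r i \<in> R" "inv r j \<in> R"
      using Sstar_range[OF Sstar_inv[OF rS], of i] Sstar_range[OF Sstar_inv[OF rS], of j] by (auto simp: R_def)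
    have "r (inv r i) = i" "r (inv r j) = j" using permutes_inverses[OF perm] by auto
    then have "inv r i \<noteq> inv r j" "\<not> \<kappa> (inv r i) < \<kappa> (inv r j)" using less[OF R(2,1)] ij by (force, force)
    moreover from this have "\<kappa> (inv r i) \<noteq> \<kappa> (inv r j)" using inj_onD[OF inj] R unfolding R_def by blast
    ultimately show "\<kappa> (inv r j) < \<kappa> (inv r i)" by linarith
  qed
qed

text \<open>The image of \<open>{1..k}\<close> and \<open>{1..k}\<close> itself differ in equally
  many elements, and \<open>f k\<close> separates the values on the two differences.\<close>

lemma sum_permuted_le:
  fixes f :: "nat \<Rightarrow> int"
  assumes mono: "\<And>i j. 1 \<le> i \<Longrightarrow> i \<le> j \<Longrightarrow> j \<le> n \<Longrightarrow> f j \<le> f i"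
    and perm: "\<theta> permutes {1..n}" and k: "k \<le> n"
  shows "(\<Sum>j=1..k. f (\<theta> j)) \<le> (\<Sum>j=1..k. f j)"
proof (cases "k = 0")
  case False
  define A where "A = \<theta> ` {1..k}"
  define B where "B = {1..k}"
  have A: "A \<subseteq> {1..n}" using permutes_image[OF perm] k by (force simp: A_def)
  have inj: "inj_on \<theta> {1..k}" using permutes_inj[OF perm] by (rule inj_on_subset) simp
  have fin: "finite A" "finite B" by (auto simp: A_def B_def)
  have card: "card A = card B" by (simp add: A_def B_def card_image[OF inj])
  have dcard: "card (A - B) = card (B - A)"
    using card fin by (metis Int_commute card_Diff_subset_Int finite_Int)
  have "sum f (A - B) \<le> of_nat (card (A - B)) * f k"
    using A mono k False by (intro sum_bounded_above) (force simp: B_def)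
  also have "\<dots> = of_nat (card (B - A)) * f k" by (simp add: dcard)
  also have "\<dots> \<le> sum f (B - A)"
    using mono k by (intro sum_bounded_below) (auto simp: B_def)
  finally have "sum f (A - B) + sum f (A \<inter> B) \<le> sum f (B - A) + sum f (B \<inter> A)" by (simp add: Int_commute)
  then have "sum f A \<le> sum f B"
    using fin by (simp add: add.commute sum.Int_Diff[of A f B] sum.Int_Diff[of B f A])
  then show ?thesis by (simp add: A_def B_def sum.reindex[OF inj])
qed simp

text \<open>Nonnegative for all \<open>k\<close> and zero at the end: \<open>P\<close> lies below
  \<open>Q\<close> in the dominance order.\<close>

definition deficit :: "(nat \<Rightarrow> int) \<Rightarrow> (nat \<Rightarrow> int) \<Rightarrow> nat \<Rightarrow> int" where
  "deficit P Q k = (\<Sum>j=1..k. Q j - P j)"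

definition reflect :: "nat \<Rightarrow> nat \<Rightarrow> nat \<Rightarrow> int \<Rightarrow> (nat \<Rightarrow> int) \<Rightarrow> nat \<Rightarrow> int" where
  "reflect m a b k P j = (if j = a then P b + k else if j = b then P a - k
     else if j = opp m a then P (opp m b) - k else if j = opp m b then P (opp m a) + k else P j)"

lemma deficit_Suc: "deficit P Q (Suc k) = deficit P Q k + (Q (Suc k) - P (Suc k))"
  by (simp add: deficit_def)

text \<open>The reflection moves \<open>d\<close> units from \<open>b\<close> to \<open>a\<close> in
  the first half. In the second half it moves units from \<open>opp m a\<close> to
  \<open>opp m b\<close>, and their number differs from \<open>d\<close> by the difference of the
  pair sums at \<open>a\<close> and \<open>b\<close>.\<close>

lemma deficit_reflect:
  assumes "1 \<le> a" "a < b" "b \<le> m"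
  shows "deficit (reflect m a b (P a - P b + d) P) Q l = deficit P Q l
    - (if a \<le> l \<and> l < b then d else 0)
    - (if opp m b \<le> l \<and> l < opp m a then (P a + P (opp m a)) - (P b + P (opp m b)) + d else 0)"
proof -
  define d' where "d' = (P a + P (opp m a)) - (P b + P (opp m b)) + d"
  have ne: "opp m a \<noteq> a" "opp m a \<noteq> b" "opp m b \<noteq> a" "opp m b \<noteq> b" "opp m a \<noteq> opp m b"
    using assms by (auto simp: opp_def)
  have 1: "Q j - reflect m a b (P a - P b + d) P j = (Q j - P j) - (if j = a then d else 0)
      + (if j = b then d else 0) - (if j = opp m b then d' else 0) + (if j = opp m a then d' else 0)" for j
    using ne assms by (auto simp: reflect_def d'_def)
  have s: "(\<Sum>j=1..l. if j = c then e else 0) = (if c \<le> l then e else 0)" if "1 \<le> c" for c and e :: int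
    using that by (simp add: sum.delta)
  have r: "1 \<le> opp m a" "1 \<le> opp m b" "opp m b < opp m a" using assms by (auto simp: opp_def)
  show ?thesis unfolding deficit_def 1 sum.distrib sum_subtractf d'_def[symmetric]
    using assms r by (simp add: s)
qed

lemma deficit_opp:
  assumes D: "deficit P Q (2*m) = 0" and l: "l \<le> 2*m"
  shows "deficit P Q (2*m - l) = deficit P Q l -
    (\<Sum>j=1..l. (Q j + Q (opp m j)) - (P j + P (opp m j)))"
  using l
proof (induction l)
  case 0
  then show ?case using D by (simp add: deficit_def)
next
  case (Suc l)
  have e: "2*m - l = Suc (2*m - Suc l)" "opp m (Suc l) = 2*m - l" using Suc by (auto simp: opp_def)
  have "deficit P Q (2*m - l) = deficit P Q (2*m - Suc l) + (Q (opp m (Suc l)) - P (opp m (Suc l)))"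
    using deficit_Suc[of P Q "2*m - Suc l"] e by simp
  then show ?case using Suc by (simp add: deficit_Suc)
qed

lemma deficit_zero_iff:
  assumes "\<And>k. k \<le> n \<Longrightarrow> deficit P Q k = 0" "1 \<le> j" "j \<le> n"
  shows "P j = Q j"
  using deficit_Suc[of P Q "j-1"] assms(1)[of j] assms(1)[of "j-1"] assms(2,3) by simp

text \<open>If the deficit at \<open>m\<close> is positive, the long root at \<open>m\<close> works. Otherwise the first and the second
  half of the coordinates can be treated together: \<open>f\<close> and \<open>g\<close> are their deficits, which differ only by the
  sums of opposite pairs, and an entry at the first index \<open>a\<close> where they do not both vanish can be
  raised at the expense of a later one.\<close>

lemma exists_reflection_up:
  fixes P Q :: "nat \<Rightarrow> int"
  assumes m: "m \<ge> 1"
    and SP: "\<And>j. j \<in> {1..2*m} \<Longrightarrow> P j + P (opp m j) \<in> {c-1, c}"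
    and SQ: "\<And>j. j \<in> {1..2*m} \<Longrightarrow> Q j + Q (opp m j) \<in> {c-1, c}"
    and D: "\<And>k. k \<le> 2*m \<Longrightarrow> 0 \<le> deficit P Q k" and D0: "deficit P Q (2*m) = 0"
    and ne: "\<exists>j\<in>{1..2*m}. P j \<noteq> Q j"
  shows "\<exists>a b k. 1 \<le> a \<and> a < b \<and> b \<le> 2*m \<and> (P a - P b < k \<or> P (opp m b) - P (opp m a) < k) \<and>
    (\<forall>l\<le>2*m. 0 \<le> deficit (reflect m a b k P) Q l) \<and>
    (\<Sum>l\<le>2*m. deficit (reflect m a b k P) Q l) < (\<Sum>l\<le>2*m. deficit P Q l)"
    (is "\<exists>a b k. ?G a b k")
proof (cases "deficit P Q m \<ge> 1")
  case True
  \<comment> \<open>One unit passes from \<open>m+1\<close> to its opposite \<open>m\<close>, which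
    lowers the deficit at \<open>m\<close> and no other.\<close>
  let ?k = "P m - P (m+1) + 1"
  have o: "opp m m = m+1" "opp m (m+1) = m" by (auto simp: opp_def)
  have r: "deficit (reflect m m (m+1) ?k P) Q l = deficit P Q l - (if l = m then 1 else 0)" for l
  proof -
    have 1: "Q j - reflect m m (m+1) ?k P j = (Q j - P j) - (if j = m then 1 else 0) + (if j = m+1 then 1 else 0)" for j
      by (auto simp: reflect_def o)
    show ?thesis unfolding deficit_def 1 sum.distrib sum_subtractf using m by (auto simp: sum.delta)
  qed
  have "?G m (m+1) ?k"
  proof (intro conjI allI impI)
    show "0 \<le> deficit (reflect m m (m+1) ?k P) Q l" if "l \<le> 2*m" for l using D[OF that] True by (simp add: r)
    show "(\<Sum>l\<le>2*m. deficit (reflect m m (m+1) ?k P) Q l) < (\<Sum>l\<le>2*m. deficit P Q l)"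
      by (rule sum_strict_mono_ex1) (auto simp: r intro!: bexI[of _ m])
  qed (use m in auto)
  then show ?thesis by blast
next
  case False
  define f where "f l = deficit P Q l" for l
  define g where "g l = deficit P Q (2*m - l)" for l
  define S where "S j = P j + P (opp m j)" for j
  define E where "E l = (\<Sum>j=1..l. (Q j + Q (opp m j)) - S j)" for l
  have fg: "f l - g l = E l" if "l \<le> 2*m" for l
    using deficit_opp[OF D0 that] by (simp add: f_def g_def E_def S_def)
  have E_Suc: "E (Suc l) = E l + (Q (Suc l) + Q (opp m (Suc l)) - S (Suc l))" for l by (simp add: E_def)
  have f0: "f l \<ge> 0" "g l \<ge> 0" if "l \<le> 2*m" for l using D that by (auto simp: f_def g_def)
  have fm: "f m = 0" "g m = 0" using False D[of m] by (auto simp: f_def g_def mult_2)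
  \<comment> \<open>Either amount may be zero: \<open>d\<close> measures strictness for the pair
    \<open>a\<close>, \<open>b\<close>, and \<open>d'\<close> for the opposite pair, which is why
    the goal contains a disjunction.\<close>
  have move: "\<exists>a b k. ?G a b k"
    if ab: "1 \<le> a" "a < b" "b \<le> m" and d: "0 \<le> d" "0 \<le> d'" "1 \<le> d + d'" "d' = S a - S b + d"
      and bd: "\<And>l. a \<le> l \<Longrightarrow> l < b \<Longrightarrow> d \<le> f l \<and> d' \<le> g l" for a b d d'
  proof -
    let ?k = "P a - P b + d"
    note r = deficit_reflect[OF ab, of P d Q, folded S_def, folded d(4)]
    have bd': "d' \<le> deficit P Q l" if "opp m b \<le> l" "l < opp m a" for l
      using bd[of "2*m - l"] that ab by (simp add: g_def opp_def)
    have disj: "\<not> (l < b \<and> opp m b \<le> l)" for l using ab by (auto simp: opp_def)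
    have "?G a b ?k"
    proof (intro conjI allI impI)
      show "0 \<le> deficit (reflect m a b ?k P) Q l" if "l \<le> 2*m" for l
        using D[OF that] bd[of l] bd'[of l] disj[of l] unfolding r f_def by auto
      show "(\<Sum>l\<le>2*m. deficit (reflect m a b ?k P) Q l) < (\<Sum>l\<le>2*m. deficit P Q l)"
      proof (rule sum_strict_mono_ex1)
        show "\<forall>l\<in>{..2*m}. deficit (reflect m a b ?k P) Q l \<le> deficit P Q l" using d unfolding r by auto
        show "\<exists>l\<in>{..2*m}. deficit (reflect m a b ?k P) Q l < deficit P Q l"
        proof (cases "d \<ge> 1")
          case True
          then show ?thesis using ab disj[of a] unfolding r by (intro bexI[of _ a]) auto
        next
          case False
          then have "d' \<ge> 1" using d by linarith
          moreover have "opp m b \<le> 2*m - a" "2*m - a < opp m a" using ab by (auto simp: opp_def)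
          ultimately show ?thesis using d unfolding r by (intro bexI[of _ "2*m - a"]) auto
        qed
      qed auto
      show "P a - P b < ?k \<or> P (opp m b) - P (opp m a) < ?k" using d by (auto simp: S_def)
    qed (use ab in auto)
    then show ?thesis by blast
  qed
  have ex: "\<exists>l. l \<le> m \<and> f l + g l > 0"
  proof (rule ccontr)
    assume n: "\<not> ?thesis"
    have z: "f l = 0" "g l = 0" if "l \<le> m" for l
    proof -
      have "f l + g l \<le> 0" using n that by auto
      then show "f l = 0" "g l = 0" using f0[of l] that by linarith+
    qed
    have "deficit P Q l = 0" if "l \<le> 2*m" for l
      using z(1)[of l] z(2)[of "2*m - l"] that by (cases "l \<le> m") (auto simp: f_def g_def)
    then show False using deficit_zero_iff[of "2*m" P Q] ne by auto
  qed
  define a where "a = (LEAST l. l \<le> m \<and> f l + g l > 0)"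
  have a: "a \<le> m" "f a + g a > 0" using LeastI_ex[OF ex] by (auto simp: a_def)
  have am: "a < m" using a fm by (cases "a = m") auto
  have a1: "a \<ge> 1"
    using a D0 by (cases "a = 0") (auto simp: f_def g_def deficit_def)
  have "\<not> (a - 1 \<le> m \<and> f (a-1) + g (a-1) > 0)" using not_less_Least[of "a-1" "\<lambda>l. l \<le> m \<and> f l + g l > 0", folded a_def] a1 by simp
  then have fa: "f (a-1) = 0" "g (a-1) = 0" using f0[of "a-1"] a by linarith+
  then have Ea: "E (a-1) = 0" using fg[of "a-1"] a by simp
  then have Ea': "E a = Q a + Q (opp m a) - S a" using E_Suc[of "a-1"] a1 by simp
  have Sv: "S j = c-1 \<or> S j = c" "c-1 \<le> Q j + Q (opp m j)" "Q j + Q (opp m j) \<le> c" if "1 \<le> j" "j \<le> 2*m" for j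
    using SP[of j] SQ[of j] that by (auto simp: S_def)
  show ?thesis
  proof (cases "S a = c")
    case False
    then have Sa: "S a = c-1" using Sv(1)[of a] a1 am by simp
    then have "f a \<ge> g a" using Ea' fg[of a] Sv(2)[of a] a1 am by simp
    then have fa1: "f a \<ge> 1" using a by linarith
    define b where "b = (LEAST l. a < l \<and> f l = 0)"
    have b: "a < b" "f b = 0" using LeastI[of "\<lambda>l. a < l \<and> f l = 0" m] am fm by (auto simp: b_def)
    have bm: "b \<le> m" unfolding b_def using am fm by (intro Least_le) simp
    have fb: "f l \<ge> 1" if "a \<le> l" "l < b" for l
      using not_less_Least[of l "\<lambda>l. a < l \<and> f l = 0"] that fa1 f0[of l] bm
      by (cases "l = a") (auto simp: b_def[symmetric])
    show ?thesis
    \<comment> \<open>A pair sum \<open>c\<close> at \<open>b'\<close> allows a move in the first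
      half only. Otherwise the pair sums of \<open>P\<close> are minimal on \<open>a..b\<close>, so
      \<open>E\<close> increases there from \<open>0\<close> to a value that is at most
      \<open>0\<close>; thus \<open>f = g\<close> before \<open>b\<close>, and both halves can be
      moved by one.\<close>
    proof (cases "\<exists>b'. a < b' \<and> b' \<le> b \<and> S b' = c")
      case True
      then obtain b' where b': "a < b'" "b' \<le> b" "S b' = c" by blast
      show ?thesis
        by (rule move[of a b' 1 0]) (use a1 b' bm Sa fb f0 in auto)
    next
      case none: False
      have S: "S j = c-1" if "a \<le> j" "j \<le> b" for j
        using none that Sa Sv(1)[of j] a1 bm by (cases "j = a") auto
      have inc: "E j \<le> E (j+1)" if "a - 1 \<le> j" "j < b" for j
      proof -
        have "a \<le> Suc j" using that by linarith
        then show ?thesis unfolding Suc_eq_plus1[symmetric]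
          using E_Suc[of j] Sv(2)[of "Suc j"] S[of "Suc j"] that bm by simp
      qed
      have "E l = 0" if l: "a \<le> l" "l \<le> b" for l
      proof -
        have "E (a-1) \<le> E l" using inc l chain_mono[of "(a-1)" l E] by simp
        moreover have "E l \<le> E b" using inc l chain_mono[of "l" b E] by simp
        moreover have "E b \<le> 0" using fg[of b] b f0[of b] bm by simp
        ultimately show ?thesis using Ea by linarith
      qed
      then have "g l = f l" if "a \<le> l" "l < b" for l using fg[of l] that bm by simp
      then show ?thesis
        by (intro move[of a b 1 1]) (use a1 b bm fb S[of a] S[of b] in auto)
    qed
  next
    \<comment> \<open>The mirror image of the previous case: \<open>f\<close> and \<open>g\<close>
      exchange roles, pair sums of \<open>P\<close> are maximal instead of minimal, and
      \<open>E\<close> decreases.\<close>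
    case Sa: True
    then have "f a \<le> g a" using Ea' fg[of a] Sv(3)[of a] a1 am by simp
    then have ga1: "g a \<ge> 1" using a by linarith
    define b where "b = (LEAST l. a < l \<and> g l = 0)"
    have b: "a < b" "g b = 0" using LeastI[of "\<lambda>l. a < l \<and> g l = 0" m] am fm by (auto simp: b_def)
    have bm: "b \<le> m" unfolding b_def using am fm by (intro Least_le) simp
    have gb: "g l \<ge> 1" if "a \<le> l" "l < b" for l
      using not_less_Least[of l "\<lambda>l. a < l \<and> g l = 0"] that ga1 f0[of l] bm
      by (cases "l = a") (auto simp: b_def[symmetric])
    show ?thesis
    proof (cases "\<exists>b'. a < b' \<and> b' \<le> b \<and> S b' = c-1")
      case True
      then obtain b' where b': "a < b'" "b' \<le> b" "S b' = c-1" by blast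
      show ?thesis
        by (rule move[of a b' 0 1]) (use a1 b' bm Sa gb f0 in auto)
    next
      case none: False
      have S: "S j = c" if "a \<le> j" "j \<le> b" for j
        using none that Sa Sv(1)[of j] a1 bm by (cases "j = a") auto
      have dec: "- E j \<le> - E (j+1)" if "a - 1 \<le> j" "j < b" for j
      proof -
        have "a \<le> Suc j" using that by linarith
        then show ?thesis unfolding Suc_eq_plus1[symmetric]
          using E_Suc[of j] Sv(3)[of "Suc j"] S[of "Suc j"] that bm by simp
      qed
      have "E l = 0" if l: "a \<le> l" "l \<le> b" for l
      proof -
        have "- E (a-1) \<le> - E l" using dec l chain_mono[of "(a-1)" l "\<lambda>l. - E l"] by simp
        moreover have "- E l \<le> - E b" using dec l chain_mono[of "l" b "\<lambda>l. - E l"] by simp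
        moreover have "E b \<ge> 0" using fg[of b] b f0[of b] bm by simp
        ultimately show ?thesis using Ea by linarith
      qed
      then have "f l = g l" if "a \<le> l" "l < b" for l using fg[of l] that bm by simp
      then show ?thesis
        by (intro move[of a b 1 1]) (use a1 b bm gb S[of a] S[of b] in auto)
    qed
  qed
qed

section \<open>Chains of reflections at a vertex\<close>

text \<open>The coordinates of the vertex \<open>w \<omega>\<^sub>i\<close> for \<open>0 \<le> i \<le> m\<close>.\<close>
definition vtx :: "nat \<Rightarrow> aw \<Rightarrow> nat \<Rightarrow> int" where
  "vtx i w j = fst w j - (if inv (snd w) j \<le> i then 1 else 0)"

lemma omega_nat:
  assumes "m \<ge> 1" "i \<le> m"
  shows "omega (2*m) (int i) j = (if j \<in> {1..2*m} \<and> j \<le> i then -1 else 0)"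
proof -
  have "int i div int (2*m) = 0" "int i mod int (2*m) = int i" using assms by auto
  then show ?thesis by (simp add: omega_def)
qed

lemma act_omega_vtx:
  assumes "m \<ge> 1" "i \<le> m" "w \<in> Wt m" "j \<in> {1..2*m}"
  shows "aw_act w (omega (2*m) (int i)) j = of_int (vtx i w j)"
  using Wt_inv_range[OF assms(3,4)] by (simp add: aw_act_def omega_nat[OF assms(1,2)] vtx_def)

lemma vtx_rfl_mult:
  assumes "a \<in> {1..2*m}" "b \<in> {1..2*m}" "a \<noteq> b" "w \<in> Wt m"
  shows "vtx i (aw_mult (rfl m a b k) w) j = reflect m a b k (vtx i w) j"
proof -
  have inv: "inv (snd (aw_mult (rfl m a b k) w)) = inv (snd w) \<circ> snd (rfl m a b k)"
    using inv_snd_mult[OF Wt_bij[OF rfl_Wt[OF assms(1-3)]] Wt_bij[OF assms(4)]] inv_snd_rfl[OF assms(1-3)] by simp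
  show ?thesis
    unfolding vtx_def inv fst_mult inv_snd_rfl[OF assms(1-3)] reflect_def
    using opp_inj[OF assms(1,2)] assms(3) opp_opp[OF assms(1)] opp_opp[OF assms(2)]
    by (auto simp: rfl_def)
qed

text \<open>As \<open>i \<le> m\<close>, at most one of two opposite indices is
  \<open>\<le> i\<close>, so at most one of the two coordinates is lowered.\<close>

lemma vtx_pair:
  assumes "i \<le> m" "w \<in> Wt m" "j \<in> {1..2*m}"
  shows "vtx i w j + vtx i w (opp m j) \<in> {cen m w - 1, cen m w}"
proof -
  have "\<not> (inv (snd w) j \<le> i \<and> opp m (inv (snd w) j) \<le> i)"
    using assms(1) Wt_inv_range[OF assms(2,3)] by (auto simp: opp_def)
  then show ?thesis using Wt_cen[OF assms(2,3)] by (auto simp: vtx_def Wt_inv_opp[OF assms(2,3)])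
qed

lemma sum_vtx:
  assumes "m \<ge> 1" "i \<le> m" "w \<in> Wt m"
  shows "(\<Sum>j=1..2*m. vtx i w j) = int m * cen m w - int i"
proof -
  have "real_of_int (\<Sum>j=1..2*m. vtx i w j) = (\<Sum>j=1..2*m. aw_act w (omega (2*m) (int i)) j)"
    using act_omega_vtx[OF assms] by simp
  also have "\<dots> = of_int (int m * cen m w) + (\<Sum>j=1..2*m. omega (2*m) (int i) j)" by (rule sum_act[OF assms(3)])
  also have "(\<Sum>j=1..2*m. omega (2*m) (int i) j) = (\<Sum>j=1..i. -1)"
    using assms by (intro sum.mono_neutral_cong_right) (auto simp: omega_nat)
  finally have "real_of_int (\<Sum>j=1..2*m. vtx i w j) = of_int (int m * cen m w - int i)" by simp
  then show ?thesis by (simp only: of_int_eq_iff)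
qed

text \<open>A vertex of \<open>wA\<close> strictly on one side of a hyperplane puts
  \<open>wA\<close> there. Either description of the hyperplane may supply the strictness, since the
  two can differ on vertices outside \<open>Vsp m\<close>.\<close>

lemma pos_less_if_vtx_less:
  assumes "m \<ge> 1" "i \<le> m" "w \<in> Wt m" and ab: "a \<in> {1..2*m}" "b \<in> {1..2*m}" "a \<noteq> b"
    and "vtx i w a - vtx i w b < k \<or> vtx i w (opp m b) - vtx i w (opp m a) < k"
  shows "pos m w a - pos m w b < per m * k"
proof -
  have *: "pos m w c - pos m w d < per m * k"
    if "c \<in> {1..2*m}" "d \<in> {1..2*m}" "c \<noteq> d" "vtx i w c - vtx i w d < k" for c d
  proof (rule ccontr)
    assume "\<not> ?thesis"
    then have "pos m w c - pos m w d > per m * k" using pos_neq[OF assms(3) that(1-3), of k] by simp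
    then have "of_int k \<le> real_of_int (vtx i w c) - of_int (vtx i w d)"
      using weak_act_ge[OF omega_weak[OF assms(1), of "int i"] that(1,2) assms(3)]
        act_omega_vtx[OF assms(1-3)] that by simp
    then show False using that(4) by linarith
  qed
  have "opp m b \<noteq> opp m a" using ab opp_inj by blast
  then have "pos m w a - pos m w b < per m * k \<or> pos m w (opp m b) - pos m w (opp m a) < per m * k"
    using *[OF ab] *[OF opp_range[OF ab(2)] opp_range[OF ab(1)]] assms(7) by blast
  then show ?thesis using pos_opp[OF assms(3) ab(1)] pos_opp[OF assms(3) ab(2)] by auto
qed

lemma transl_Wt: "l \<in> Xstar m \<Longrightarrow> transl l \<in> Wt m"
  by (intro WtI) (simp_all add: transl_def Sstar_id)

lemma pos_transl_mult: "pos m (aw_mult (transl l) w) j = per m * l j + pos m w j"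
  by (simp add: pos_def transl_def aw_mult_def algebra_simps)

text \<open>Translation in the direction of \<kappa>, centred so that opposite coordinates cancel;
  doubling avoids the half-integer \<open>K/2\<close>.\<close>

definition dilation :: "nat \<Rightarrow> (nat \<Rightarrow> int) \<Rightarrow> int \<Rightarrow> int \<Rightarrow> aw" where
  "dilation m \<kappa> K M = transl (\<lambda>j. if j \<in> {1..2*m} then M * (2 * \<kappa> j - K) else 0)"

lemma dilation_Wt:
  assumes "\<And>j. j \<in> {1..2*m} \<Longrightarrow> \<kappa> j + \<kappa> (opp m j) = K"
  shows "dilation m \<kappa> K M \<in> Wt m"
  unfolding dilation_def
proof (intro transl_Wt XstarI[where c=0])
  fix j assume j: "j \<in> {1..2*m}"
  have "M * (2 * \<kappa> j - K) + M * (2 * \<kappa> (opp m j) - K) = 2 * M * (\<kappa> j + \<kappa> (opp m j) - K)"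
    by (simp add: algebra_simps)
  then show "(if j \<in> {1..2*m} then M * (2 * \<kappa> j - K) else 0) +
      (if opp m j \<in> {1..2*m} then M * (2 * \<kappa> (opp m j) - K) else 0) = 0"
    using j assms[OF j] opp_range[OF j] by simp
qed auto

lemma dilation_rfl:
  assumes K: "\<And>j. j \<in> {1..2*m} \<Longrightarrow> \<kappa> j + \<kappa> (opp m j) = K" and ab: "a \<in> {1..2*m}" "b \<in> {1..2*m}" "a \<noteq> b"
  shows "aw_mult (aw_mult (aw_inv (dilation m \<kappa> K M)) (rfl m a b k)) (dilation m \<kappa> K M)
    = rfl m a b (k - 2 * M * (\<kappa> a - \<kappa> b))"
proof -
  have e: "k - fst (dilation m \<kappa> K M) a + fst (dilation m \<kappa> K M) b = k - 2 * M * (\<kappa> a - \<kappa> b)"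
    "snd (dilation m \<kappa> K M) = id"
    using ab by (simp_all add: dilation_def transl_def algebra_simps)
  show ?thesis
    using rfl_conj[OF dilation_Wt[where \<kappa>=\<kappa> and K=K and M=M, OF K] ab, of k] by (simp only: e inv_id id_apply)
qed

lemma lcoset_eq:
  assumes "x \<in> Wt m" "h \<in> W_I m I"
  shows "lcoset (aw_mult x h) (W_I m I) = lcoset x (W_I m I)"
proof -
  interpret group "affW m" by (rule group_affW)
  interpret P: subgroup "W_I m I" "affW m" by (rule subgroup_W_I)
  have sub: "g \<in> Wt m" if "g \<in> W_I m I" for g using that by (simp add: W_I_def stab_in_def)
  have 1: "aw_mult h g \<in> W_I m I" if "g \<in> W_I m I" for g using P.m_closed[OF assms(2) that] by simp
  have 2: "aw_mult (aw_inv h) g \<in> W_I m I" if "g \<in> W_I m I" for g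
    using P.m_closed[OF P.m_inv_closed[OF assms(2)] that] sub[OF assms(2)] by simp
  have "aw_mult (aw_mult x h) g = aw_mult x (aw_mult h g)" if "g \<in> W_I m I" for g
    using m_assoc[of x h g] assms sub that by simp
  moreover have "aw_mult x g = aw_mult (aw_mult x h) (aw_mult (aw_inv h) g)" if "g \<in> W_I m I" for g
  proof -
    have "aw_mult (aw_mult x h) (aw_mult (aw_inv h) g) = aw_mult x (aw_mult (aw_mult h (aw_inv h)) g)"
      using assms sub that Wt_inv Wt_mult m_assoc by simp
    then show ?thesis using aw_inv_right[OF Wt_bij[OF sub[OF assms(2)]]] by simp
  qed
  ultimately show ?thesis unfolding lcoset_def using 1 2 by blast
qed

text \<open>Modulo constant vectors, an index congruent to \<open>-a\<close> gives the dual of the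
  vertex \<open>a\<close>, so one vertex controls the whole class of indices.\<close>

lemma omega_reduce:
  assumes m: "m \<ge> 1" and a: "a \<le> m" and i: "i \<in> idx (2*m) {a}"
  shows "\<exists>k. (\<forall>j\<in>{1..2*m}. omega (2*m) i j = omega (2*m) (int a) j + k) \<or>
    (\<forall>j\<in>{1..2*m}. omega (2*m) i j = - omega (2*m) (int a) (opp m j) + k)"
proof -
  let ?k = "- real_of_int (i div int (2*m))"
  have am: "int a mod int (2*m) = int a" using m a by simp
  consider "i mod int (2*m) = int a" | "i mod int (2*m) = (- int a) mod int (2*m)" "a > 0"
    using i am by (cases "a = 0") (auto simp: idx_def)
  then show ?thesis
  proof cases
    case 1
    then show ?thesis by (intro exI[of _ ?k]) (simp add: omega_nat[OF m a], simp add: omega_def)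
  next
    case 2
    have "(- int a) mod int (2*m) = int (2*m) - int a"
      using m a 2(2) by (simp add: zmod_zminus1_eq_if)
    then have e: "i mod int (2*m) = int (2*m - a)" using 2 a by simp
    have "omega (2*m) i j = - omega (2*m) (int a) (opp m j) + (?k - 1)" if j: "j \<in> {1..2*m}" for j
    proof -
      have "opp m j \<in> {1..2*m}" "opp m j \<le> a \<longleftrightarrow> \<not> j \<le> 2*m - a" using j a by (auto simp: opp_def)
      then show ?thesis unfolding omega_nat[OF m a] using j e by (simp add: omega_def)
    qed
    then show ?thesis by (intro exI[of _ "?k - 1"]) blast
  qed
qed

text \<open>A fixed point forces \<open>cen\<close> zero, so opposite translation parts cancel and
  \<open>g\<close> also fixes the dual vertex and all shifts by constants.\<close>

lemma W_I_singleton: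
  assumes m: "m \<ge> 1" and a: "a \<le> m" and g: "g \<in> Wt m"
    and fix_: "aw_act g (omega (2*m) (int a)) = omega (2*m) (int a)"
  shows "g \<in> W_I m {a}"
proof -
  let ?\<omega> = "omega (2*m) (int a)"
  have c: "cen m g = 0" using fix_cen[OF m g fix_] .
  have f: "of_int (fst g j) + ?\<omega> (inv (snd g) j) = ?\<omega> j" for j
    using fun_cong[OF fix_, of j] by (simp add: aw_act_def)
  have "aw_act g (omega (2*m) i) = omega (2*m) i" if i: "i \<in> idx (2*m) {a}" for i
  proof (rule ext)
    fix j
    show "aw_act g (omega (2*m) i) j = omega (2*m) i j"
    proof (cases "j \<in> {1..2*m}")
      case True
      note r = Wt_inv_range[OF g True]
      have o: "of_int (fst g (opp m j)) = - real_of_int (fst g j)" using Wt_cen[OF g True] c by linarith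
      obtain k where "(\<forall>j\<in>{1..2*m}. omega (2*m) i j = ?\<omega> j + k) \<or>
          (\<forall>j\<in>{1..2*m}. omega (2*m) i j = - ?\<omega> (opp m j) + k)"
        using omega_reduce[OF m a i] by blast
      then show ?thesis
      proof
        assume e: "\<forall>j\<in>{1..2*m}. omega (2*m) i j = ?\<omega> j + k"
        show ?thesis unfolding aw_act_def bspec[OF e r] bspec[OF e True] using f[of j] by linarith
      next
        assume e: "\<forall>j\<in>{1..2*m}. omega (2*m) i j = - ?\<omega> (opp m j) + k"
        show ?thesis unfolding aw_act_def bspec[OF e r] bspec[OF e True]
          using f[of "opp m j"] o Wt_inv_opp[OF g True] by simp
      qed
    next
      case False
      then show ?thesis
        using Xstar_zero[OF Wt_fst[OF g]] permutes_not_in[OF permutes_inv[OF Wt_permutes[OF g]]]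
        by (auto simp: aw_act_def omega_def)
    qed
  qed
  then show ?thesis using g by (simp add: W_I_def stab_in_def)
qed

lemma W_I_Inter: "I \<noteq> {} \<Longrightarrow> W_I m I = (\<Inter>a\<in>I. W_I m {a})"
  by (auto simp: W_I_def stab_in_def idx_def)

lemma Wt_subset_WGL: "w \<in> Wt m \<Longrightarrow> w \<in> WGL (2*m)"
  using Wt_permutes Xstar_zero[OF Wt_fst] by (auto simp: WGL_def)

lemma WGL_bij: "w \<in> WGL n \<Longrightarrow> bij (snd w)"
  by (auto simp: WGL_def permutes_bij)

lemma WGL_mult:
  assumes "u \<in> WGL n" "w \<in> WGL n"
  shows "aw_mult u w \<in> WGL n"
proof -
  have p: "snd u permutes {1..n}" "snd w permutes {1..n}" using assms by (simp_all add: WGL_def)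
  have "fst (aw_mult u w) j = 0" if "j \<notin> {1..n}" for j
    using assms that permutes_not_in[OF permutes_inv[OF p(1)] that] by (simp add: WGL_def fst_mult)
  then show ?thesis using permutes_compose[OF p(2,1)] by (simp add: WGL_def snd_mult)
qed

lemma emb_lcoset:
  assumes "w \<in> Wt m"
  shows "emb m I (lcoset w (W_I m I)) = lcoset w (WGL_pmI (2*m) I)"
proof -
  have sub: "h \<in> WGL_pmI (2*m) I" if "h \<in> W_I m I" for h
    using that Wt_subset_WGL by (auto simp: W_I_def WGL_pmI_def stab_in_def)
  have G: "h \<in> WGL (2*m)" if "h \<in> WGL_pmI (2*m) I" for h using that by (simp add: WGL_pmI_def stab_in_def)
  have cl: "aw_mult g h \<in> WGL_pmI (2*m) I" if "g \<in> WGL_pmI (2*m) I" "h \<in> WGL_pmI (2*m) I" for g h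
    using that WGL_mult aw_act_mult[OF WGL_bij[OF G[OF that(1)]] WGL_bij[OF G[OF that(2)]]]
    by (simp add: WGL_pmI_def stab_in_def)
  have one: "aw_one \<in> W_I m I" using Wt_one by (simp add: W_I_def stab_in_def)
  show ?thesis
  proof
    show "emb m I (lcoset w (W_I m I)) \<subseteq> lcoset w (WGL_pmI (2*m) I)"
    proof
      fix z assume "z \<in> emb m I (lcoset w (W_I m I))"
      then obtain g h where gh: "g \<in> W_I m I" "h \<in> WGL_pmI (2*m) I" "z = aw_mult (aw_mult w g) h"
        unfolding emb_def lcoset_def by blast
      then have "z = aw_mult w (aw_mult g h)"
        using aw_mult_assoc[OF Wt_bij[OF assms] WGL_bij[OF G[OF sub[OF gh(1)]]]] by simp
      then show "z \<in> lcoset w (WGL_pmI (2*m) I)" using cl[OF sub[OF gh(1)] gh(2)] unfolding lcoset_def by blast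
    qed
    show "lcoset w (WGL_pmI (2*m) I) \<subseteq> emb m I (lcoset w (W_I m I))"
      unfolding lcoset_def emb_def using one by (fastforce intro: aw_mult_one[symmetric])
  qed
qed

lemma permissible_W_I:
  assumes "w \<in> Wt m" "h \<in> WGL_pmI (2*m) I" "i \<in> idx (2*m) I"
  shows "permissible m i \<mu> (aw_mult w h) \<longleftrightarrow> permissible m i \<mu> w"
proof -
  have "bij (snd h)" "aw_act h (omega (2*m) i) = omega (2*m) i"
    using assms WGL_bij[of h "2*m"] by (auto simp: WGL_pmI_def stab_in_def)
  then show ?thesis using aw_act_mult[OF Wt_bij[OF assms(1)]] by (simp add: permissible_def)
qed

lemma Perm_GL_iff:
  assumes "w \<in> Wt m"
  shows "lcoset w (WGL_pmI (2*m) I) \<in> Perm_GL (2*m) I \<mu> \<longleftrightarrow> (\<forall>i\<in>idx (2*m) I. permissible m i \<mu> w)"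
proof -
  have "lcoset w (WGL_pmI (2*m) I) \<in> quot (WGL (2*m)) (WGL_pmI (2*m) I)"
    using Wt_subset_WGL[OF assms] unfolding quot_def by blast
  moreover have "(\<exists>v\<in>lcoset w (WGL_pmI (2*m) I). \<forall>i\<in>idx (2*m) I. permissible m i \<mu> v) \<longleftrightarrow>
      (\<forall>i\<in>idx (2*m) I. permissible m i \<mu> w)"
  proof -
    have "aw_one \<in> WGL_pmI (2*m) I" using Wt_subset_WGL[OF Wt_one] by (simp add: WGL_pmI_def stab_in_def)
    then have "w \<in> lcoset w (WGL_pmI (2*m) I)" unfolding lcoset_def using aw_mult_one[of w] by (metis (mono_tags, lifting) mem_Collect_eq)
    moreover have "\<forall>i\<in>idx (2*m) I. permissible m i \<mu> w"
      if v: "v \<in> lcoset w (WGL_pmI (2*m) I)" "\<forall>i\<in>idx (2*m) I. permissible m i \<mu> v" for v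
    proof -
      obtain h where "h \<in> WGL_pmI (2*m) I" "v = aw_mult w h" using v(1) unfolding lcoset_def by blast
      then show ?thesis using permissible_W_I[OF assms] v(2) by blast
    qed
    ultimately show ?thesis by blast
  qed
  ultimately show ?thesis by (simp add: Perm_GL_def permissible_def orbit_hull_def)
qed

lemma W_I_subset_WGL_pmI: "W_I m I \<subseteq> WGL_pmI (2*m) I"
  using Wt_subset_WGL by (auto simp: W_I_def WGL_pmI_def stab_in_def)

section \<open>Comparison with the dominant translation at a single vertex\<close>

context
  fixes m :: nat
  assumes m: "m \<ge> 1"
begin

interpretation reflection_cocycle "affW m" "rfls m" "Simple m" "seps m"
  by (rule reflection_cocycle_affW[OF m])

lemma permissible_le: "le x y \<Longrightarrow> permissible m i \<mu> y \<Longrightarrow> permissible m i \<mu> x"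
  by (induction rule: le.induct) (use permissible_reflect[OF m] in auto)

lemma dilation_le:
  assumes K: "\<And>j. j \<in> {1..2*m} \<Longrightarrow> \<kappa> j + \<kappa> (opp m j) = K"
    and z: "z \<in> Wt m" and ab: "a \<in> {1..2*m}" "b \<in> {1..2*m}" "a \<noteq> b"
    and up: "\<kappa> b < \<kappa> a" "pos m z a - pos m z b < per m * k" and M: "M \<ge> \<bar>k\<bar> + 1"
  shows "le (aw_mult (dilation m \<kappa> K M) z) (aw_mult (dilation m \<kappa> K M) (aw_mult (rfl m a b k) z))"
proof -
  define u where "u = dilation m \<kappa> K M"
  have uW: "u \<in> Wt m" using dilation_Wt[where \<kappa>=\<kappa> and K=K, OF K] by (simp add: u_def)
  define k' where "k' = k + 2 * M * (\<kappa> a - \<kappa> b)"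
  have r: "aw_mult (aw_mult (aw_inv u) (rfl m a b k')) u = rfl m a b k"
    using dilation_rfl[where \<kappa>=\<kappa> and K=K, OF K ab, of M k'] by (simp add: u_def k'_def)
  note W = rfl_Wt[OF ab, of k'] Wt_inv[OF uW]
  have "aw_mult u (aw_mult (rfl m a b k) z) = aw_mult (rfl m a b k') (aw_mult u z)"
    unfolding r[symmetric] using W uW z Wt_mult m_assoc[of u "aw_inv u"] m_assoc aw_inv_right[OF Wt_bij[OF uW]]
      mult_inv_cancel[of u "aw_mult (rfl m a b k') (aw_mult u z)"] by simp
  moreover have "rfl m a b k' \<notin> seps m (aw_mult u z)"
  proof -
    \<comment> \<open>Since \<open>\<kappa> a - \<kappa> b\<close> is a positive integer and
      \<open>M > \<bar>k\<bar>\<close>, the translated hyperplane has level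
      \<open>k' \<ge> 1\<close>, so the base alcove lies on its negative side.\<close>
    have "2 * M * 1 \<le> 2 * M * (\<kappa> a - \<kappa> b)" using up(1) M by (intro mult_left_mono) auto
    then have "1 \<le> k'" using M unfolding k'_def by linarith
    then have "per m * 1 \<le> per m * k'" using per_pos[of m] by (intro mult_left_mono) auto
    then have 1: "int a - int b < per m * k'" using range_diff[OF ab(1,2)] by linarith
    have "pos m (aw_mult u z) a - pos m (aw_mult u z) b
        = pos m z a - pos m z b + per m * (2 * M * (\<kappa> a - \<kappa> b))"
      using ab unfolding u_def dilation_def pos_transl_mult by (simp add: algebra_simps)
    also have "\<dots> < per m * k'" using up(2) by (simp add: k'_def distrib_left)
    finally show ?thesis using 1 rfl_in_seps[OF Wt_mult[OF uW z] ab] by (simp add: separates_def)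
  qed
  moreover have "rfl m a b k' \<in> rfls m" using ab by (auto simp: rfls_def)
  ultimately show ?thesis using le_up[of "aw_mult u z" "rfl m a b k'"] Wt_mult[OF uW z] by (simp add: u_def)
qed

text \<open>Induction on the total deficit. Each reflection is Bruhat increasing only after a
  translation that is large for its own \<open>k\<close>; the chain is finite, so one bound
  \<open>M0\<close> serves all steps. The end \<open>z\<close> agrees with \<open>y\<close> only at
  the vertex \<open>i\<close>.\<close>

lemma vertex_chain:
  assumes K: "\<And>j. j \<in> {1..2*m} \<Longrightarrow> \<kappa> j + \<kappa> (opp m j) = K" and \<pi>: "\<pi> \<in> Sstar m"
    and sorted: "\<And>i j. 1 \<le> i \<Longrightarrow> i < j \<Longrightarrow> j \<le> 2*m \<Longrightarrow> \<kappa> (\<pi> j) < \<kappa> (\<pi> i)"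
    and y: "y \<in> Wt m" and i: "i \<le> m"
    and x: "x \<in> Wt m" "cen m x = cen m y"
    and D: "\<And>k. k \<le> 2*m \<Longrightarrow> 0 \<le> deficit (\<lambda>j. vtx i x (\<pi> j)) (\<lambda>j. vtx i y (\<pi> j)) k"
  shows "\<exists>z M0. z \<in> Wt m \<and> (\<forall>j\<in>{1..2*m}. vtx i z j = vtx i y j) \<and>
    (\<forall>M\<ge>M0. le (aw_mult (dilation m \<kappa> K M) x) (aw_mult (dilation m \<kappa> K M) z))"
  using x D
proof (induction "nat (\<Sum>l\<le>2*m. deficit (\<lambda>j. vtx i x (\<pi> j)) (\<lambda>j. vtx i y (\<pi> j)) l)" arbitrary: x rule: less_induct)
  case less
  define P where "P w j = vtx i w (\<pi> j)" for w j
  note p = Sstar_permutes[OF \<pi>]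
  have surj: "\<exists>l\<in>{1..2*m}. j = \<pi> l" if "j \<in> {1..2*m}" for j
    using permutes_image[OF p] that by blast
  show ?case
  proof (cases "\<exists>j\<in>{1..2*m}. P x j \<noteq> P y j")
    case False
    then have "\<forall>j\<in>{1..2*m}. vtx i x j = vtx i y j" using surj by (force simp: P_def)
    then show ?thesis
      using le_refl Wt_mult dilation_Wt[where \<kappa>=\<kappa> and K=K, OF K] less(2) by (intro exI[of _ x] exI[of _ 0]) simp
  next
    case True
    have pair: "P w j + P w (opp m j) \<in> {cen m w - 1, cen m w}" if "w \<in> Wt m" "j \<in> {1..2*m}" for w j
      using vtx_pair[OF i that(1) Sstar_range[OF \<pi> that(2)]] Sstar_opp[OF \<pi> that(2)] by (simp add: P_def)
    have tot: "(\<Sum>j=1..2*m. P w j) = int m * cen m w - int i" if "w \<in> Wt m" for w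
      using sum.permute[OF p, of "vtx i w"] sum_vtx[OF m i that] by (simp add: P_def o_def)
    have D0: "deficit (P x) (P y) (2*m) = 0"
      using tot[OF less(2)] tot[OF y] less(3) by (simp add: deficit_def sum_subtractf)
    have D: "0 \<le> deficit (P x) (P y) k" if "k \<le> 2*m" for k using less(4)[OF that] by (simp add: P_def[abs_def])
    obtain a b k where ab: "1 \<le> a" "a < b" "b \<le> 2*m"
      and up: "P x a - P x b < k \<or> P x (opp m b) - P x (opp m a) < k"
      and D': "\<And>l. l \<le> 2*m \<Longrightarrow> 0 \<le> deficit (reflect m a b k (P x)) (P y) l"
      and lt: "(\<Sum>l\<le>2*m. deficit (reflect m a b k (P x)) (P y) l) < (\<Sum>l\<le>2*m. deficit (P x) (P y) l)"
      using exists_reflection_up[OF m, of "P x" "cen m x" "P y"] pair[OF less(2)] pair[OF y] less(3) D D0 True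
      by auto
    have r: "a \<in> {1..2*m}" "b \<in> {1..2*m}" using ab by auto
    define A B where "A = \<pi> a" and "B = \<pi> b"
    have AB: "A \<in> {1..2*m}" "B \<in> {1..2*m}" "A \<noteq> B"
      using Sstar_range[OF \<pi>] r ab permutes_inj[OF p] by (auto simp: A_def B_def dest: injD simp del: atLeastAtMost_iff)
    have AB': "\<pi> (opp m a) = opp m A" "\<pi> (opp m b) = opp m B"
      using Sstar_opp[OF \<pi>] r by (simp_all add: A_def B_def)
    have inj: "\<pi> c = \<pi> d \<longleftrightarrow> c = d" for c d using permutes_inj[OF p] by (metis injD)
    define x' where "x' = aw_mult (rfl m A B k) x"
    have x': "x' \<in> Wt m" using rfl_Wt[OF AB] Wt_mult less(2) by (simp add: x'_def)
    have cx': "cen m x' = cen m y"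
      using cen_mult[OF m rfl_Wt[OF AB] less(2)] cen_one_rfls(2)[OF m, of "rfl m A B k"] AB less(3)
      by (auto simp: x'_def rfls_def)
    have Px': "P x' j = reflect m a b k (P x) j" for j
      unfolding P_def x'_def vtx_rfl_mult[OF AB less(2)] reflect_def AB'[symmetric] unfolding A_def B_def inj ..
    have posu: "pos m x A - pos m x B < per m * k"
      using pos_less_if_vtx_less[OF m i less(2) AB] up AB' by (simp add: P_def A_def B_def)
    have "nat (\<Sum>l\<le>2*m. deficit (P x') (P y) l) < nat (\<Sum>l\<le>2*m. deficit (P x) (P y) l)"
    proof -
      have "0 \<le> (\<Sum>l\<le>2*m. deficit (P x') (P y) l)" using D' by (intro sum_nonneg) (simp add: Px'[abs_def])
      then show ?thesis using lt by (simp add: Px'[abs_def])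
    qed
    then obtain z M0 where z: "z \<in> Wt m" "\<forall>j\<in>{1..2*m}. vtx i z j = vtx i y j"
      "\<And>M. M \<ge> M0 \<Longrightarrow> le (aw_mult (dilation m \<kappa> K M) x') (aw_mult (dilation m \<kappa> K M) z)"
      using less(1)[of x'] x' cx' D' Px' by (auto simp: P_def[abs_def])
    have "\<kappa> B < \<kappa> A" using sorted[of a b] ab by (simp add: A_def B_def)
    then have "le (aw_mult (dilation m \<kappa> K M) x) (aw_mult (dilation m \<kappa> K M) x')" if "M \<ge> \<bar>k\<bar> + 1" for M
      using dilation_le[where \<kappa>=\<kappa> and K=K, OF K less(2) AB _ posu that] by (simp add: x'_def)
    then have "\<forall>M\<ge>max M0 (\<bar>k\<bar> + 1). le (aw_mult (dilation m \<kappa> K M) x) (aw_mult (dilation m \<kappa> K M) z)"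
      using z(3) le_trans by (meson max.boundedE)
    then show ?thesis using z by blast
  qed
qed

text \<open>The translation points in the direction in which \<open>x\<close> displaces the base
  point, so no hyperplane is crossed by one and crossed back by the other; lengths add and
  \<open>le_left_cancel\<close> applies.\<close>

lemma dilation_cancel:
  assumes x: "x \<in> Wt m" and K: "\<And>j. j \<in> {1..2*m} \<Longrightarrow> \<kappa> j + \<kappa> (opp m j) = K"
    and \<kappa>: "\<And>j. \<kappa> j = per m * (pos m x j - int j) - int j" and M: "M \<ge> 0" and z: "z \<in> Wt m"
    and le: "le (aw_mult (dilation m \<kappa> K M) x) (aw_mult (dilation m \<kappa> K M) z)"
  shows "le x z"
proof (rule le_left_cancel)
  define u where "u = dilation m \<kappa> K M"
  have uW: "u \<in> Wt m" using dilation_Wt[where \<kappa>=\<kappa> and K=K, OF K] by (simp add: u_def)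
  show "dilation m \<kappa> K M \<in> carrier (affW m)" "x \<in> carrier (affW m)" "z \<in> carrier (affW m)"
    using uW x z by (simp_all add: u_def)
  show "le (dilation m \<kappa> K M \<otimes>\<^bsub>affW m\<^esub> x) (dilation m \<kappa> K M \<otimes>\<^bsub>affW m\<^esub> z)" using le by simp
  fix t assume "t \<in> seps m (dilation m \<kappa> K M)"
  then obtain a b k where ab: "a \<in> {1..2*m}" "b \<in> {1..2*m}" "a \<noteq> b" "t = rfl m a b k"
    "int a - int b < per m * k" "pos m u a - pos m u b > per m * k"
    using seps_obtain[OF uW] unfolding u_def by metis
  define k' where "k' = k - 2 * M * (\<kappa> a - \<kappa> b)"
  have "pos m u a - pos m u b = int a - int b + per m * (2 * M * (\<kappa> a - \<kappa> b))"
    using pos_transl_mult[of m _ aw_one] ab(1,2) by (simp add: u_def dilation_def algebra_simps)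
  then have 1: "int a - int b > per m * k'" using ab(6) by (simp add: k'_def right_diff_distrib)
  have "\<not> pos m x a - pos m x b < per m * k'"
  proof
    assume less: "pos m x a - pos m x b < per m * k'"
    \<comment> \<open>Crossing back would need a negative relative displacement. The tie-break in
      \<kappa> is smaller than \<open>per m\<close>, so
      \<open>\<kappa> a - \<kappa> b \<le> 0\<close>; then the level \<open>k'\<close> is at least
      \<open>k\<close>, which contradicts the position of the base point.\<close>
    define \<delta> where "\<delta> = (pos m x a - int a) - (pos m x b - int b)"
    have "\<delta> < 0" using less 1 by (simp add: \<delta>_def)
    then have "per m * \<delta> \<le> per m * (-1)" using per_pos[of m] by (intro mult_left_mono) auto
    moreover have "\<kappa> a - \<kappa> b = per m * \<delta> - (int a - int b)" by (simp add: \<kappa> \<delta>_def algebra_simps)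
    ultimately have "\<kappa> a - \<kappa> b \<le> 0" using range_diff[OF ab(1,2)] by linarith
    then have "2 * M * (\<kappa> a - \<kappa> b) \<le> 0" using M by (simp add: mult_nonneg_nonpos)
    then have "k \<le> k'" by (simp add: k'_def)
    then have "per m * k \<le> per m * k'" using per_pos[of m] by (intro mult_left_mono) auto
    then show False using ab(5) 1 by linarith
  qed
  then have "\<not> separates m x a b k'" using 1 by (simp add: separates_def)
  moreover have "aw_mult (aw_mult (aw_inv u) t) u = rfl m a b k'"
    using dilation_rfl[where \<kappa>=\<kappa> and K=K, OF K ab(1-3), of M k] ab(4) by (simp add: u_def k'_def)
  ultimately show "m_inv (affW m) (dilation m \<kappa> K M) \<otimes>\<^bsub>affW m\<^esub> t \<otimes>\<^bsub>affW m\<^esub> dilation m \<kappa> K M \<notin> seps m x"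
    using rfl_in_seps[OF x ab(1-3)] uW by (simp flip: u_def)
qed

text \<open>The sum of the first \<open>k\<close> coordinates in the order \<pi> is a linear form;
  on the orbit of \<mu> under all permutations it is largest at \<nu>, which is sorted in this
  order, and the bound passes to the hull.\<close>

lemma permissible_deficit:
  assumes x: "x \<in> Wt m" and i: "i \<le> m" and perm: "permissible m (int i) \<mu> x" and \<mu>: "\<mu> \<in> Xstar m"
    and \<pi>: "\<pi> \<in> Sstar m" and \<rho>: "\<rho> permutes {1..2*m}"
    and sorted: "\<And>i j. 1 \<le> i \<Longrightarrow> i \<le> j \<Longrightarrow> j \<le> 2*m \<Longrightarrow> \<mu> (\<rho> j) \<le> \<mu> (\<rho> i)"
    and \<nu>: "\<And>j. \<nu> (\<pi> j) = \<mu> (\<rho> j)"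
  shows "k \<le> 2*m \<Longrightarrow> 0 \<le> deficit (\<lambda>j. vtx i x (\<pi> j)) (\<lambda>j. vtx i (transl \<nu>) (\<pi> j)) k"
    and "cen m x = \<mu> 1 + \<mu> (2*m)"
proof -
  define v where "v j = aw_act x (omega (2*m) (int i)) j - omega (2*m) (int i) j" for j
  have v: "v \<in> conv {of_int_vec (perm_vec \<sigma> \<mu>) |\<sigma>. \<sigma> permutes {1..2*m}}"
    using perm by (simp add: permissible_def orbit_hull_def v_def[abs_def])
  note p = Sstar_permutes[OF \<pi>]
  show "0 \<le> deficit (\<lambda>j. vtx i x (\<pi> j)) (\<lambda>j. vtx i (transl \<nu>) (\<pi> j)) k" if k: "k \<le> 2*m"
  proof -
    have vj: "v (\<pi> j) = of_int (vtx i x (\<pi> j) - vtx i (transl \<nu>) (\<pi> j) + \<mu> (\<rho> j))" if "j \<in> {1..2*m}" for j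
    proof -
      have "vtx i (transl \<nu>) (\<pi> j) = \<mu> (\<rho> j) - (if \<pi> j \<le> i then 1 else 0)" by (simp add: vtx_def transl_def \<nu>)
      then show ?thesis using act_omega_vtx[OF m i x Sstar_range[OF \<pi> that]] Sstar_range[OF \<pi> that]
        by (simp add: v_def omega_nat[OF m i])
    qed
    have "(\<Sum>j=1..k. 1 * v (\<pi> j)) \<le> of_int (\<Sum>j=1..k. \<mu> (\<rho> j))"
    proof (rule conv_sum_le[OF v])
      fix w assume "w \<in> {of_int_vec (perm_vec \<sigma> \<mu>) |\<sigma>. \<sigma> permutes {1..2*m}}"
      then obtain \<tau> where \<tau>: "\<tau> permutes {1..2*m}" "w = of_int_vec (perm_vec \<tau> \<mu>)" by blast
      define \<theta> where "\<theta> = inv \<rho> \<circ> (inv \<tau> \<circ> \<pi>)"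
      have "\<theta> permutes {1..2*m}" unfolding \<theta>_def
        using \<tau>(1) \<rho> p permutes_compose permutes_inv by metis
      then have "(\<Sum>j=1..k. \<mu> (\<rho> (\<theta> j))) \<le> (\<Sum>j=1..k. \<mu> (\<rho> j))"
        using sum_permuted_le[of "2*m" "\<lambda>j. \<mu> (\<rho> j)" \<theta> k] sorted k by blast
      moreover have "\<rho> (\<theta> j) = inv \<tau> (\<pi> j)" for j using permutes_inverses[OF \<rho>] by (simp add: \<theta>_def)
      ultimately have "(\<Sum>j=1..k. \<mu> (inv \<tau> (\<pi> j))) \<le> (\<Sum>j=1..k. \<mu> (\<rho> j))" by simp
      then have "real_of_int (\<Sum>j=1..k. \<mu> (inv \<tau> (\<pi> j))) \<le> of_int (\<Sum>j=1..k. \<mu> (\<rho> j))" by linarith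
      then show "(\<Sum>j=1..k. 1 * w (\<pi> j)) \<le> of_int (\<Sum>j=1..k. \<mu> (\<rho> j))"
        by (simp add: \<tau>(2) of_int_vec_def perm_vec_def)
    qed
    moreover have "(\<Sum>j=1..k. 1 * v (\<pi> j)) = of_int (\<Sum>j=1..k. vtx i x (\<pi> j) - vtx i (transl \<nu>) (\<pi> j) + \<mu> (\<rho> j))"
      using vj k by simp
    ultimately have "(\<Sum>j=1..k. vtx i x (\<pi> j) - vtx i (transl \<nu>) (\<pi> j) + \<mu> (\<rho> j)) \<le> (\<Sum>j=1..k. \<mu> (\<rho> j))"
      by (simp only: of_int_le_iff)
    then show ?thesis by (simp add: deficit_def sum.distrib sum_subtractf)
  qed
  have s\<mu>: "(\<Sum>j=1..2*m. \<mu> j) = int m * (\<mu> 1 + \<mu> (2*m))"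
    using sum_fst[OF transl_Wt[OF \<mu>]] by (simp add: transl_def cen_def)
  \<comment> \<open>The total sum is constant on the orbit; stated for arbitrary \<open>s\<close>,
    the inequality yields equality from \<open>s = 1\<close> and \<open>s = -1\<close>.\<close>
  have orb: "(\<Sum>j=1..2*m. s * w (id j)) \<le> s * of_int (int m * (\<mu> 1 + \<mu> (2*m)))"
    if "w \<in> {of_int_vec (perm_vec \<sigma> \<mu>) |\<sigma>. \<sigma> permutes {1..2*m}}" for w s
  proof -
    obtain \<tau> where \<tau>: "\<tau> permutes {1..2*m}" "w = of_int_vec (perm_vec \<tau> \<mu>)" using \<open>w \<in> _\<close> by blast
    have "(\<Sum>j=1..2*m. \<mu> (inv \<tau> j)) = (\<Sum>j=1..2*m. \<mu> j)"
      using sum.permute[OF permutes_inv[OF \<tau>(1)], of \<mu>] by (simp add: o_def)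
    then have "real_of_int (\<Sum>j=1..2*m. \<mu> (inv \<tau> j)) = of_int (int m * (\<mu> 1 + \<mu> (2*m)))" using s\<mu> by simp
    then show ?thesis by (simp add: \<tau>(2) of_int_vec_def perm_vec_def flip: sum_distrib_left)
  qed
  have "(\<Sum>j=1..2*m. v j) = of_int (int m * cen m x)"
    using sum_act[OF x, of "omega (2*m) (int i)"] by (simp add: v_def sum_subtractf)
  then have "s * of_int (int m * cen m x) \<le> s * of_int (int m * (\<mu> 1 + \<mu> (2*m)))" for s :: real
    using conv_sum_le[OF v, where s=s and h=id and J="{1..2*m}", OF orb] by (simp flip: sum_distrib_left)
  from this[of 1] this[of "-1"] have "int m * cen m x = int m * (\<mu> 1 + \<mu> (2*m))" by linarith
  then show "cen m x = \<mu> 1 + \<mu> (2*m)" using m by simp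
qed

end

section \<open>Admissible and permissible cosets\<close>

text \<open>\<open>per m * \<mu> c - c\<close> encodes the lexicographic order by value and then by
  index: \<open>per m\<close> exceeds every difference of indices.\<close>

lemma dominant_key:
  fixes \<mu> :: "nat \<Rightarrow> int"
  assumes "c \<in> {1..2*m}" "d \<in> {1..2*m}"
  shows "per m * \<mu> c - int c = per m * \<mu> d - int d \<Longrightarrow> c = d"
    and "per m * \<mu> d - int d < per m * \<mu> c - int c \<Longrightarrow> \<mu> d \<le> \<mu> c"
proof -
  note rd = range_diff[OF assms]
  {
    assume "per m * \<mu> c - int c = per m * \<mu> d - int d"
    then have "per m * (\<mu> c - \<mu> d) = int c - int d" by (simp add: algebra_simps)
    then show "c = d" using per_small[of m "\<mu> c - \<mu> d" "int c - int d"] rd by auto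
  next
    assume "per m * \<mu> d - int d < per m * \<mu> c - int c"
    then have "per m * (-1) < per m * (\<mu> c - \<mu> d)" using rd unfolding right_diff_distrib by linarith
    then show "\<mu> d \<le> \<mu> c" unfolding per_less_iff by simp
  }
qed

lemma perm_vec_Xstar:
  assumes "\<sigma> \<in> Sstar m" "\<mu> \<in> Xstar m"
  shows "perm_vec \<sigma> \<mu> \<in> Xstar m"
proof (rule XstarI)
  note s = Sstar_inv[OF assms(1)]
  fix j assume j: "j \<in> {1..2*m}"
  show "perm_vec \<sigma> \<mu> j + perm_vec \<sigma> \<mu> (opp m j) = \<mu> 1 + \<mu> (2*m)"
    using Xstar_pair[OF assms(2) Sstar_range[OF s j]] Sstar_opp[OF s j] by (simp add: perm_vec_def)
qed (use Xstar_zero[OF assms(2)] permutes_not_in[OF permutes_inv[OF Sstar_permutes[OF assms(1)]]] in \<open>simp add: perm_vec_def\<close>)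

lemma Adm_imp_permissible:
  assumes m: "m \<ge> 1" and I: "I \<noteq> {}" and \<mu>: "\<mu> \<in> Xstar m" and C: "C \<in> Adm m I \<mu>"
  shows "emb m I C \<in> Perm_GL (2*m) I \<mu>"
proof -
  interpret reflection_cocycle "affW m" "rfls m" "Simple m" "seps m"
    by (rule reflection_cocycle_affW[OF m])
  interpret P: subgroup "W_I m I" "affW m" by (rule subgroup_W_I)
  obtain x0 where x0: "x0 \<in> Wt m" "C = lcoset x0 (W_I m I)" using C by (auto simp: Adm_def quot_def)
  obtain \<sigma> where \<sigma>: "\<sigma> \<in> Sstar m" "quot_le m C (lcoset (transl (perm_vec \<sigma> \<mu>)) (W_I m I))"
    using C by (auto simp: Adm_def)
  define t where "t = transl (perm_vec \<sigma> \<mu>)"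
  have tW: "t \<in> Wt m" using transl_Wt[OF perm_vec_Xstar[OF \<sigma>(1) \<mu>]] by (simp add: t_def)
  obtain w w' where w: "minrep m C w" "minrep m (lcoset t (W_I m I)) w'" "ext_le m w w'"
    using \<sigma>(2) by (auto simp: quot_le_def t_def)
  obtain h where h: "h \<in> W_I m I" "w = aw_mult x0 h" using w(1) x0 unfolding minrep_def lcoset_def by blast
  obtain h' where h': "h' \<in> W_I m I" "w' = aw_mult t h'" using w(2) unfolding minrep_def lcoset_def by blast
  have wW: "w \<in> Wt m" using h x0 P.mem_carrier[OF h(1)] Wt_mult by simp
  have le: "le w w'" using w(3) ext_le_iff[OF m] by simp
  have "permissible m i \<mu> w" if i: "i \<in> idx (2*m) I" for i
  proof (rule permissible_le[OF m le])
    have "(\<lambda>j. aw_act t (omega (2*m) i) j - omega (2*m) i j) = of_int_vec (perm_vec \<sigma> \<mu>)"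
      by (simp add: t_def transl_def aw_act_def of_int_vec_def)
    then have "permissible m i \<mu> t"
      unfolding permissible_def orbit_hull_def using Sstar_permutes[OF \<sigma>(1)] by (auto intro!: conv_base)
    then show "permissible m i \<mu> w'"
      using permissible_W_I[OF tW _ i] W_I_subset_WGL_pmI h' by blast
  qed
  then have "lcoset w (WGL_pmI (2*m) I) \<in> Perm_GL (2*m) I \<mu>" using Perm_GL_iff[OF wW] by blast
  moreover have "C = lcoset w (W_I m I)" using lcoset_eq[OF x0(1) h(1)] h x0 by simp
  ultimately show ?thesis using emb_lcoset[OF wW] by simp
qed

lemma permissible_imp_Adm:
  assumes m: "m \<ge> 1" and I: "I \<subseteq> {0..m}" "I \<noteq> {}" and \<mu>: "\<mu> \<in> Xstar m"
    and C: "C \<in> quot (Wt m) (W_I m I)" "emb m I C \<in> Perm_GL (2*m) I \<mu>"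
  shows "C \<in> Adm m I \<mu>"
proof -
  interpret reflection_cocycle "affW m" "rfls m" "Simple m" "seps m"
    by (rule reflection_cocycle_affW[OF m])
  interpret P: reflection_parabolic "affW m" "rfls m" "Simple m" "seps m" "W_I m I"
    by (rule reflection_parabolic_W_I[OF m I(2)])
  have sub: "g \<in> Wt m" if "g \<in> W_I m J" for g J using that by (simp add: W_I_def stab_in_def)
  have minrep: "minrep m (lcoset u (W_I m I)) u" if u: "P.reduced u" for u
  proof -
    have uW: "u \<in> Wt m" using u by (simp add: P.reduced_def)
    have "u \<in> lcoset u (W_I m I)" using P.one_closed aw_mult_one[of u] unfolding lcoset_def
      by (metis (mono_tags, lifting) affW_simps(3) mem_Collect_eq)
    moreover have "ext_len m u \<le> ext_len m v" if v: "v \<in> lcoset u (W_I m I)" for v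
    proof -
      obtain h where h: "h \<in> W_I m I" "v = aw_mult u h" using v unfolding lcoset_def by blast
      then show ?thesis
        using P.reduced_mult_ell[OF u h(1)] ext_len_eq[OF m uW] ext_len_eq[OF m Wt_mult[OF uW sub[OF h(1)]]] by simp
    qed
    ultimately show ?thesis by (simp add: minrep_def)
  qed
  obtain x0 where x0: "x0 \<in> Wt m" "C = lcoset x0 (W_I m I)" using C(1) by (auto simp: quot_def)
  obtain x h0 where x: "P.reduced x" "h0 \<in> W_I m I" "x0 = aw_mult x h0"
    using P.exists_reduced[of x0] x0 by auto
  have xW: "x \<in> Wt m" using x by (simp add: P.reduced_def)
  have Cx: "C = lcoset x (W_I m I)" using lcoset_eq[OF xW x(2)] x(3) x0 by simp
  have perm: "permissible m i \<mu> x" if "i \<in> idx (2*m) I" for i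
    using that C(2) Perm_GL_iff[OF xW] emb_lcoset[OF xW] Cx by simp
  \<comment> \<open>The displacement of the base point under \<open>x\<close>, made injective by the
    index as in \<open>dominant_key\<close>.\<close>
  define \<kappa> where "\<kappa> j = per m * (pos m x j - int j) - int j" for j
  define K where "K = per m * (per m * cen m x) - per m"
  have K: "\<kappa> j + \<kappa> (opp m j) = K" if "j \<in> {1..2*m}" for j
    unfolding \<kappa>_def K_def pos_opp[OF xW that] int_opp[OF that] by (simp add: algebra_simps)
  have inj: "inj_on \<kappa> {1..2*m}"
    unfolding \<kappa>_def using dominant_key(1)[of _ m _ "\<lambda>j. pos m x j - int j"] by (intro inj_onI) blast
  obtain \<pi> where \<pi>: "\<pi> \<in> Sstar m" "\<And>i j. 1 \<le> i \<Longrightarrow> i < j \<Longrightarrow> j \<le> 2*m \<Longrightarrow> \<kappa> (\<pi> j) < \<kappa> (\<pi> i)"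
    using exists_Sstar_sort[OF inj K] by blast
  define \<kappa>\<mu> where "\<kappa>\<mu> j = per m * \<mu> j - int j" for j
  have K\<mu>: "\<kappa>\<mu> j + \<kappa>\<mu> (opp m j) = per m * (\<mu> 1 + \<mu> (2*m)) - per m" if "j \<in> {1..2*m}" for j
    unfolding \<kappa>\<mu>_def int_opp[OF that] Xstar_pair[OF \<mu> that, symmetric] by (simp add: algebra_simps)
  have inj\<mu>: "inj_on \<kappa>\<mu> {1..2*m}"
    unfolding \<kappa>\<mu>_def using dominant_key(1)[of _ m _ \<mu>] by (intro inj_onI) blast
  obtain \<rho> where \<rho>: "\<rho> \<in> Sstar m" "\<And>i j. 1 \<le> i \<Longrightarrow> i < j \<Longrightarrow> j \<le> 2*m \<Longrightarrow> \<kappa>\<mu> (\<rho> j) < \<kappa>\<mu> (\<rho> i)"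
    using exists_Sstar_sort[OF inj\<mu> K\<mu>] by blast
  have dom: "\<mu> (\<rho> j) \<le> \<mu> (\<rho> i)" if "1 \<le> i" "i \<le> j" "j \<le> 2*m" for i j
  proof (cases "i = j")
    case False
    then have "\<kappa>\<mu> (\<rho> j) < \<kappa>\<mu> (\<rho> i)" using \<rho>(2) that by simp
    moreover have "\<rho> i \<in> {1..2*m}" "\<rho> j \<in> {1..2*m}" using Sstar_range[OF \<rho>(1)] that by simp_all
    ultimately show ?thesis using dominant_key(2) by (simp add: \<kappa>\<mu>_def)
  qed simp
  note p = Sstar_permutes[OF \<pi>(1)] Sstar_permutes[OF \<rho>(1)]
  \<comment> \<open>Places the entries of \<mu>, in decreasing order, at the coordinates in
    decreasing order of \<kappa>.\<close>
  define \<sigma> where "\<sigma> = \<pi> \<circ> inv \<rho>"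
  have \<sigma>: "\<sigma> \<in> Sstar m" using Sstar_comp \<pi>(1) Sstar_inv[OF \<rho>(1)] by (simp add: \<sigma>_def)
  define \<nu> where "\<nu> = perm_vec \<sigma> \<mu>"
  have "inv \<sigma> = \<rho> \<circ> inv \<pi>"
    unfolding \<sigma>_def using o_inv_distrib[OF permutes_bij[OF p(1)] permutes_bij[OF permutes_inv[OF p(2)]]]
      inv_inv_eq[OF permutes_bij[OF p(2)]] by simp
  then have \<nu>\<pi>: "\<nu> (\<pi> j) = \<mu> (\<rho> j)" for j using permutes_inverses[OF p(1)] by (simp add: \<nu>_def perm_vec_def)
  define y where "y = transl \<nu>"
  have yW: "y \<in> Wt m" using transl_Wt[OF perm_vec_Xstar[OF \<sigma> \<mu>]] by (simp add: y_def \<nu>_def)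
  have cy: "cen m y = \<mu> 1 + \<mu> (2*m)"
  proof -
    have 1: "1 \<in> {1..2*m}" "opp m 1 = 2*m" using m by (auto simp: opp_def)
    have "cen m y = \<nu> 1 + \<nu> (2*m)" by (simp add: y_def cen_def transl_def)
    also have "\<dots> = \<mu> 1 + \<mu> (2*m)"
      using Xstar_pair[OF \<mu> Sstar_range[OF Sstar_inv[OF \<sigma>] 1(1)]] Sstar_opp[OF Sstar_inv[OF \<sigma>] 1(1)] 1(2)
      by (simp add: \<nu>_def perm_vec_def)
    finally show ?thesis .
  qed
  have chain: "\<exists>z\<in>Wt m. aw_mult (aw_inv y) z \<in> W_I m {a} \<and> le x z" if a: "a \<in> I" for a
  proof -
    have am: "a \<le> m" using a I by auto
    have ia: "int a \<in> idx (2*m) I" using a by (auto simp: idx_def)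
    have D: "0 \<le> deficit (\<lambda>j. vtx a x (\<pi> j)) (\<lambda>j. vtx a y (\<pi> j)) k" if "k \<le> 2*m" for k
      unfolding y_def
      by (rule permissible_deficit(1)[OF m xW am perm[OF ia] \<mu> \<pi>(1) p(2)]) (fact dom \<nu>\<pi> that)+
    have cx: "cen m x = cen m y"
      unfolding cy by (rule permissible_deficit(2)[OF m xW am perm[OF ia] \<mu> \<pi>(1) p(2)]) (fact dom \<nu>\<pi>)+
    have "\<exists>z M0. z \<in> Wt m \<and> (\<forall>j\<in>{1..2*m}. vtx a z j = vtx a y j) \<and>
        (\<forall>M\<ge>M0. le (aw_mult (dilation m \<kappa> K M) x) (aw_mult (dilation m \<kappa> K M) z))"
      by (rule vertex_chain[OF m]) (fact K \<pi> yW am xW cx D)+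
    then obtain z M0 where z: "z \<in> Wt m" "\<forall>j\<in>{1..2*m}. vtx a z j = vtx a y j"
      "\<And>M. M \<ge> M0 \<Longrightarrow> le (aw_mult (dilation m \<kappa> K M) x) (aw_mult (dilation m \<kappa> K M) z)"
      by blast
    \<comment> \<open>\<open>M\<close> is the bound of the chain, raised to \<open>0\<close> because
      cancellation requires a nonnegative multiple.\<close>
    have "le x z"
      by (rule dilation_cancel[OF m xW _ _ _ z(1) z(3)[of "max M0 0"]]) (fact K \<kappa>_def | simp)+
    moreover have "aw_mult (aw_inv y) z \<in> W_I m {a}"
    proof (rule W_I_singleton[OF m am Wt_mult[OF Wt_inv[OF yW] z(1)]])
      let ?\<omega> = "omega (2*m) (int a)"
      have "aw_act z ?\<omega> = aw_act y ?\<omega>"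
      proof (rule ext)
        fix j
        show "aw_act z ?\<omega> j = aw_act y ?\<omega> j"
        proof (cases "j \<in> {1..2*m}")
          case True
          then show ?thesis using act_omega_vtx[OF m am z(1) True] act_omega_vtx[OF m am yW True] z(2) by simp
        next
          case False
          then show ?thesis
            using Xstar_zero[OF Wt_fst[OF z(1)]] permutes_not_in[OF permutes_inv[OF Wt_permutes[OF z(1)]]]
              Xstar_zero[OF Wt_fst[OF yW]] permutes_not_in[OF permutes_inv[OF Wt_permutes[OF yW]]]
            by (simp add: aw_act_def)
        qed
      qed
      then show "aw_act (aw_mult (aw_inv y) z) ?\<omega> = ?\<omega>"
        using aw_act_mult[OF Wt_bij[OF Wt_inv[OF yW]] Wt_bij[OF z(1)]]
          aw_act_mult[OF Wt_bij[OF Wt_inv[OF yW]] Wt_bij[OF yW], of ?\<omega>] aw_inv_left[OF Wt_bij[OF yW]] by simp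
    qed
    ultimately show ?thesis using z(1) by blast
  qed
  obtain u h where u: "P.reduced u" "h \<in> W_I m I" "y = aw_mult u h"
    using P.exists_reduced[of y] yW by auto
  have uW: "u \<in> Wt m" using u by (simp add: P.reduced_def)
  have "le x u"
  proof (rule deodhar[OF _ P.reflection_parabolic_axioms W_I_Inter[OF I(2)] I(2) x(1) u(1)])
    fix a assume a: "a \<in> I"
    show "reflection_parabolic (affW m) (rfls m) (Simple m) (seps m) (W_I m {a})"
      by (rule reflection_parabolic_W_I[OF m]) simp
    interpret Q: subgroup "W_I m {a}" "affW m" by (rule subgroup_W_I)
    obtain z where z: "z \<in> Wt m" "aw_mult (aw_inv y) z \<in> W_I m {a}" "le x z" using chain[OF a] by blast
    have hQ: "h \<in> W_I m {a}" using u(2) a W_I_Inter[OF I(2)] by blast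
    \<comment> \<open>\<open>y\<close> and its reduced representative \<open>u\<close> differ by
      \<open>h\<close>, which fixes all vertices; so \<open>z\<close>, which agrees with
      \<open>y\<close> modulo the stabilizer of the vertex \<open>a\<close>, also lies in the coset
      of \<open>u\<close>.\<close>
    define b where "b = aw_mult h (aw_mult (aw_inv y) z)"
    have "b \<in> W_I m {a}" using Q.m_closed[OF hQ z(2)] by (simp add: b_def)
    moreover have "aw_mult u b = z"
    proof -
      have "aw_mult u b = aw_mult y (aw_mult (aw_inv y) z)"
        unfolding b_def using m_assoc[of u h "aw_mult (aw_inv y) z"] uW sub[OF hQ] sub[OF z(2)] u(3) by simp
      then show ?thesis using mult_inv_cancel[of y z] yW z(1) by simp
    qed
    ultimately show "\<exists>c\<in>W_I m {a}. \<exists>b\<in>W_I m {a}. le (x \<otimes>\<^bsub>affW m\<^esub> c) (u \<otimes>\<^bsub>affW m\<^esub> b)"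
      using Q.one_closed z(3) by (intro bexI[of _ aw_one] bexI[of _ b]) auto
  qed
  then have "ext_le m x u" using ext_le_iff[OF m] by simp
  moreover have "lcoset y (W_I m I) = lcoset u (W_I m I)" using lcoset_eq[OF uW u(2)] u(3) by simp
  ultimately have "quot_le m C (lcoset y (W_I m I))"
    unfolding quot_le_def Cx using minrep[OF x(1)] minrep[OF u(1)] by metis
  then show ?thesis using C(1) \<sigma> by (auto simp: Adm_def y_def \<nu>_def)
qed

theorem theorem6p3p2:
  fixes m :: nat and I :: "nat set" and \<mu> :: "nat \<Rightarrow> int"
  assumes "m \<ge> 1" and "I \<subseteq> {0..m}" and "I \<noteq> {}" and "\<mu> \<in> Xstar m"
  shows "Adm m I \<mu> = {C \<in> quot (Wt m) (W_I m I). emb m I C \<in> Perm_GL (2*m) I \<mu>}"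
  using Adm_imp_permissible[OF assms(1,3,4)] permissible_imp_Adm[OF assms]
  by (auto simp: Adm_def)

end
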